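(* Let $\boldsymbol\sigma=\{\sigma_i\}_{i=1}^d$ be a shape partition of a nonnegative tensor $\mathcal A\in\mathbb R_+^{N_1\times\cdots\times N_m}$ and let $\mathbf p=(p_1,\ldots,p_d)\in(1,\infty)^d$. Suppose that either $\mathcal A$ is $\boldsymbol\sigma$-strictly nonnegative and $\sum_{i=1}^d|\sigma_i|/p_i<1$, or $\mathcal A$ is $\boldsymbol\sigma$-weakly irreducible and $\sum_{i=1}^d|\sigma_i|/p_i=1$. Let $\bar{\mathbf x}$ be the unique positive $(\boldsymbol\sigma,\mathbf p)$-eigenvector of $\mathcal A$ and $\bar\lambda=r^{(\boldsymbol\sigma,\mathbf p)}(\mathcal A)$. Then the sequences $\{\mathbf x^k\}$ and $\{\lambda_k\}$ generated by the algorithm LS-NNM (described in the context) converge quadratically to $\bar{\mathbf x}$ and $\bar\lambda$, respectively. Moreover, $\alpha_k=1$ for all sufficiently large $k$.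
   Context: Notation: $[n]=\{1,\ldots,n\}$; $\mathbb R_+$ and $\mathbb R_{++}$ are the nonnegative and positive reals; $\|\cdot\|_p$ is the $\ell_p$-norm, $\|\cdot\|$ the Euclidean norm; $\circ$ is the entrywise product; inequalities of vectors are entrywise; $D$ denotes the Jacobian. A sequence $\{v_k\}$ converges quadratically to $\bar v$ if $v_k\to\bar v$ and there is a constant $K$ with $\|v_{k+1}-\bar v\|\le K\|v_k-\bar v\|^2$ for all sufficiently large $k$. Shape partition: a partition $\boldsymbol\sigma=\{\sigma_i\}_{i=1}^d$ of $[m]$ such that (a) $N_j=N_{j'}$ for all $j,j'\in\sigma_i$ and all $i$; (b) $j\le k$ for all $j\in\sigma_i$, $k\in\sigma_{i+1}$; (c) $|\sigma_i|\le|\sigma_{i+1}|$ for $i\in[d-1]$. Put $\nu_i=|\sigma_i|$, $s_i=\min\sigma_i$, $n_i=N_{s_i}$. Let $\mathbb R^{\boldsymbol\sigma}=\mathbb R^{n_1}\times\cdots\times\mathbb R^{n_d}$, with elements $\mathbf x=(\mathbf x_1,\ldots,\mathbf x_d)$, $\mathbf x_i=(x_{i,1},\ldots,x_{i,n_i})$, and $\mathbb R^{\boldsymbol\sigma}_{+}$, $\mathbb R^{\boldsymbol\sigma}_{++}$ the subsets of entrywise nonnegative, resp. positive, elements. For $\mathbf x\in\mathbb R^{\boldsymbol\sigma}$, $\mathbf x^{[\boldsymbol\sigma]}=(\mathbf x_1,\ldots,\mathbf x_1,\ldots,\mathbf x_d,\ldots,\mathbf x_d)$ with $\mathbf x_i$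 repeated $\nu_i$ times. For $\mathcal A=(a_{j_1\cdots j_m})$, $i\in[m]$, $j_i\in[N_i]$ and $(\mathbf z_1,\ldots,\mathbf z_m)\in\mathbb R^{N_1}\times\cdots\times\mathbb R^{N_m}$, $\mathscr A_{i,j_i}(\mathbf z_1,\ldots,\mathbf z_m)=\sum_{j_l\in[N_l],\,l\ne i}a_{j_1\cdots j_m}\prod_{l\neq i}z_{l,j_l}$, and $\mathscr A_i=(\mathscr A_{i,1},\ldots,\mathscr A_{i,N_i})$. A pair $(\lambda,\mathbf x)\in\mathbb R\times\mathbb R^{\boldsymbol\sigma}$ is a $(\boldsymbol\sigma,\mathbf p)$-eigenpair of $\mathcal A$ ($\lambda$ an eigenvalue, $\mathbf x$ an eigenvector) if $\mathscr A_{s_i}(\mathbf x^{[\boldsymbol\sigma]})=\lambda\,\psi_{p_i}(\mathbf x_i)$ and $\|\mathbf x_i\|_{p_i}=1$ for all $i\in[d]$, where $\psi_{p}(\mathbf v)$ has entries $|v_j|^{p-1}\mathrm{sign}(v_j)$. The $(\boldsymbol\sigma,\mathbf p)$-spectral radius is $r^{(\boldsymbol\sigma,\mathbf p)}(\mathcal A)=\sup\{|\lambda|:\lambda\text{ is a }(\boldsymbol\sigma,\mathbf p)\text{-eigenvalue of }\mathcal A\}$. Let $M$ be the square matrix of size $n_1+\cdots+n_d$ with $M_{(i,t_i),(j,l_j)}=\frac{\partial}{\partial x_{j,l_j}}\mathscr A_{s_i,t_i}(\mathbf x^{[\boldsymbol\sigma]})\big|_{\mathbf x=\mathbf 1}$.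 The nonnegative tensor $\mathcal A$ is $\boldsymbol\sigma$-strictly nonnegative if every row of $M$ has a nonzero entry, and $\boldsymbol\sigma$-weakly irreducible if $M$ is irreducible. By the known Perron–Frobenius theorem of Gautier, Tudisco and Hein, under the hypotheses of the claim $\mathcal A$ has a unique positive $(\boldsymbol\sigma,\mathbf p)$-eigenvector, and its eigenvalue is $r^{(\boldsymbol\sigma,\mathbf p)}(\mathcal A)$. Functions: for $\mathbf x\in\mathbb R^{\boldsymbol\sigma}_{++}$, $\Phi_{i,j_i}(\mathbf x)=\mathscr A_{s_i,j_i}(\mathbf x^{[\boldsymbol\sigma]})/x_{i,j_i}^{p_i-1}$, $\Phi=(\Phi_{i,j_i})$, $\phi(\mathbf x)=\max_{i\in[d],j_i\in[n_i]}\Phi_{i,j_i}(\mathbf x)$; $c(\mathbf x)=\|\mathbf x_1\|_{p_1}\cdots\|\mathbf x_d\|_{p_d}$; $C=\{\mathbf x\in\mathbb R^{\boldsymbol\sigma}_{++}:c(\mathbf x)=1\}$; $R(\mathbf x)=\mathbf x/\sqrt[d]{c(\mathbf x)}$ for $c(\mathbf x)\neq0$; $r(\mathbf x,\lambda)=-\Phi(\mathbf x)\circ\mathbf x+\lambda\mathbf x$; $H(\mathbf x,\lambda)=\begin{pmatrix}r(\mathbf x,\lambda)\\ c(\mathbf x)-1\end{pmatrix}$ for $(\mathbf x,\lambda)\in\mathbb R^{\boldsymbol\sigma}_{++}\times\mathbb R_{++}$. Algorithm LS-NNM. Given scalars $\sigma\in(0,1)$, $\rho\in(0,1)$ (the scalar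 $\sigma$ is unrelated to the partition $\boldsymbol\sigma$) and $\mathbf u^0\in C$, set $\mathbf x^0=R(\mathbf u^0)$, $\lambda_0=\phi(\mathbf x^0)$, $k=0$. While $H(\mathbf x^k,\lambda_k)\ne0$: (1) compute $(\mathbf d^k,\delta_k)\in\mathbb R^{\boldsymbol\sigma}\times\mathbb R$ solving $DH(\mathbf x^k,\lambda_k)\begin{pmatrix}\mathbf d^k\\ \delta_k\end{pmatrix}+H(\mathbf x^k,\lambda_k)=0$; (2) let $\alpha_k$ be the largest element of $\{\rho^i:i=0,1,\ldots\}$ with $\mathbf x^k+\alpha_k\mathbf d^k>0$ and $\phi(R(\mathbf x^k+\alpha_k\mathbf d^k))\le\phi(\mathbf x^k)+\sigma\alpha_k\delta_k$; (3) set $\mathbf x^{k+1}=R(\mathbf x^k+\alpha_k\mathbf d^k)$, $\lambda_{k+1}=\phi(\mathbf x^{k+1})$, $k\leftarrow k+1$. If the algorithm stops at some $k$ (i.e. $H(\mathbf x^k,\lambda_k)=0$), the sequences are understood to be continued by $\mathbf x^j=\mathbf x^k$, $\lambda_j=\lambda_k$, $\mathbf d^j=0$, $\delta_j=0$, $\alpha_j=1$ for the remaining indices $j\ge k$. *)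

theory Defs
  imports "HOL-Analysis.Analysis"
begin

text \<open>
  A tensor in \<open>R^{N_1 x ... x N_m}\<close> is a function on multi-indices; an element of
  \<open>R^\<sigma> = R^{n_1} x ... x R^{n_d}\<close> is a function \<open>x\<close> with \<open>x (i, t)\<close> the entry \<open>x_{i,t}\<close>.
  Only the values on the respective finite index sets (indices start at 1) are meaningful: every
  definition below depends on these values only, and equality of elements of \<open>R^\<sigma>\<close> is
  always stated on the index set.
\<close>

type_synonym bvec = "nat \<times> nat \<Rightarrow> real"

definition multi_idx :: "nat \<Rightarrow> (nat \<Rightarrow> nat) \<Rightarrow> (nat \<Rightarrow> nat) set" where
  "multi_idx m N = (\<Pi>\<^sub>E l\<in>{1..m}. {1..N l})"

definition nonneg_tensor :: "nat \<Rightarrow> (nat \<Rightarrow> nat) \<Rightarrow> ((nat \<Rightarrow> nat) \<Rightarrow> real) \<Rightarrow> bool" where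
  "nonneg_tensor m N a \<longleftrightarrow> (\<forall>j\<in>multi_idx m N. 0 \<le> a j)"

definition shape_partition :: "nat \<Rightarrow> (nat \<Rightarrow> nat) \<Rightarrow> nat \<Rightarrow> (nat \<Rightarrow> nat set) \<Rightarrow> bool" where
  "shape_partition m N d \<sigma> \<longleftrightarrow>
     partition_on {1..m} (\<sigma> ` {1..d}) \<and> inj_on \<sigma> {1..d} \<and>
     (\<forall>i\<in>{1..d}. \<forall>j\<in>\<sigma> i. \<forall>j'\<in>\<sigma> i. N j = N j') \<and>
     (\<forall>i\<in>{1..<d}. \<forall>j\<in>\<sigma> i. \<forall>k\<in>\<sigma> (Suc i). j \<le> k) \<and>
     (\<forall>i\<in>{1..<d}. card (\<sigma> i) \<le> card (\<sigma> (Suc i)))"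

definition s_idx :: "(nat \<Rightarrow> nat set) \<Rightarrow> nat \<Rightarrow> nat" where
  "s_idx \<sigma> i = Min (\<sigma> i)"

definition n_dim :: "(nat \<Rightarrow> nat) \<Rightarrow> (nat \<Rightarrow> nat set) \<Rightarrow> nat \<Rightarrow> nat" where
  "n_dim N \<sigma> i = N (s_idx \<sigma> i)"

definition idx :: "(nat \<Rightarrow> nat) \<Rightarrow> nat \<Rightarrow> (nat \<Rightarrow> nat set) \<Rightarrow> (nat \<times> nat) set" where
  "idx N d \<sigma> = (SIGMA i:{1..d}. {1..n_dim N \<sigma> i})"

definition positive_vec :: "(nat \<Rightarrow> nat) \<Rightarrow> nat \<Rightarrow> (nat \<Rightarrow> nat set) \<Rightarrow> bvec \<Rightarrow> bool" where
  "positive_vec N d \<sigma> x \<longleftrightarrow> (\<forall>b\<in>idx N d \<sigma>. 0 < x b)"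

definition block_of :: "nat \<Rightarrow> (nat \<Rightarrow> nat set) \<Rightarrow> nat \<Rightarrow> nat" where
  "block_of d \<sigma> l = (THE i. i \<in> {1..d} \<and> l \<in> \<sigma> i)"

text \<open>
  \<open>x^{[\<sigma>]}\<close>: the blocks of a shape partition are consecutive intervals of modes, so
  repeating \<open>x_i\<close> as often as \<open>\<sigma> i\<close> has elements puts \<open>x_i\<close> exactly in the modes \<open>l \<in> \<sigma> i\<close>.
\<close>

definition repeat_blocks :: "nat \<Rightarrow> (nat \<Rightarrow> nat set) \<Rightarrow> bvec \<Rightarrow> nat \<Rightarrow> nat \<Rightarrow> real" where
  "repeat_blocks d \<sigma> x = (\<lambda>l t. x (block_of d \<sigma> l, t))"

definition tensor_map ::
  "nat \<Rightarrow> (nat \<Rightarrow> nat) \<Rightarrow> ((nat \<Rightarrow> nat) \<Rightarrow> real) \<Rightarrow> nat \<Rightarrow> nat \<Rightarrow> (nat \<Rightarrow> nat \<Rightarrow> real) \<Rightarrow> real" where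
  "tensor_map m N a i t z =
     (\<Sum>j\<in>{j \<in> multi_idx m N. j i = t}. a j * (\<Prod>l\<in>{1..m} - {i}. z l (j l)))"

text \<open>The function \<open>x \<mapsto> A_{s_i,t}(x^{[\<sigma>]})\<close>.\<close>

definition block_map ::
  "nat \<Rightarrow> (nat \<Rightarrow> nat) \<Rightarrow> ((nat \<Rightarrow> nat) \<Rightarrow> real) \<Rightarrow> nat \<Rightarrow> (nat \<Rightarrow> nat set) \<Rightarrow> nat \<times> nat \<Rightarrow> bvec \<Rightarrow> real"
  where
  "block_map m N a d \<sigma> b x = tensor_map m N a (s_idx \<sigma> (fst b)) (snd b) (repeat_blocks d \<sigma> x)"

definition block_norm ::
  "(nat \<Rightarrow> nat) \<Rightarrow> (nat \<Rightarrow> nat set) \<Rightarrow> (nat \<Rightarrow> real) \<Rightarrow> bvec \<Rightarrow> nat \<Rightarrow> real" where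
  "block_norm N \<sigma> p x i = (\<Sum>t\<in>{1..n_dim N \<sigma> i}. \<bar>x (i, t)\<bar> powr p i) powr (1 / p i)"

definition is_eigenpair ::
  "nat \<Rightarrow> (nat \<Rightarrow> nat) \<Rightarrow> ((nat \<Rightarrow> nat) \<Rightarrow> real) \<Rightarrow> nat \<Rightarrow> (nat \<Rightarrow> nat set) \<Rightarrow> (nat \<Rightarrow> real)
    \<Rightarrow> real \<Rightarrow> bvec \<Rightarrow> bool" where
  "is_eigenpair m N a d \<sigma> p \<mu> x \<longleftrightarrow>
     (\<forall>i\<in>{1..d}.
        (\<forall>t\<in>{1..n_dim N \<sigma> i}.
           block_map m N a d \<sigma> (i, t) x = \<mu> * (\<bar>x (i, t)\<bar> powr (p i - 1) * sgn (x (i, t)))) \<and>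
        block_norm N \<sigma> p x i = 1)"

definition is_eigenvector ::
  "nat \<Rightarrow> (nat \<Rightarrow> nat) \<Rightarrow> ((nat \<Rightarrow> nat) \<Rightarrow> real) \<Rightarrow> nat \<Rightarrow> (nat \<Rightarrow> nat set) \<Rightarrow> (nat \<Rightarrow> real)
    \<Rightarrow> bvec \<Rightarrow> bool" where
  "is_eigenvector m N a d \<sigma> p x \<longleftrightarrow> (\<exists>\<mu>. is_eigenpair m N a d \<sigma> p \<mu> x)"

definition is_eigenvalue ::
  "nat \<Rightarrow> (nat \<Rightarrow> nat) \<Rightarrow> ((nat \<Rightarrow> nat) \<Rightarrow> real) \<Rightarrow> nat \<Rightarrow> (nat \<Rightarrow> nat set) \<Rightarrow> (nat \<Rightarrow> real)
    \<Rightarrow> real \<Rightarrow> bool" where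
  "is_eigenvalue m N a d \<sigma> p \<mu> \<longleftrightarrow> (\<exists>x. is_eigenpair m N a d \<sigma> p \<mu> x)"

definition spectral_radius_\<sigma>p ::
  "nat \<Rightarrow> (nat \<Rightarrow> nat) \<Rightarrow> ((nat \<Rightarrow> nat) \<Rightarrow> real) \<Rightarrow> nat \<Rightarrow> (nat \<Rightarrow> nat set) \<Rightarrow> (nat \<Rightarrow> real) \<Rightarrow> real"
  where
  "spectral_radius_\<sigma>p m N a d \<sigma> p = Sup {\<bar>\<mu>\<bar> | \<mu>. is_eigenvalue m N a d \<sigma> p \<mu>}"

text \<open>The partial derivative with respect to the entry \<open>b\<close>.\<close>

definition pderiv_at :: "nat \<times> nat \<Rightarrow> (bvec \<Rightarrow> real) \<Rightarrow> bvec \<Rightarrow> real" where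
  "pderiv_at b f x = deriv (\<lambda>s. f (x(b := s))) (x b)"

definition M_matrix ::
  "nat \<Rightarrow> (nat \<Rightarrow> nat) \<Rightarrow> ((nat \<Rightarrow> nat) \<Rightarrow> real) \<Rightarrow> nat \<Rightarrow> (nat \<Rightarrow> nat set)
    \<Rightarrow> nat \<times> nat \<Rightarrow> nat \<times> nat \<Rightarrow> real" where
  "M_matrix m N a d \<sigma> b b' = pderiv_at b' (block_map m N a d \<sigma> b) (\<lambda>_. 1)"

definition strictly_nonneg ::
  "nat \<Rightarrow> (nat \<Rightarrow> nat) \<Rightarrow> ((nat \<Rightarrow> nat) \<Rightarrow> real) \<Rightarrow> nat \<Rightarrow> (nat \<Rightarrow> nat set) \<Rightarrow> bool" where
  "strictly_nonneg m N a d \<sigma> \<longleftrightarrow>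
     (\<forall>b\<in>idx N d \<sigma>. \<exists>b'\<in>idx N d \<sigma>. M_matrix m N a d \<sigma> b b' \<noteq> 0)"

text \<open>
  Irreducibility of a square matrix with index set \<open>I\<close>: no simultaneous permutation of rows and
  columns yields a block triangular form with nontrivial square diagonal blocks; the set \<open>S\<close>
  collects the rows of the zero block. Every 1 x 1 matrix is irreducible in this convention.
\<close>

definition irreducible_matrix :: "'i set \<Rightarrow> ('i \<Rightarrow> 'i \<Rightarrow> real) \<Rightarrow> bool" where
  "irreducible_matrix I M \<longleftrightarrow>
     \<not> (\<exists>S. S \<noteq> {} \<and> S \<subset> I \<and> (\<forall>b\<in>S. \<forall>b'\<in>I - S. M b b' = 0))"

definition weakly_irreducible ::
  "nat \<Rightarrow> (nat \<Rightarrow> nat) \<Rightarrow> ((nat \<Rightarrow> nat) \<Rightarrow> real) \<Rightarrow> nat \<Rightarrow> (nat \<Rightarrow> nat set) \<Rightarrow> bool" where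
  "weakly_irreducible m N a d \<sigma> \<longleftrightarrow>
     irreducible_matrix (idx N d \<sigma>) (M_matrix m N a d \<sigma>)"

definition Phi ::
  "nat \<Rightarrow> (nat \<Rightarrow> nat) \<Rightarrow> ((nat \<Rightarrow> nat) \<Rightarrow> real) \<Rightarrow> nat \<Rightarrow> (nat \<Rightarrow> nat set) \<Rightarrow> (nat \<Rightarrow> real)
    \<Rightarrow> bvec \<Rightarrow> bvec" where
  "Phi m N a d \<sigma> p x b = block_map m N a d \<sigma> b x / x b powr (p (fst b) - 1)"

definition phi_max ::
  "nat \<Rightarrow> (nat \<Rightarrow> nat) \<Rightarrow> ((nat \<Rightarrow> nat) \<Rightarrow> real) \<Rightarrow> nat \<Rightarrow> (nat \<Rightarrow> nat set) \<Rightarrow> (nat \<Rightarrow> real)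
    \<Rightarrow> bvec \<Rightarrow> real" where
  "phi_max m N a d \<sigma> p x = Max (Phi m N a d \<sigma> p x ` idx N d \<sigma>)"

definition c_fun ::
  "(nat \<Rightarrow> nat) \<Rightarrow> nat \<Rightarrow> (nat \<Rightarrow> nat set) \<Rightarrow> (nat \<Rightarrow> real) \<Rightarrow> bvec \<Rightarrow> real" where
  "c_fun N d \<sigma> p x = (\<Prod>i\<in>{1..d}. block_norm N \<sigma> p x i)"

definition C_set ::
  "(nat \<Rightarrow> nat) \<Rightarrow> nat \<Rightarrow> (nat \<Rightarrow> nat set) \<Rightarrow> (nat \<Rightarrow> real) \<Rightarrow> bvec set" where
  "C_set N d \<sigma> p = {x. positive_vec N d \<sigma> x \<and> c_fun N d \<sigma> p x = 1}"

definition R_fun ::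
  "(nat \<Rightarrow> nat) \<Rightarrow> nat \<Rightarrow> (nat \<Rightarrow> nat set) \<Rightarrow> (nat \<Rightarrow> real) \<Rightarrow> bvec \<Rightarrow> bvec" where
  "R_fun N d \<sigma> p x = (\<lambda>b. x b / root d (c_fun N d \<sigma> p x))"

text \<open>
  The components of \<open>H\<close> are indexed by \<open>Some b\<close> (component \<open>b\<close> of \<open>r\<close>) and \<open>None\<close> (the component
  \<open>c(x) - 1\<close>); likewise the columns of its Jacobian \<open>DH\<close>, the matrix of partial derivatives, are
  indexed by \<open>Some b\<close> (the variable \<open>x b\<close>) and \<open>None\<close> (the variable \<open>\<mu>\<close>).
\<close>

definition H_idx :: "(nat \<Rightarrow> nat) \<Rightarrow> nat \<Rightarrow> (nat \<Rightarrow> nat set) \<Rightarrow> (nat \<times> nat) option set" where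
  "H_idx N d \<sigma> = insert None (Some ` idx N d \<sigma>)"

definition r_fun ::
  "nat \<Rightarrow> (nat \<Rightarrow> nat) \<Rightarrow> ((nat \<Rightarrow> nat) \<Rightarrow> real) \<Rightarrow> nat \<Rightarrow> (nat \<Rightarrow> nat set) \<Rightarrow> (nat \<Rightarrow> real)
    \<Rightarrow> bvec \<Rightarrow> real \<Rightarrow> bvec" where
  "r_fun m N a d \<sigma> p x \<mu> b = - (Phi m N a d \<sigma> p x b * x b) + \<mu> * x b"

definition H_fun ::
  "nat \<Rightarrow> (nat \<Rightarrow> nat) \<Rightarrow> ((nat \<Rightarrow> nat) \<Rightarrow> real) \<Rightarrow> nat \<Rightarrow> (nat \<Rightarrow> nat set) \<Rightarrow> (nat \<Rightarrow> real)
    \<Rightarrow> bvec \<Rightarrow> real \<Rightarrow> (nat \<times> nat) option \<Rightarrow> real" where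
  "H_fun m N a d \<sigma> p x \<mu> h =
     (case h of Some b \<Rightarrow> r_fun m N a d \<sigma> p x \<mu> b | None \<Rightarrow> c_fun N d \<sigma> p x - 1)"

definition DH_fun ::
  "nat \<Rightarrow> (nat \<Rightarrow> nat) \<Rightarrow> ((nat \<Rightarrow> nat) \<Rightarrow> real) \<Rightarrow> nat \<Rightarrow> (nat \<Rightarrow> nat set) \<Rightarrow> (nat \<Rightarrow> real)
    \<Rightarrow> bvec \<Rightarrow> real \<Rightarrow> (nat \<times> nat) option \<Rightarrow> (nat \<times> nat) option \<Rightarrow> real" where
  "DH_fun m N a d \<sigma> p x \<mu> h g =
     (case g of
        Some b \<Rightarrow> pderiv_at b (\<lambda>y. H_fun m N a d \<sigma> p y \<mu> h) x
      | None \<Rightarrow> deriv (\<lambda>s. H_fun m N a d \<sigma> p x s h) \<mu>)"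

definition H_zero ::
  "nat \<Rightarrow> (nat \<Rightarrow> nat) \<Rightarrow> ((nat \<Rightarrow> nat) \<Rightarrow> real) \<Rightarrow> nat \<Rightarrow> (nat \<Rightarrow> nat set) \<Rightarrow> (nat \<Rightarrow> real)
    \<Rightarrow> bvec \<Rightarrow> real \<Rightarrow> bool" where
  "H_zero m N a d \<sigma> p x \<mu> \<longleftrightarrow> (\<forall>h\<in>H_idx N d \<sigma>. H_fun m N a d \<sigma> p x \<mu> h = 0)"

definition newton_step ::
  "nat \<Rightarrow> (nat \<Rightarrow> nat) \<Rightarrow> ((nat \<Rightarrow> nat) \<Rightarrow> real) \<Rightarrow> nat \<Rightarrow> (nat \<Rightarrow> nat set) \<Rightarrow> (nat \<Rightarrow> real)
    \<Rightarrow> bvec \<Rightarrow> real \<Rightarrow> bvec \<Rightarrow> real \<Rightarrow> bool" where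
  "newton_step m N a d \<sigma> p x \<mu> v \<delta> \<longleftrightarrow>
     (\<forall>h\<in>H_idx N d \<sigma>.
        (\<Sum>b\<in>idx N d \<sigma>. DH_fun m N a d \<sigma> p x \<mu> h (Some b) * v b)
        + DH_fun m N a d \<sigma> p x \<mu> h None * \<delta> + H_fun m N a d \<sigma> p x \<mu> h = 0)"

definition move :: "bvec \<Rightarrow> real \<Rightarrow> bvec \<Rightarrow> bvec" where
  "move x \<alpha> v = (\<lambda>b. x b + \<alpha> * v b)"

definition admissible_steps ::
  "nat \<Rightarrow> (nat \<Rightarrow> nat) \<Rightarrow> ((nat \<Rightarrow> nat) \<Rightarrow> real) \<Rightarrow> nat \<Rightarrow> (nat \<Rightarrow> nat set) \<Rightarrow> (nat \<Rightarrow> real)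
    \<Rightarrow> real \<Rightarrow> real \<Rightarrow> bvec \<Rightarrow> bvec \<Rightarrow> real \<Rightarrow> real set" where
  "admissible_steps m N a d \<sigma> p \<eta> \<rho> x v \<delta> =
     {\<alpha>. (\<exists>i::nat. \<alpha> = \<rho> ^ i) \<and> positive_vec N d \<sigma> (move x \<alpha> v) \<and>
          phi_max m N a d \<sigma> p (R_fun N d \<sigma> p (move x \<alpha> v)) \<le> phi_max m N a d \<sigma> p x + \<eta> * \<alpha> * \<delta>}"

text \<open>
  \<open>xs\<close>, \<open>ls\<close>, \<open>ds\<close>, \<open>\<delta>s\<close>, \<open>\<alpha>s\<close> are sequences of iterates, eigenvalue approximations, directions,
  \<open>\<lambda>\<close>-increments and step lengths produced by LS-NNM with line search parameters \<open>\<eta>\<close> (the scalar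
  \<open>\<sigma>\<close> of the algorithm), \<open>\<rho>\<close> and starting point \<open>u0\<close>. After termination the sequences are continued
  constantly; this propagates to all later indices, as \<open>H\<close> vanishes again at the next index.
\<close>

definition LS_NNM ::
  "nat \<Rightarrow> (nat \<Rightarrow> nat) \<Rightarrow> ((nat \<Rightarrow> nat) \<Rightarrow> real) \<Rightarrow> nat \<Rightarrow> (nat \<Rightarrow> nat set) \<Rightarrow> (nat \<Rightarrow> real)
    \<Rightarrow> real \<Rightarrow> real \<Rightarrow> bvec
    \<Rightarrow> (nat \<Rightarrow> bvec) \<Rightarrow> (nat \<Rightarrow> real) \<Rightarrow> (nat \<Rightarrow> bvec) \<Rightarrow> (nat \<Rightarrow> real) \<Rightarrow> (nat \<Rightarrow> real) \<Rightarrow> bool" where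
  "LS_NNM m N a d \<sigma> p \<eta> \<rho> u0 xs ls ds \<delta>s \<alpha>s \<longleftrightarrow>
     (\<forall>b\<in>idx N d \<sigma>. xs 0 b = R_fun N d \<sigma> p u0 b) \<and>
     ls 0 = phi_max m N a d \<sigma> p (xs 0) \<and>
     (\<forall>k. if H_zero m N a d \<sigma> p (xs k) (ls k)
          then (\<forall>b\<in>idx N d \<sigma>. xs (Suc k) b = xs k b) \<and> ls (Suc k) = ls k \<and>
               (\<forall>b\<in>idx N d \<sigma>. ds k b = 0) \<and> \<delta>s k = 0 \<and> \<alpha>s k = 1
          else newton_step m N a d \<sigma> p (xs k) (ls k) (ds k) (\<delta>s k) \<and>
               \<alpha>s k \<in> admissible_steps m N a d \<sigma> p \<eta> \<rho> (xs k) (ds k) (\<delta>s k) \<and>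
               (\<forall>\<beta>\<in>admissible_steps m N a d \<sigma> p \<eta> \<rho> (xs k) (ds k) (\<delta>s k). \<beta> \<le> \<alpha>s k) \<and>
               (\<forall>b\<in>idx N d \<sigma>. xs (Suc k) b = R_fun N d \<sigma> p (move (xs k) (\<alpha>s k) (ds k)) b) \<and>
               ls (Suc k) = phi_max m N a d \<sigma> p (xs (Suc k)))"

text \<open>Quadratic convergence with respect to the norm \<open>nrm\<close>.\<close>

definition converges_quadratically :: "('v \<Rightarrow> real) \<Rightarrow> (nat \<Rightarrow> 'v::minus) \<Rightarrow> 'v \<Rightarrow> bool" where
  "converges_quadratically nrm v vbar \<longleftrightarrow>
     (\<lambda>k. nrm (v k - vbar)) \<longlonglongrightarrow> 0 \<and>
     (\<exists>K. \<forall>\<^sub>F k in sequentially. nrm (v (Suc k) - vbar) \<le> K * (nrm (v k - vbar))\<^sup>2)"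

end

theory Submission
  imports Defs
begin

text \<open>
  Write \<open>A b x\<close> for the polynomial \<open>x \<mapsto> A_{s_i,t}(x^{[\<sigma>]})\<close> of the index \<open>b = (i, t)\<close>, \<open>p b\<close> for
  \<open>p_i\<close>, and \<open>S\<close> for \<open>\<nu>_1 / p_1 + ... + \<nu>_d / p_d\<close>.  Everything rests on one homogeneity: each monomial
  of \<open>A b\<close> has degree \<open>S - 1 / p b\<close> when the variable \<open>x b\<close> gets the weight \<open>1 / p b\<close>.

  Consider the Jacobian \<open>Q\<close> of \<open>r\<close> in \<open>x\<close> at a positive \<open>x\<close> with \<open>\<lambda> \<ge> \<Phi> b x\<close> for all \<open>b\<close>.  Its
  off-diagonal entries are \<open>\<le> 0\<close>, and by Euler's identity the positive vector \<open>w b = x b / p b\<close>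
  satisfies \<open>(Q w) b = x b ((\<lambda> - \<Phi> b x) / p b + (1 - S) \<Phi> b x) \<ge> 0\<close>.  So \<open>Q\<close> is an M-matrix.  It is
  nonsingular if \<open>S < 1\<close>; if \<open>S = 1\<close>, irreducibility leaves at most the line through \<open>w\<close> as kernel, and \<open>w\<close> is not
  tangent to \<open>c = 1\<close>.  Hence \<open>Q y \<le> 0\<close> and \<open>\<nabla>c \<bullet> y = 0\<close> force \<open>y = 0\<close> (\<open>jac_injective\<close>).  On a compact
  set of positive vectors this becomes quantitative (\<open>jac_uniform_injective\<close>): the
  bordered Jacobian has a bounded inverse, and a Newton direction satisfies \<open>|d| \<le> K |\<delta>|\<close> with
  \<open>\<delta> \<le> 0\<close>.

  The iterates stay in such a compact set.  For the eigenvector \<open>xbar\<close>, compare an iterate \<open>x\<close> with it by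
  the numbers \<open>\<theta> b = p b ln (x b / xbar b)\<close>.  At an index where \<open>\<theta>\<close> is minimal, \<open>\<Phi> b x\<close> is
  at least \<open>\<mu> exp ((S - 1) \<theta> b)\<close>, so for \<open>S < 1\<close> a bound on \<open>\<Phi>\<close> bounds \<open>\<theta>\<close> from below; for \<open>S = 1\<close> the
  bound on \<open>\<Phi>\<close> lets \<open>\<theta>\<close> grow only by a bounded amount along each nonzero coefficient, and
  irreducibility together with \<open>c x = 1\<close> gives the same conclusion (\<open>theta_lower_bound\<close>).  The same
  comparison shows that \<open>xbar\<close> is the only positive solution with \<open>c = 1\<close>
  (\<open>normalized_eigenvector_unique\<close>), and, applied to the absolute values of an arbitrary
  eigenvector, that its eigenvalue \<open>\<mu>\<close> is the spectral radius (\<open>eigenvalue_le\<close>).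

  By the Newton equation, \<open>\<Phi>(x + \<alpha> d) \<le> \<lambda> + \<alpha> \<delta> + K (\<alpha> \<delta>)^2\<close>, and the retraction to \<open>c = 1\<close> changes
  this by another term of second order, since \<open>d\<close> is tangent to \<open>c = 1\<close>.  Therefore every step with \<open>\<alpha> |\<delta>|\<close> below a
  fixed constant is accepted (\<open>line_search_accepts\<close>).  A reduced step then decreases \<open>\<lambda>\<close> by at least a fixed
  amount, which happens only finitely often because \<open>\<lambda>\<close> is nonincreasing and nonnegative.  So \<open>\<alpha> = 1\<close>
  eventually, \<open>\<delta>\<close> and with it the residual tends to \<open>0\<close>, and uniqueness makes \<open>xbar\<close> the limit.  With full
  steps the usual Newton estimate (\<open>newton_quadratic_error\<close>) gives quadratic convergence of \<open>x\<close>; for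
  \<open>\<lambda>\<close> one uses in addition that \<open>|x - xbar|\<close> is bounded by a multiple of \<open>|\<lambda> - \<mu>|\<close>, again
  because \<open>|d| \<le> K |\<delta>|\<close>.
\<close>

section \<open>Second-order Taylor estimates on sets of vectors\<close>

abbreviation l1_dist :: "'i set \<Rightarrow> ('i \<Rightarrow> real) \<Rightarrow> ('i \<Rightarrow> real) \<Rightarrow> real" where
  "l1_dist I x y \<equiv> (\<Sum>b\<in>I. \<bar>y b - x b\<bar>)"

text \<open>Second-order Taylor estimate, uniform on \<open>B\<close>, with \<open>f'\<close> in the role of the gradient.  The
  estimate replaces bounds on second derivatives; the bounds on \<open>f\<close>, \<open>f'\<close> and the Lipschitz
  bound are included because they are what makes the notion closed under products.  Only the entries
  indexed by \<open>I\<close> count.\<close>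

definition quad_bound_on ::
  "real \<Rightarrow> 'i set \<Rightarrow> ('i \<Rightarrow> real) set \<Rightarrow> (('i \<Rightarrow> real) \<Rightarrow> real) \<Rightarrow> (('i \<Rightarrow> real) \<Rightarrow> 'i \<Rightarrow> real) \<Rightarrow> bool"
  where
  "quad_bound_on K I B f f' \<longleftrightarrow>
     (\<forall>x\<in>B. \<bar>f x\<bar> \<le> K) \<and> (\<forall>x\<in>B. \<forall>b\<in>I. \<bar>f' x b\<bar> \<le> K) \<and>
     (\<forall>x\<in>B. \<forall>y\<in>B. \<bar>f y - f x\<bar> \<le> K * l1_dist I x y) \<and>
     (\<forall>x\<in>B. \<forall>y\<in>B. \<bar>f y - f x - (\<Sum>b\<in>I. f' x b * (y b - x b))\<bar>
        \<le> K * (l1_dist I x y)\<^sup>2)"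

definition quad_approx_on ::
  "'i set \<Rightarrow> ('i \<Rightarrow> real) set \<Rightarrow> (('i \<Rightarrow> real) \<Rightarrow> real) \<Rightarrow> (('i \<Rightarrow> real) \<Rightarrow> 'i \<Rightarrow> real) \<Rightarrow> bool"
  where "quad_approx_on I B f f' \<longleftrightarrow> (\<exists>K\<ge>0. quad_bound_on K I B f f')"

lemma quad_bound_onD:
  assumes "quad_bound_on K I B f f'"
  shows "x \<in> B \<Longrightarrow> \<bar>f x\<bar> \<le> K" and "x \<in> B \<Longrightarrow> b \<in> I \<Longrightarrow> \<bar>f' x b\<bar> \<le> K"
    and "x \<in> B \<Longrightarrow> y \<in> B \<Longrightarrow> \<bar>f y - f x\<bar> \<le> K * l1_dist I x y"
    and "x \<in> B \<Longrightarrow> y \<in> B \<Longrightarrow>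
      \<bar>f y - f x - (\<Sum>b\<in>I. f' x b * (y b - x b))\<bar> \<le> K * (l1_dist I x y)\<^sup>2"
proof -
  note b = assms[unfolded quad_bound_on_def]
  note bounds = b[THEN conjunct1] b[THEN conjunct2, THEN conjunct1]
    b[THEN conjunct2, THEN conjunct2, THEN conjunct1] b[THEN conjunct2, THEN conjunct2, THEN conjunct2]
  show "x \<in> B \<Longrightarrow> \<bar>f x\<bar> \<le> K" by (rule bspec[OF bounds(1)])
  show "x \<in> B \<Longrightarrow> b \<in> I \<Longrightarrow> \<bar>f' x b\<bar> \<le> K" by (rule bspec[OF bspec[OF bounds(2)]])
  assume x: "x \<in> B" and y: "y \<in> B"
  show "\<bar>f y - f x\<bar> \<le> K * l1_dist I x y" by (rule bspec[OF bspec[OF bounds(3) x] y])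
  show "\<bar>f y - f x - (\<Sum>b\<in>I. f' x b * (y b - x b))\<bar> \<le> K * (l1_dist I x y)\<^sup>2"
    by (rule bspec[OF bspec[OF bounds(4) x] y])
qed

lemma quad_approx_onI:
  assumes "\<And>x. x \<in> B \<Longrightarrow> \<bar>f x\<bar> \<le> K1"
    and "\<And>x b. x \<in> B \<Longrightarrow> b \<in> I \<Longrightarrow> \<bar>f' x b\<bar> \<le> K2"
    and "\<And>x y. x \<in> B \<Longrightarrow> y \<in> B \<Longrightarrow> \<bar>f y - f x\<bar> \<le> K3 * l1_dist I x y"
    and "\<And>x y. x \<in> B \<Longrightarrow> y \<in> B \<Longrightarrow>
      \<bar>f y - f x - (\<Sum>b\<in>I. f' x b * (y b - x b))\<bar> \<le> K4 * (l1_dist I x y)\<^sup>2"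
  shows "quad_approx_on I B f f'"
proof -
  define K where "K = \<bar>K1\<bar> + \<bar>K2\<bar> + \<bar>K3\<bar> + \<bar>K4\<bar>"
  have le: "K1 \<le> K" "K2 \<le> K" "K3 \<le> K" "K4 \<le> K" "0 \<le> K"
    unfolding K_def by linarith+
  have N: "0 \<le> l1_dist I x y" for x y :: "'a \<Rightarrow> real"
    by (simp add: sum_nonneg)
  show ?thesis
    unfolding quad_approx_on_def quad_bound_on_def
  proof (intro exI[of _ K] conjI ballI)
    show "0 \<le> K" by fact
    fix x assume x: "x \<in> B"
    show "\<bar>f x\<bar> \<le> K" using assms(1)[OF x] le by linarith
    fix b assume b: "b \<in> I"
    show "\<bar>f' x b\<bar> \<le> K" using assms(2)[OF x b] le by linarith
  next
    fix x y assume xy: "x \<in> B" "y \<in> B"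
    show "\<bar>f y - f x\<bar> \<le> K * l1_dist I x y"
      by (rule order_trans[OF assms(3)[OF xy] mult_right_mono[OF le(3) N]])
    show "\<bar>f y - f x - (\<Sum>b\<in>I. f' x b * (y b - x b))\<bar> \<le> K * (l1_dist I x y)\<^sup>2"
      by (rule order_trans[OF assms(4)[OF xy] mult_right_mono[OF le(4) zero_le_power2]])
  qed
qed

lemma quad_approx_onE:
  assumes "quad_approx_on I B f f'"
  obtains K where "0 \<le> K" "quad_bound_on K I B f f'"
  using assms[unfolded quad_approx_on_def] by (elim exE conjE) (rule that)

lemma quad_approx_on_remainderE:
  assumes "quad_approx_on I B f f'"
  obtains K where "0 \<le> K" "\<And>x y. x \<in> B \<Longrightarrow> y \<in> B \<Longrightarrow>
      \<bar>f y - f x - (\<Sum>b\<in>I. f' x b * (y b - x b))\<bar> \<le> K * (l1_dist I x y)\<^sup>2"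
proof (rule quad_approx_onE[OF assms])
  fix K assume K: "0 \<le> K" "quad_bound_on K I B f f'"
  show thesis by (rule that[OF K(1) quad_bound_onD(4)[OF K(2)]])
qed

lemma quad_approx_on_lipschitzE:
  assumes "quad_approx_on I B f f'"
  obtains K where "0 \<le> K" "\<And>x y. x \<in> B \<Longrightarrow> y \<in> B \<Longrightarrow>
      \<bar>f y - f x\<bar> \<le> K * l1_dist I x y"
proof (rule quad_approx_onE[OF assms])
  fix K assume K: "0 \<le> K" "quad_bound_on K I B f f'"
  show thesis by (rule that[OF K(1) quad_bound_onD(3)[OF K(2)]])
qed

lemma quad_approx_on_cong:
  assumes "quad_approx_on I B f f'"
    and "\<And>x. x \<in> B \<Longrightarrow> g x = f x" "\<And>x b. x \<in> B \<Longrightarrow> b \<in> I \<Longrightarrow> g' x b = f' x b"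
  shows "quad_approx_on I B g g'"
proof -
  have "quad_bound_on K I B g g' = quad_bound_on K I B f f'" for K
    unfolding quad_bound_on_def using assms(2,3) by (simp cong: sum.cong)
  then show ?thesis using assms(1) unfolding quad_approx_on_def by simp
qed

lemma quad_approx_on_const: "quad_approx_on I B (\<lambda>x. k) (\<lambda>x b. 0)"
  by (rule quad_approx_onI[of _ _ "\<bar>k\<bar>" _ _ 0 0 0]) auto

lemma quad_approx_on_coord:
  assumes "finite I" "b0 \<in> I" "\<And>x. x \<in> B \<Longrightarrow> \<bar>x b0\<bar> \<le> u"
  shows "quad_approx_on I B (\<lambda>x. x b0) (\<lambda>x b. if b = b0 then 1 else 0)"
proof (rule quad_approx_onI[of _ _ u _ _ 1 1 0])
  fix x y :: "'a \<Rightarrow> real"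
  show "\<bar>y b0 - x b0\<bar> \<le> 1 * l1_dist I x y"
    using member_le_sum[of b0 I "\<lambda>b. \<bar>y b - x b\<bar>"] assms by simp
  have "(\<Sum>b\<in>I. (if b = b0 then 1 else 0) * (y b - x b)) = y b0 - x b0"
    using assms by (simp add: if_distrib[of "\<lambda>t. t * _"] sum.delta cong: if_cong)
  then show "\<bar>y b0 - x b0 - (\<Sum>b\<in>I. (if b = b0 then 1 else 0) * (y b - x b))\<bar>
      \<le> 0 * (l1_dist I x y)\<^sup>2"
    by simp
qed (use assms in auto)

lemma quad_approx_on_add:
  assumes "quad_approx_on I B f f'" "quad_approx_on I B g g'"
  shows "quad_approx_on I B (\<lambda>x. f x + g x) (\<lambda>x b. f' x b + g' x b)"
proof -
  obtain K where K0: "0 \<le> K" and Kq: "quad_bound_on K I B f f'"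
    using assms(1) by (rule quad_approx_onE)
  note K = K0 quad_bound_onD[OF Kq]
  obtain M where M0: "0 \<le> M" and Mq: "quad_bound_on M I B g g'"
    using assms(2) by (rule quad_approx_onE)
  note M = M0 quad_bound_onD[OF Mq]
  show ?thesis
  proof (rule quad_approx_onI[of _ _ "K + M" _ _ "K + M" "K + M" "K + M"])
    fix x y assume xy: "x \<in> B" "y \<in> B"
    show "\<bar>f y + g y - (f x + g x)\<bar> \<le> (K + M) * l1_dist I x y"
      using K(4)[OF xy] M(4)[OF xy] by (simp add: distrib_right)
    show "\<bar>f y + g y - (f x + g x) - (\<Sum>b\<in>I. (f' x b + g' x b) * (y b - x b))\<bar>
        \<le> (K + M) * (l1_dist I x y)\<^sup>2"
      using K(5)[OF xy] M(5)[OF xy] by (simp add: distrib_right sum.distrib)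
  next
    fix x assume x: "x \<in> B"
    show "\<bar>f x + g x\<bar> \<le> K + M" using K(2)[OF x] M(2)[OF x] by linarith
    fix b assume b: "b \<in> I"
    show "\<bar>f' x b + g' x b\<bar> \<le> K + M" using K(3)[OF x b] M(3)[OF x b] by linarith
  qed
qed

lemma quad_approx_on_mult:
  assumes "quad_approx_on I B f f'" "quad_approx_on I B g g'"
  shows "quad_approx_on I B (\<lambda>x. f x * g x) (\<lambda>x b. f' x b * g x + f x * g' x b)"
proof -
  obtain K where K0: "0 \<le> K" and Kq: "quad_bound_on K I B f f'"
    using assms(1) by (rule quad_approx_onE)
  note K = K0 quad_bound_onD[OF Kq]
  obtain M where M0: "0 \<le> M" and Mq: "quad_bound_on M I B g g'"
    using assms(2) by (rule quad_approx_onE)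
  note M = M0 quad_bound_onD[OF Mq]
  show ?thesis
  proof (rule quad_approx_onI[of _ _ "K * M" _ _ "K * M + K * M" "K * M + K * M" "K * M + K * M + K * M"])
    fix x assume x: "x \<in> B"
    show "\<bar>f x * g x\<bar> \<le> K * M"
      using K(1,2) M(1,2) x by (simp add: abs_mult mult_mono)
    fix b assume b: "b \<in> I"
    have "\<bar>f' x b * g x\<bar> \<le> K * M" "\<bar>f x * g' x b\<bar> \<le> K * M"
      using K(1) K(2)[OF x] K(3)[OF x b] M(1) M(2)[OF x] M(3)[OF x b]
      by (simp_all add: abs_mult mult_mono)
    then show "\<bar>f' x b * g x + f x * g' x b\<bar> \<le> K * M + K * M" by linarith
  next
    fix x y assume xy: "x \<in> B" "y \<in> B"
    define n where "n = l1_dist I x y"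
    define u where "u = f y - f x - (\<Sum>b\<in>I. f' x b * (y b - x b))"
    define v where "v = g y - g x - (\<Sum>b\<in>I. g' x b * (y b - x b))"
    have n: "0 \<le> n" unfolding n_def by (simp add: sum_nonneg)
    have Kn: "\<bar>f y - f x\<bar> \<le> K * n" "\<bar>u\<bar> \<le> K * n\<^sup>2" "\<bar>g y - g x\<bar> \<le> M * n" "\<bar>v\<bar> \<le> M * n\<^sup>2"
      using K(4,5)[OF xy] M(4,5)[OF xy] unfolding n_def u_def v_def by auto
    have 1: "\<bar>(f y - f x) * g y\<bar> \<le> (K * n) * M" "\<bar>f x * (g y - g x)\<bar> \<le> K * (M * n)"
      unfolding abs_mult using Kn K(1,2) M(1,2) xy n by (auto intro!: mult_mono)
    have "f y * g y - f x * g x = (f y - f x) * g y + f x * (g y - g x)"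
      by (simp add: algebra_simps)
    then have "\<bar>f y * g y - f x * g x\<bar> \<le> (K * n) * M + K * (M * n)"
      using 1 by linarith
    also have "\<dots> = (K * M + K * M) * n" by (simp add: algebra_simps)
    finally show "\<bar>f y * g y - f x * g x\<bar> \<le> (K * M + K * M) * l1_dist I x y"
      unfolding n_def .
    have 2: "\<bar>u * g x\<bar> \<le> (K * n\<^sup>2) * M" "\<bar>f x * v\<bar> \<le> K * (M * n\<^sup>2)"
      "\<bar>(f y - f x) * (g y - g x)\<bar> \<le> (K * n) * (M * n)"
      unfolding abs_mult using Kn K(1,2) M(1,2) xy n by (auto intro!: mult_mono)
    have "(\<Sum>b\<in>I. (f' x b * g x + f x * g' x b) * (y b - x b))
        = (\<Sum>b\<in>I. f' x b * (y b - x b)) * g x + f x * (\<Sum>b\<in>I. g' x b * (y b - x b))"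
      by (simp add: sum_distrib_left sum_distrib_right flip: sum.distrib) (simp add: algebra_simps)
    then have "f y * g y - f x * g x - (\<Sum>b\<in>I. (f' x b * g x + f x * g' x b) * (y b - x b))
        = u * g x + f x * v + (f y - f x) * (g y - g x)"
      unfolding u_def v_def by (simp add: algebra_simps)
    then have "\<bar>f y * g y - f x * g x - (\<Sum>b\<in>I. (f' x b * g x + f x * g' x b) * (y b - x b))\<bar>
        \<le> (K * n\<^sup>2) * M + K * (M * n\<^sup>2) + (K * n) * (M * n)"
      using 2 by linarith
    also have "\<dots> = (K * M + K * M + K * M) * n\<^sup>2" by (simp add: algebra_simps power2_eq_square)
    finally show "\<bar>f y * g y - f x * g x - (\<Sum>b\<in>I. (f' x b * g x + f x * g' x b) * (y b - x b))\<bar>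
        \<le> (K * M + K * M + K * M) * (l1_dist I x y)\<^sup>2"
      unfolding n_def .
  qed
qed

lemma quad_approx_on_cmult:
  assumes "quad_approx_on I B f f'"
  shows "quad_approx_on I B (\<lambda>x. k * f x) (\<lambda>x b. k * f' x b)"
  using quad_approx_on_mult[OF quad_approx_on_const[of I B k] assms] by simp

lemma quad_approx_on_sum:
  assumes "\<And>j. j \<in> J \<Longrightarrow> quad_approx_on I B (f j) (f' j)"
  shows "quad_approx_on I B (\<lambda>x. \<Sum>j\<in>J. f j x) (\<lambda>x b. \<Sum>j\<in>J. f' j x b)"
proof (cases "finite J")
  case True
  then show ?thesis using assms
    by (induction J) (auto simp: quad_approx_on_const intro!: quad_approx_on_add)
next
  case False
  then show ?thesis by (simp add: quad_approx_on_const)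
qed

text \<open>The logarithmic derivative of a product is the sum of the logarithmic derivatives; this
  avoids products over an index set with one element removed.\<close>

lemma quad_approx_on_prod:
  assumes "\<And>j. j \<in> J \<Longrightarrow> quad_approx_on I B (f j) (\<lambda>x b. f j x * l j x b)"
  shows "quad_approx_on I B (\<lambda>x. \<Prod>j\<in>J. f j x) (\<lambda>x b. (\<Prod>j\<in>J. f j x) * (\<Sum>j\<in>J. l j x b))"
proof (cases "finite J")
  case True
  then show ?thesis using assms
  proof (induction J)
    case empty
    then show ?case by (simp add: quad_approx_on_const)
  next
    case (insert i J)
    have "quad_approx_on I B (\<lambda>x. f i x * (\<Prod>j\<in>J. f j x))
        (\<lambda>x b. f i x * l i x b * (\<Prod>j\<in>J. f j x) + f i x * ((\<Prod>j\<in>J. f j x) * (\<Sum>j\<in>J. l j x b)))"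
      by (rule quad_approx_on_mult) (use insert in auto)
    then show ?case
      by (rule quad_approx_on_cong) (use insert in \<open>simp_all add: algebra_simps\<close>)
  qed
next
  case False
  then show ?thesis by (simp add: quad_approx_on_const)
qed

text \<open>On an interval away from \<open>0\<close> the second derivative of a power is bounded, and the mean value theorem
  applied twice turns this bound into the quadratic remainder.\<close>

lemma quadratic_remainder_powr:
  fixes lo hi e :: real
  assumes "0 < lo"
  obtains K where "0 \<le> K" "\<And>s. s \<in> {lo..hi} \<Longrightarrow> \<bar>s powr e\<bar> \<le> K"
    "\<And>s. s \<in> {lo..hi} \<Longrightarrow> \<bar>e * s powr (e - 1)\<bar> \<le> K"
    "\<And>s t. s \<in> {lo..hi} \<Longrightarrow> t \<in> {lo..hi} \<Longrightarrow> \<bar>t powr e - s powr e\<bar> \<le> K * \<bar>t - s\<bar>"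
    "\<And>s t. s \<in> {lo..hi} \<Longrightarrow> t \<in> {lo..hi} \<Longrightarrow>
      \<bar>t powr e - s powr e - e * s powr (e - 1) * (t - s)\<bar> \<le> K * (t - s)\<^sup>2"
proof -
  have bd: "\<exists>K\<ge>0. \<forall>s\<in>{lo..hi}. \<bar>k * s powr q\<bar> \<le> K" for k q :: real
  proof -
    have "continuous_on {lo..hi} (\<lambda>s. k * s powr q)"
      using assms by (intro continuous_intros) auto
    then have "bounded ((\<lambda>s. k * s powr q) ` {lo..hi})"
      using compact_continuous_image compact_imp_bounded by blast
    then obtain K where "\<forall>s\<in>{lo..hi}. \<bar>k * s powr q\<bar> \<le> K" by (auto simp: bounded_iff)
    then show ?thesis by (intro exI[of _ "max 0 K"]) (auto simp: le_max_iff_disj)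
  qed
  have lip: "\<bar>k * t powr q - k * s powr q\<bar> \<le> K * \<bar>t - s\<bar>"
    if K: "\<forall>s\<in>{lo..hi}. \<bar>k * (q * s powr (q - 1))\<bar> \<le> K" and st: "s \<in> {lo..hi}" "t \<in> {lo..hi}"
    for k q K s t :: real
  proof -
    have "norm (k * t powr q - k * s powr q) \<le> K * norm (t - s)"
    proof (rule field_differentiable_bound[where S = "{lo..hi}" and f' = "\<lambda>s. k * (q * s powr (q - 1))"])
      fix z assume "z \<in> {lo..hi}"
      then show "((\<lambda>s. k * s powr q) has_field_derivative k * (q * z powr (q - 1))) (at z within {lo..hi})"
        using assms by (auto intro!: derivative_eq_intros)
    qed (use K st in auto)
    then show ?thesis by simp
  qed
  obtain K0 where K0: "0 \<le> K0" "\<forall>s\<in>{lo..hi}. \<bar>1 * s powr e\<bar> \<le> K0" using bd by blast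
  obtain K1 where K1: "0 \<le> K1" "\<forall>s\<in>{lo..hi}. \<bar>e * s powr (e - 1)\<bar> \<le> K1" using bd by blast
  obtain K2 where K2: "0 \<le> K2" "\<forall>s\<in>{lo..hi}. \<bar>(e * (e - 1)) * s powr (e - 1 - 1)\<bar> \<le> K2" using bd by blast
  define K where "K = K0 + K1 + K2"
  have le: "K0 \<le> K" "K1 \<le> K" "K2 \<le> K" "0 \<le> K" using K0 K1 K2 unfolding K_def by auto
  show ?thesis
  proof (rule that[of K])
    show "0 \<le> K" by fact
    fix s assume s: "s \<in> {lo..hi}"
    show "\<bar>s powr e\<bar> \<le> K" using K0(2) s le by fastforce
    show "\<bar>e * s powr (e - 1)\<bar> \<le> K" using K1(2) s le by fastforce
    fix t assume t: "t \<in> {lo..hi}"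
    have "\<bar>1 * t powr e - 1 * s powr e\<bar> \<le> K1 * \<bar>t - s\<bar>"
      using lip[of 1 e K1, OF _ s t] K1 by simp
    also have "\<dots> \<le> K * \<bar>t - s\<bar>" using le by (simp add: mult_right_mono)
    finally show "\<bar>t powr e - s powr e\<bar> \<le> K * \<bar>t - s\<bar>" by simp
    define h where "h = (\<lambda>r. r powr e - e * s powr (e - 1) * r)"
    have "norm (h t - h s) \<le> (K2 * \<bar>t - s\<bar>) * norm (t - s)"
    proof (rule field_differentiable_bound[where S = "closed_segment s t"
          and f' = "\<lambda>r. e * r powr (e - 1) - e * s powr (e - 1)"])
      fix z assume z: "z \<in> closed_segment s t"
      then have zI: "z \<in> {lo..hi}" "\<bar>z - s\<bar> \<le> \<bar>t - s\<bar>"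
        using s t by (auto simp: closed_segment_eq_real_ivl split: if_splits)
      then show "(h has_field_derivative e * z powr (e - 1) - e * s powr (e - 1)) (at z within closed_segment s t)"
        unfolding h_def using assms by (auto intro!: derivative_eq_intros)
      have "\<bar>e * z powr (e - 1) - e * s powr (e - 1)\<bar> \<le> K2 * \<bar>z - s\<bar>"
        using lip[of e "e - 1" K2, OF _ s zI(1)] K2 by (simp add: mult.assoc)
      also have "\<dots> \<le> K2 * \<bar>t - s\<bar>" using K2 zI(2) by (simp add: mult_left_mono)
      finally show "norm (e * z powr (e - 1) - e * s powr (e - 1)) \<le> K2 * \<bar>t - s\<bar>" by simp
    qed auto
    also have "\<dots> = K2 * (t - s)\<^sup>2"
      by (metis (no_types) mult.assoc power2_abs power2_eq_square real_norm_def)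
    also have "\<dots> \<le> K * (t - s)\<^sup>2" using le by (simp add: mult_right_mono)
    finally show "\<bar>t powr e - s powr e - e * s powr (e - 1) * (t - s)\<bar> \<le> K * (t - s)\<^sup>2"
      unfolding h_def by (simp add: algebra_simps)
  qed
qed

lemma quad_approx_on_powr:
  assumes "quad_approx_on I B f f'" and "0 < lo" "\<And>x. x \<in> B \<Longrightarrow> lo \<le> f x"
  shows "quad_approx_on I B (\<lambda>x. f x powr e) (\<lambda>x b. e * f x powr (e - 1) * f' x b)"
proof -
  obtain K where K0: "0 \<le> K" and Kq: "quad_bound_on K I B f f'"
    using assms(1) by (rule quad_approx_onE)
  note K = K0 quad_bound_onD[OF Kq]
  obtain M where M: "0 \<le> M" "\<And>s. s \<in> {lo..K} \<Longrightarrow> \<bar>s powr e\<bar> \<le> M"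
    "\<And>s. s \<in> {lo..K} \<Longrightarrow> \<bar>e * s powr (e - 1)\<bar> \<le> M"
    "\<And>s t. s \<in> {lo..K} \<Longrightarrow> t \<in> {lo..K} \<Longrightarrow> \<bar>t powr e - s powr e\<bar> \<le> M * \<bar>t - s\<bar>"
    "\<And>s t. s \<in> {lo..K} \<Longrightarrow> t \<in> {lo..K} \<Longrightarrow>
      \<bar>t powr e - s powr e - e * s powr (e - 1) * (t - s)\<bar> \<le> M * (t - s)\<^sup>2"
    using quadratic_remainder_powr[OF assms(2), of K e] by blast
  have ran: "f x \<in> {lo..K}" if "x \<in> B" for x
    using assms(3)[OF that] K(2)[OF that] by auto
  show ?thesis
  proof (rule quad_approx_onI[of _ _ M _ _ "M * K" "M * K" "M * K\<^sup>2 + M * K"])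
    fix x assume x: "x \<in> B"
    show "\<bar>f x powr e\<bar> \<le> M" using M(2) ran x by blast
    fix b assume b: "b \<in> I"
    show "\<bar>e * f x powr (e - 1) * f' x b\<bar> \<le> M * K"
      unfolding abs_mult[of "e * f x powr (e - 1)"] using M(3)[OF ran[OF x]] K(3)[OF x b] M(1) by (intro mult_mono) auto
  next
    fix x y assume xy: "x \<in> B" "y \<in> B"
    define n where "n = l1_dist I x y"
    have n: "0 \<le> n" unfolding n_def by (simp add: sum_nonneg)
    define u where "u = f y - f x - (\<Sum>b\<in>I. f' x b * (y b - x b))"
    have Kn: "\<bar>f y - f x\<bar> \<le> K * n" "\<bar>u\<bar> \<le> K * n\<^sup>2"
      using K(4,5)[OF xy] unfolding n_def u_def by auto
    have "\<bar>f y powr e - f x powr e\<bar> \<le> M * \<bar>f y - f x\<bar>"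
      using M(4) ran xy by blast
    also have "\<dots> \<le> M * (K * n)" using Kn M(1) by (intro mult_left_mono) auto
    finally show "\<bar>f y powr e - f x powr e\<bar> \<le> M * K * l1_dist I x y"
      unfolding n_def by (simp add: mult.assoc)
    have "\<bar>f y powr e - f x powr e - e * f x powr (e - 1) * (f y - f x)\<bar> \<le> M * (f y - f x)\<^sup>2"
      using M(5) ran xy by blast
    also have "(f y - f x)\<^sup>2 \<le> (K * n)\<^sup>2"
      by (rule power2_le_iff_abs_le[THEN iffD2]) (use Kn K n in auto)
    then have "M * (f y - f x)\<^sup>2 \<le> M * K\<^sup>2 * n\<^sup>2"
      using M(1) by (simp add: power_mult_distrib mult_left_mono mult.assoc)
    finally have 1: "\<bar>f y powr e - f x powr e - e * f x powr (e - 1) * (f y - f x)\<bar> \<le> M * K\<^sup>2 * n\<^sup>2" .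
    have 2: "\<bar>e * f x powr (e - 1) * u\<bar> \<le> M * (K * n\<^sup>2)"
      unfolding abs_mult[of "e * f x powr (e - 1)"] using M(3)[OF ran[OF xy(1)]] Kn M(1) by (intro mult_mono) auto
    have "(\<Sum>b\<in>I. e * f x powr (e - 1) * f' x b * (y b - x b))
        = e * f x powr (e - 1) * (\<Sum>b\<in>I. f' x b * (y b - x b))"
      by (simp add: sum_distrib_left mult.assoc)
    then have "f y powr e - f x powr e - (\<Sum>b\<in>I. e * f x powr (e - 1) * f' x b * (y b - x b))
        = (f y powr e - f x powr e - e * f x powr (e - 1) * (f y - f x)) + e * f x powr (e - 1) * u"
      unfolding u_def by (simp add: algebra_simps)
    then have "\<bar>f y powr e - f x powr e - (\<Sum>b\<in>I. e * f x powr (e - 1) * f' x b * (y b - x b))\<bar>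
        \<le> M * K\<^sup>2 * n\<^sup>2 + M * (K * n\<^sup>2)" using 1 2 by linarith
    then show "\<bar>f y powr e - f x powr e - (\<Sum>b\<in>I. e * f x powr (e - 1) * f' x b * (y b - x b))\<bar>
        \<le> (M * K\<^sup>2 + M * K) * (l1_dist I x y)\<^sup>2"
      unfolding n_def by (simp add: algebra_simps)
  qed
qed

text \<open>The function \<open>f'\<close> is not an additional datum: its entries are the partial derivatives.\<close>

lemma quad_approx_on_partial_derivative:
  assumes "finite I" and q: "quad_approx_on I B f f'" and x: "x \<in> B" and b: "b \<in> I"
    and "0 < \<epsilon>" and B: "\<And>s. \<bar>s - x b\<bar> < \<epsilon> \<Longrightarrow> x(b := s) \<in> B"
  shows "((\<lambda>s. f (x(b := s))) has_real_derivative f' x b) (at (x b))"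
proof -
  obtain K where K: "0 \<le> K" "\<And>x y. x \<in> B \<Longrightarrow> y \<in> B \<Longrightarrow>
      \<bar>f y - f x - (\<Sum>b\<in>I. f' x b * (y b - x b))\<bar> \<le> K * (l1_dist I x y)\<^sup>2"
    using quad_approx_on_remainderE[OF q] by blast
  have est: "\<bar>(f (x(b := s)) - f x) / (s - x b) - f' x b\<bar> \<le> K * \<bar>s - x b\<bar>"
    if s: "\<bar>s - x b\<bar> < \<epsilon>" "s \<noteq> x b" for s
  proof -
    have 1: "(\<Sum>b'\<in>I. f' x b' * ((x(b := s)) b' - x b')) = f' x b * (s - x b)"
      using assms(1) b by (subst sum.remove[of I b]) auto
    have 2: "(\<Sum>b'\<in>I. \<bar>(x(b := s)) b' - x b'\<bar>) = \<bar>s - x b\<bar>"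
      using assms(1) b by (subst sum.remove[of I b]) auto
    have "\<bar>f (x(b := s)) - f x - f' x b * (s - x b)\<bar> \<le> K * \<bar>s - x b\<bar>\<^sup>2"
      using K(2)[OF x B[OF s(1)]] unfolding 1 2 .
    moreover have "(f (x(b := s)) - f x) / (s - x b) - f' x b
        = (f (x(b := s)) - f x - f' x b * (s - x b)) / (s - x b)"
      using s by (simp add: field_simps)
    ultimately show ?thesis
      using s by (simp add: abs_divide divide_le_eq power2_eq_square mult.assoc del: abs_mult_self_eq)
  qed
  have lim: "((\<lambda>s. K * \<bar>s - x b\<bar>) \<longlongrightarrow> 0) (at (x b))"
    by (auto intro!: tendsto_eq_intros)
  have "\<forall>\<^sub>F s in at (x b). norm ((f (x(b := s)) - f x) / (s - x b) - f' x b) \<le> K * \<bar>s - x b\<bar>"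
    unfolding eventually_at
    using est \<open>0 < \<epsilon>\<close> by (auto simp: dist_real_def intro!: exI[of _ \<epsilon>])
  then have "((\<lambda>s. (f (x(b := s)) - f x) / (s - x b) - f' x b) \<longlongrightarrow> 0) (at (x b))"
    by (rule Lim_null_comparison) (rule lim)
  then have "((\<lambda>s. (f (x(b := s)) - f x) / (s - x b)) \<longlongrightarrow> f' x b) (at (x b))"
    by (rule LIM_zero_cancel)
  then show ?thesis
    unfolding has_field_derivative_iff by (simp add: fun_upd_triv)
qed

section \<open>Weighted homogeneous systems and their Jacobian\<close>

text \<open>The polynomials \<open>\<Sum>j. a j * \<Prod>l. x (\<beta> j l)\<close> of a multihomogeneous eigenvalue problem: \<open>j\<close> runs over
  the monomials in the row \<open>b\<close>, and \<open>\<beta> j l\<close> is the variable in the \<open>l\<close>-th factor.  The assumption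
  \<open>degree\<close> states weighted homogeneity, with weight \<open>1 / p b\<close> for the variable \<open>b\<close>.\<close>

locale weighted_form =
  fixes I :: "'i set" and J :: "'i \<Rightarrow> 'j set" and a :: "'j \<Rightarrow> real"
    and L :: "'i \<Rightarrow> 'l set" and \<beta> :: "'j \<Rightarrow> 'l \<Rightarrow> 'i" and p :: "'i \<Rightarrow> real" and S :: real
  assumes finite_I: "finite I" and I_nonempty: "I \<noteq> {}"
    and finite_J: "b \<in> I \<Longrightarrow> finite (J b)"
    and finite_L: "b \<in> I \<Longrightarrow> finite (L b)"
    and a_nonneg: "b \<in> I \<Longrightarrow> j \<in> J b \<Longrightarrow> 0 \<le> a j"
    and \<beta>_in: "b \<in> I \<Longrightarrow> j \<in> J b \<Longrightarrow> l \<in> L b \<Longrightarrow> \<beta> j l \<in> I"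
    and p_gt_1: "b \<in> I \<Longrightarrow> 1 < p b"
    and degree: "b \<in> I \<Longrightarrow> j \<in> J b \<Longrightarrow> (\<Sum>l\<in>L b. 1 / p (\<beta> j l)) = S - 1 / p b"

begin

definition monomial :: "'i \<Rightarrow> 'j \<Rightarrow> ('i \<Rightarrow> real) \<Rightarrow> real" where
  "monomial b j x = (\<Prod>l\<in>L b. x (\<beta> j l))"

definition form :: "'i \<Rightarrow> ('i \<Rightarrow> real) \<Rightarrow> real" where
  "form b x = (\<Sum>j\<in>J b. a j * monomial b j x)"

definition quot :: "'i \<Rightarrow> ('i \<Rightarrow> real) \<Rightarrow> real" where
  "quot b x = form b x / x b powr (p b - 1)"

text \<open>The gradient of \<open>form b\<close>, written through logarithmic derivatives; for nonzero entries of \<open>x\<close> this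
  is the usual formula, since \<open>monomial b j x\<close> contains \<open>x b'\<close> with the exponent counted by the cardinality.\<close>

definition form_grad :: "'i \<Rightarrow> ('i \<Rightarrow> real) \<Rightarrow> 'i \<Rightarrow> real" where
  "form_grad b x b' = (\<Sum>j\<in>J b. a j * (monomial b j x * (real (card {l \<in> L b. \<beta> j l = b'}) / x b')))"

definition quot_grad :: "'i \<Rightarrow> ('i \<Rightarrow> real) \<Rightarrow> 'i \<Rightarrow> real" where
  "quot_grad b x b' = form_grad b x b' / x b powr (p b - 1)
     - (if b' = b then (p b - 1) * quot b x / x b else 0)"

text \<open>The gradient of \<open>quot b x * x b\<close>, the nonlinear part of the residual.\<close>

definition scaled_grad :: "'i \<Rightarrow> ('i \<Rightarrow> real) \<Rightarrow> 'i \<Rightarrow> real" where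
  "scaled_grad b x b' = quot_grad b x b' * x b + quot b x * (if b' = b then 1 else 0)"

text \<open>The derivative of the residual \<open>lam * x b - quot b x * x b\<close> in the direction \<open>y\<close>.\<close>

definition jac :: "real \<Rightarrow> ('i \<Rightarrow> real) \<Rightarrow> ('i \<Rightarrow> real) \<Rightarrow> 'i \<Rightarrow> real" where
  "jac lam x y b = lam * y b - (\<Sum>b'\<in>I. scaled_grad b x b' * y b')"

definition positive :: "('i \<Rightarrow> real) \<Rightarrow> bool" where
  "positive x \<longleftrightarrow> (\<forall>b\<in>I. 0 < x b)"

definition box :: "real \<Rightarrow> real \<Rightarrow> ('i \<Rightarrow> real) set" where
  "box l u = {x. \<forall>b\<in>I. l \<le> x b \<and> x b \<le> u}"

lemma p_pos: "b \<in> I \<Longrightarrow> 0 < p b"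
  using p_gt_1 by fastforce

lemma positiveD: "positive x \<Longrightarrow> b \<in> I \<Longrightarrow> 0 < x b"
  by (simp add: positive_def)

lemma monomial_pos: "positive x \<Longrightarrow> b \<in> I \<Longrightarrow> j \<in> J b \<Longrightarrow> 0 < monomial b j x"
  unfolding monomial_def positive_def using \<beta>_in by (auto intro!: prod_pos)

lemma form_nonneg: "positive x \<Longrightarrow> b \<in> I \<Longrightarrow> 0 \<le> form b x"
  unfolding form_def by (intro sum_nonneg mult_nonneg_nonneg less_imp_le[OF monomial_pos] a_nonneg)

lemma form_pos:
  assumes "positive x" "b \<in> I" "j \<in> J b" "0 < a j"
  shows "0 < form b x"
  unfolding form_def
  by (rule sum_pos2[of _ j]) (use assms a_nonneg monomial_pos finite_J in \<open>auto intro!: mult_nonneg_nonneg less_imp_le[OF monomial_pos]\<close>)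

lemma quot_nonneg: "positive x \<Longrightarrow> b \<in> I \<Longrightarrow> 0 \<le> quot b x"
  unfolding quot_def by (simp add: form_nonneg)

lemma form_cong: "(\<And>b. b \<in> I \<Longrightarrow> x b = y b) \<Longrightarrow> b \<in> I \<Longrightarrow> form b x = form b y"
  unfolding form_def monomial_def using \<beta>_in by (auto intro!: sum.cong prod.cong)

lemma quot_cong: "(\<And>b. b \<in> I \<Longrightarrow> x b = y b) \<Longrightarrow> b \<in> I \<Longrightarrow> quot b x = quot b y"
  unfolding quot_def using form_cong[of x y b] by simp

lemma form_grad_cong:
  assumes "\<And>b. b \<in> I \<Longrightarrow> x b = y b" "b \<in> I" "b' \<in> I"
  shows "form_grad b x b' = form_grad b y b'"
proof -
  have "monomial b j x = monomial b j y" if "j \<in> J b" for j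
    unfolding monomial_def using assms \<beta>_in[OF assms(2) that] by (auto intro!: prod.cong)
  then show ?thesis unfolding form_grad_def using assms by (auto intro!: sum.cong)
qed

lemma jac_cong:
  assumes "\<And>b. b \<in> I \<Longrightarrow> x b = x' b" "\<And>b. b \<in> I \<Longrightarrow> y b = y' b" "b \<in> I"
  shows "jac lam x y b = jac lam x' y' b"
  unfolding jac_def scaled_grad_def quot_grad_def
  using assms form_grad_cong[OF assms(1,3)] quot_cong[OF assms(1,3)] by (auto intro!: sum.cong)

lemma form_grad_nonneg: "positive x \<Longrightarrow> b \<in> I \<Longrightarrow> b' \<in> I \<Longrightarrow> 0 \<le> form_grad b x b'"
  unfolding form_grad_def
  by (intro sum_nonneg mult_nonneg_nonneg divide_nonneg_nonneg)
    (auto simp: a_nonneg positive_def intro!: less_imp_le[OF monomial_pos[unfolded positive_def]])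

lemma form_grad_pos:
  assumes "positive x" "b \<in> I" "j \<in> J b" "0 < a j" "b' \<in> \<beta> j ` L b"
  shows "0 < form_grad b x b'"
proof -
  have b': "b' \<in> I" using assms \<beta>_in by blast
  have "{l \<in> L b. \<beta> j l = b'} \<noteq> {}" using assms by auto
  then have "0 < card {l \<in> L b. \<beta> j l = b'}" using finite_L assms by (simp add: card_gt_0_iff)
  then have "0 < a j * (monomial b j x * (real (card {l \<in> L b. \<beta> j l = b'}) / x b'))"
    using assms b' monomial_pos by (auto simp: positive_def)
  moreover have "0 \<le> a i * (monomial b i x * (real (card {l \<in> L b. \<beta> i l = b'}) / x b'))"
    if "i \<in> J b" for i
    using assms b' that a_nonneg monomial_pos[of x b i] by (auto simp: positive_def)
  ultimately show ?thesis
    unfolding form_grad_def using assms finite_J by (intro sum_pos2[of _ j]) auto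
qed

text \<open>Euler's identity for the weights \<open>1 / p\<close>, applied to each monomial.\<close>

lemma form_grad_euler:
  assumes x: "positive x" and b: "b \<in> I"
  shows "(\<Sum>b'\<in>I. form_grad b x b' * (x b' / p b')) = (S - 1 / p b) * form b x"
proof -
  have card: "(\<Sum>b'\<in>I. real (card {l \<in> L b. \<beta> j l = b'}) / p b') = S - 1 / p b" if j: "j \<in> J b" for j
  proof -
    have "(\<Sum>b'\<in>I. real (card {l \<in> L b. \<beta> j l = b'}) / p b')
        = (\<Sum>b'\<in>I. \<Sum>l\<in>{l \<in> L b. \<beta> j l = b'}. 1 / p (\<beta> j l))"
      by (intro sum.cong) auto
    also have "\<dots> = (\<Sum>l\<in>L b. 1 / p (\<beta> j l))"
      using sum.group[of "L b" I "\<beta> j" "\<lambda>l. 1 / p (\<beta> j l)"] finite_L finite_I \<beta>_in b j by auto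
    finally show ?thesis using degree b j by simp
  qed
  have "(\<Sum>b'\<in>I. form_grad b x b' * (x b' / p b'))
      = (\<Sum>b'\<in>I. \<Sum>j\<in>J b. a j * monomial b j x * (real (card {l \<in> L b. \<beta> j l = b'}) / p b'))"
    unfolding form_grad_def sum_distrib_right
    using x by (intro sum.cong) (auto simp: positive_def)
  also have "\<dots> = (\<Sum>j\<in>J b. a j * monomial b j x * (S - 1 / p b))"
    by (subst sum.swap) (simp add: card[symmetric] sum_distrib_left cong: sum.cong)
  also have "\<dots> = (S - 1 / p b) * form b x"
    unfolding form_def by (simp add: sum_distrib_left sum_distrib_right mult_ac)
  finally show ?thesis .
qed

lemma jac_eq:
  assumes x: "positive x" and b: "b \<in> I"
  shows "jac lam x y b = (lam - quot b x) * y b + (p b - 1) * quot b x * y b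
    - x b / x b powr (p b - 1) * (\<Sum>b'\<in>I. form_grad b x b' * y b')"
proof -
  have xb: "x b \<noteq> 0" using x b by (auto simp: positive_def)
  have "scaled_grad b x b' * y b' = x b / x b powr (p b - 1) * (form_grad b x b' * y b')
      + (if b' = b then quot b x * y b - (p b - 1) * quot b x * y b else 0)" for b'
    unfolding scaled_grad_def quot_grad_def using xb by (simp add: field_simps)
  then have "(\<Sum>b'\<in>I. scaled_grad b x b' * y b')
      = x b / x b powr (p b - 1) * (\<Sum>b'\<in>I. form_grad b x b' * y b')
        + (quot b x * y b - (p b - 1) * quot b x * y b)"
    using finite_I b by (simp add: sum.distrib sum_distrib_left sum.delta)
  then show ?thesis unfolding jac_def by (simp add: algebra_simps)
qed

text \<open>By Euler's identity.  If \<open>lam\<close> bounds all quotients, the right-hand side is nonnegative, and a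
  matrix with nonpositive off-diagonal entries that maps a positive vector to a nonnegative one is an M-matrix.\<close>

lemma jac_weight:
  assumes x: "positive x" and b: "b \<in> I"
  shows "jac lam x (\<lambda>b. x b / p b) b = x b * ((lam - quot b x) / p b + quot b x * (1 - S))"
proof -
  have *: "x b / x b powr (p b - 1) * ((S - 1 / p b) * form b x) = x b * (S - 1 / p b) * quot b x"
    unfolding quot_def by simp
  show ?thesis
    unfolding jac_eq[OF x b] form_grad_euler[OF x b] *
    using p_pos[OF b] by (simp add: field_simps)
qed

lemma jac_linear: "jac lam x (\<lambda>b. s * y b - z b) b = s * jac lam x y b - jac lam x z b"
  unfolding jac_def by (simp add: algebra_simps sum_subtractf sum_distrib_left)

lemma form_quad:
  assumes "0 < l" and b: "b \<in> I"
  shows "quad_approx_on I (box l u) (form b) (form_grad b)"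
proof -
  have "quad_approx_on I (box l u) (\<lambda>x. \<Sum>j\<in>J b. a j * (\<Prod>k\<in>L b. x (\<beta> j k)))
      (\<lambda>x b'. \<Sum>j\<in>J b. a j * ((\<Prod>k\<in>L b. x (\<beta> j k)) * (\<Sum>k\<in>L b. if b' = \<beta> j k then 1 / x b' else 0)))"
  proof (intro quad_approx_on_sum quad_approx_on_cmult quad_approx_on_prod)
    fix j k assume jk: "j \<in> J b" "k \<in> L b"
    have "quad_approx_on I (box l u) (\<lambda>x. x (\<beta> j k)) (\<lambda>x b'. if b' = \<beta> j k then 1 else 0)"
      by (rule quad_approx_on_coord[of _ _ _ u])
        (use finite_I \<beta>_in[OF b jk] \<open>0 < l\<close> in \<open>force simp: box_def\<close>)+
    then show "quad_approx_on I (box l u) (\<lambda>x. x (\<beta> j k))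
        (\<lambda>x b'. x (\<beta> j k) * (if b' = \<beta> j k then 1 / x b' else 0))"
      by (rule quad_approx_on_cong) (use \<beta>_in[OF b jk] \<open>0 < l\<close> in \<open>auto simp: box_def\<close>)
  qed
  then show ?thesis
  proof (rule quad_approx_on_cong)
    fix x b' assume "x \<in> box l u" "b' \<in> I"
    have "(\<Sum>k\<in>L b. if b' = \<beta> j k then 1 / x b' else 0) = real (card {k \<in> L b. \<beta> j k = b'}) / x b'" for j
      using finite_L[OF b] by (simp add: sum.If_cases Int_def conj_commute eq_commute[of b'])
    then show "form_grad b x b' = (\<Sum>j\<in>J b. a j * ((\<Prod>k\<in>L b. x (\<beta> j k)) *
        (\<Sum>k\<in>L b. if b' = \<beta> j k then 1 / x b' else 0)))"
      unfolding form_grad_def monomial_def by simp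
  qed (simp add: form_def monomial_def)
qed

lemma coord_quad: "0 < l \<Longrightarrow> b \<in> I \<Longrightarrow>
    quad_approx_on I (box l u) (\<lambda>x. x b) (\<lambda>x b'. if b' = b then 1 else 0)"
  by (rule quad_approx_on_coord[of _ _ _ u]) (use finite_I in \<open>force simp: box_def\<close>)+

lemma quot_quad:
  assumes l: "0 < l" and b: "b \<in> I"
  shows "quad_approx_on I (box l u) (quot b) (quot_grad b)"
proof -
  have "quad_approx_on I (box l u) (\<lambda>x. x b powr (1 - p b))
      (\<lambda>x b'. (1 - p b) * x b powr (1 - p b - 1) * (if b' = b then 1 else 0))"
    by (rule quad_approx_on_powr[OF coord_quad[OF l b] l]) (use b in \<open>auto simp: box_def\<close>)
  from quad_approx_on_mult[OF form_quad[OF l b] this]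
  show ?thesis
  proof (rule quad_approx_on_cong)
    fix x assume x: "x \<in> box l u"
    have xb: "0 < x b" using x l b by (force simp: box_def)
    show eq: "quot b x = form b x * x b powr (1 - p b)"
      unfolding quot_def by (simp add: powr_diff xb)
    fix b'
    show "quot_grad b x b' = form_grad b x b' * x b powr (1 - p b)
        + form b x * ((1 - p b) * x b powr (1 - p b - 1) * (if b' = b then 1 else 0))"
      unfolding quot_grad_def eq using xb
      by (cases "b' = b") (simp_all add: powr_diff powr_minus divide_simps, simp add: algebra_simps)
  qed
qed

lemma scaled_quad:
  assumes l: "0 < l" and b: "b \<in> I"
  shows "quad_approx_on I (box l u) (\<lambda>x. quot b x * x b) (scaled_grad b)"
  using quad_approx_on_mult[OF quot_quad[OF l b] coord_quad[OF l b]]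
  by (rule quad_approx_on_cong) (auto simp: scaled_grad_def)

lemma continuous_quot: "b \<in> I \<Longrightarrow> continuous_on (Collect positive) (quot b)"
  unfolding quot_def form_def monomial_def
  by (intro continuous_intros continuous_on_product_coordinates[THEN continuous_on_subset])
    (auto simp: positive_def)

lemma continuous_jac_coeff:
  assumes "b \<in> I" "b' \<in> I" shows "continuous_on (Collect positive) (\<lambda>x. scaled_grad b x b')"
proof -
  have 1: "continuous_on (Collect positive) (\<lambda>x. if b' = b then (p b - 1) * quot b x / x b else 0)"
  proof (cases "b' = b")
    case True
    then show ?thesis
      using assms continuous_on_product_coordinates[THEN continuous_on_subset, OF subset_UNIV]
      by (force simp: positive_def intro!: continuous_on_divide continuous_on_mult continuous_on_const
          continuous_quot)
  qed simp
  show ?thesis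
    unfolding scaled_grad_def quot_grad_def form_grad_def monomial_def using assms
    by (intro continuous_intros 1 continuous_quot
        continuous_on_product_coordinates[THEN continuous_on_subset]) (auto simp: positive_def)
qed

text \<open>Every positive vector lies in the interior of some box, so an estimate on all boxes determines the
  partial derivatives at all positive vectors.\<close>

lemma partial_derivative_positive:
  assumes q: "\<And>l u. 0 < l \<Longrightarrow> quad_approx_on I (box l u) f f'" and x: "positive x" and b: "b \<in> I"
  shows "((\<lambda>s. f (x(b := s))) has_real_derivative f' x b) (at (x b))"
proof -
  define l where "l = Min (x ` I) / 2"
  have "0 < Min (x ` I)" using finite_I I_nonempty x by (subst Min_gr_iff) (auto simp: positive_def)
  then have l: "0 < l" unfolding l_def by simp
  have low: "2 * l \<le> x b'" if "b' \<in> I" for b' unfolding l_def using finite_I that by simp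
  define u where "u = Max (x ` I) + l"
  have up: "x b' + l \<le> u" if "b' \<in> I" for b' unfolding u_def using finite_I that by simp
  show ?thesis
  proof (rule quad_approx_on_partial_derivative[OF finite_I q[OF l, of u] _ b l])
    show "x \<in> box l u" unfolding box_def using low up l by force
    fix s assume s: "\<bar>s - x b\<bar> < l"
    have "l \<le> (x(b := s)) b' \<and> (x(b := s)) b' \<le> u" if "b' \<in> I" for b'
      using low[OF that] up[OF that] s l by (cases "b' = b") auto
    then show "x(b := s) \<in> box l u" unfolding box_def by simp
  qed
qed

end

text \<open>The two cases of the convergence theorem.  In the critical case \<open>S = 1\<close>, irreducibility is expressed by closed sets:
  no proper nonempty set of variables contains, with each of its rows, all variables of that row's nonzero
  monomials.\<close>

locale weighted_system = weighted_form +
  assumes subcritical_or_irreducible: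
      "(S < 1 \<and> (\<forall>b\<in>I. \<exists>j\<in>J b. 0 < a j)) \<or>
       (S = 1 \<and> (\<forall>T. T \<noteq> {} \<longrightarrow> T \<subseteq> I \<longrightarrow>
          (\<forall>b\<in>T. \<forall>j\<in>J b. 0 < a j \<longrightarrow> \<beta> j ` L b \<subseteq> T) \<longrightarrow> T = I))"
begin

lemma S_le_1: "S \<le> 1"
  using subcritical_or_irreducible by auto

lemma quot_pos:
  assumes "S < 1" "positive x" "b \<in> I" shows "0 < quot b x"
proof -
  obtain j where "j \<in> J b" "0 < a j" using subcritical_or_irreducible assms by auto
  then show ?thesis
    unfolding quot_def using form_pos[OF assms(2,3)] assms by (auto simp: positive_def intro!: divide_pos_pos)
qed

text \<open>Let \<open>\<theta>\<close> be the largest ratio of \<open>y\<close> to the vector \<open>w\<close> of \<open>jac_weight\<close>, so that \<open>z = \<theta> w - y \<ge> 0\<close> vanishes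
  somewhere.  At a zero of \<open>z\<close> only off-diagonal, hence nonpositive, entries contribute to \<open>jac z\<close>.  If
  \<open>\<theta> > 0\<close>, this contradicts strict positivity of \<open>jac w\<close> for \<open>S < 1\<close>; for \<open>S = 1\<close> the zeros of \<open>z\<close> form a
  closed set, so \<open>y = \<theta> w\<close>, which is not orthogonal to a positive \<open>g\<close>.  Hence \<open>y \<le> 0\<close>, and
  orthogonality to \<open>g\<close> gives \<open>y = 0\<close>.\<close>

lemma jac_injective:
  assumes x: "positive x" and lam: "\<And>b. b \<in> I \<Longrightarrow> quot b x \<le> lam"
    and y: "\<And>b. b \<in> I \<Longrightarrow> jac lam x y b \<le> 0"
    and g: "\<And>b. b \<in> I \<Longrightarrow> 0 < g b" and gy: "(\<Sum>b\<in>I. g b * y b) = 0" and b: "b \<in> I"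
  shows "y b = 0"
proof -
  define w where "w = (\<lambda>b. x b / p b)"
  have w: "0 < w b" if "b \<in> I" for b
    unfolding w_def using x p_pos that by (auto simp: positive_def)
  define \<theta> where "\<theta> = Max ((\<lambda>b. y b / w b) ` I)"
  define z where "z = (\<lambda>b. \<theta> * w b - y b)"
  have z_nonneg: "0 \<le> z b" if "b \<in> I" for b
  proof -
    have "y b / w b \<le> \<theta>" unfolding \<theta>_def using finite_I that by (intro Max_ge) auto
    then show ?thesis unfolding z_def using w[OF that] by (simp add: divide_le_eq)
  qed
  have "\<theta> \<in> (\<lambda>b. y b / w b) ` I"
    unfolding \<theta>_def using finite_I I_nonempty by (intro Max_in) auto
  then obtain b0 where b0: "b0 \<in> I" "z b0 = 0"
    using w unfolding z_def by force
  have jac_z: "jac lam x z b = \<theta> * jac lam x w b - jac lam x y b" for b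
    unfolding z_def by (rule jac_linear)
  have jac_w: "jac lam x w b = x b * ((lam - quot b x) / p b + quot b x * (1 - S))" if "b \<in> I" for b
    unfolding w_def by (rule jac_weight[OF x that])
  have jac_at_zero: "jac lam x z b = - (x b / x b powr (p b - 1) * (\<Sum>b'\<in>I. form_grad b x b' * z b'))"
    if "b \<in> I" "z b = 0" for b
    using jac_eq[OF x that(1), of lam z] that(2) by simp
  have row_nonneg: "0 \<le> form_grad b x b' * z b'" if "b \<in> I" "b' \<in> I" for b b'
    using form_grad_nonneg[OF x] z_nonneg that by simp
  have scale: "0 < x b / x b powr (p b - 1)" if "b \<in> I" for b
    using x that by (auto simp: positive_def)
  have jac_w_nonneg: "0 \<le> jac lam x w b" if "b \<in> I" for b
    unfolding jac_w[OF that] using x lam[OF that] quot_nonneg[OF x that] S_le_1 p_pos[OF that] that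
    by (intro mult_nonneg_nonneg add_nonneg_nonneg) (auto simp: positive_def less_imp_le)
  have "\<theta> \<le> 0"
  proof (rule ccontr)
    assume "\<not> \<theta> \<le> 0"
    then have \<theta>: "0 < \<theta>" by simp
    consider (sub) "S < 1" | (irr) "S = 1"
        "\<And>T. T \<noteq> {} \<Longrightarrow> T \<subseteq> I \<Longrightarrow> (\<forall>b\<in>T. \<forall>j\<in>J b. 0 < a j \<longrightarrow> \<beta> j ` L b \<subseteq> T) \<Longrightarrow> T = I"
      using subcritical_or_irreducible by auto
    then show False
    proof cases
      case sub
      have "0 < jac lam x w b0"
        unfolding jac_w[OF b0(1)]
        using x lam[OF b0(1)] quot_pos[OF sub x b0(1)] sub p_pos[OF b0(1)] b0(1)
        by (intro mult_pos_pos add_nonneg_pos) (auto simp: positive_def)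
      then have "0 < jac lam x z b0"
        unfolding jac_z using y[OF b0(1)] \<theta> by (smt (verit) mult_pos_pos)
      moreover have "jac lam x z b0 \<le> 0"
        unfolding jac_at_zero[OF b0]
        using mult_nonneg_nonneg[OF less_imp_le[OF scale[OF b0(1)]] sum_nonneg[OF row_nonneg[OF b0(1)]]]
        by simp
      ultimately show False by simp
    next
      case irr
      have "{b \<in> I. z b = 0} = I"
      proof (rule irr(2))
        show "\<forall>b\<in>{b \<in> I. z b = 0}. \<forall>j\<in>J b. 0 < a j \<longrightarrow> \<beta> j ` L b \<subseteq> {b \<in> I. z b = 0}"
        proof (intro ballI impI subsetI)
          fix b j b' assume b: "b \<in> {b \<in> I. z b = 0}" and j: "j \<in> J b" "0 < a j" "b' \<in> \<beta> j ` L b"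
          have bI: "b \<in> I" and zb: "z b = 0" using b by auto
          have b'I: "b' \<in> I" using \<beta>_in[OF bI j(1)] j(3) by blast
          have "0 \<le> jac lam x z b"
            unfolding jac_z using jac_w_nonneg[OF bI] y[OF bI] \<theta> by (smt (verit) mult_nonneg_nonneg)
          then have "(\<Sum>b'\<in>I. form_grad b x b' * z b') \<le> 0"
            unfolding jac_at_zero[OF bI zb] using scale[OF bI]
            by (metis neg_0_le_iff_le mult_pos_pos not_le)
          then have "form_grad b x b' * z b' = 0"
            using row_nonneg[OF bI] b'I finite_I sum_nonneg_eq_0_iff[of I "\<lambda>b'. form_grad b x b' * z b'"]
            by (metis (no_types, lifting) antisym sum_nonneg)
          moreover have "0 < form_grad b x b'" by (rule form_grad_pos[OF x bI j])
          ultimately show "b' \<in> {b \<in> I. z b = 0}" using b'I by simp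
        qed
      qed (use b0 in auto)
      then have "y b = \<theta> * w b" if "b \<in> I" for b using that unfolding z_def by force
      then have "0 < (\<Sum>b\<in>I. g b * y b)"
        using finite_I I_nonempty g w \<theta> by (intro sum_pos) auto
      then show False using gy by simp
    qed
  qed
  have y_le: "y b \<le> 0" if "b \<in> I" for b
    using z_nonneg[OF that] \<open>\<theta> \<le> 0\<close> w[OF that] unfolding z_def
    by (smt (verit) mult_nonpos_nonneg)
  have "(\<Sum>b\<in>I. - (g b * y b)) = 0" using gy by (simp add: sum_negf)
  moreover have "0 \<le> - (g b * y b)" if "b \<in> I" for b
    using g[OF that] y_le[OF that] by (simp add: mult_le_0_iff)
  ultimately have "- (g b * y b) = 0"
    using finite_I b sum_nonneg_eq_0_iff[of I "\<lambda>b. - (g b * y b)"] by blast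
  then show ?thesis using g[OF b] by simp
qed

end

section \<open>Comparison with a positive eigenvector\<close>

text \<open>A weighted system with a normaliser \<open>c\<close>, homogeneous of degree \<open>n\<close>, and a positive normalized
  eigenvector \<open>xbar\<close>.  The model is the product of the block norms of a vector; the assumptions record how it enters the argument: strict monotonicity locates \<open>xbar\<close> among the normalized
  vectors, bounded level sets give compactness, and a positive gradient excludes positive tangent vectors.\<close>

locale normalized_system = weighted_system I J a L \<beta> p S
  for I :: "'i::countable set" and J :: "'i \<Rightarrow> 'j set" and a :: "'j \<Rightarrow> real"
    and L :: "'i \<Rightarrow> 'l set" and \<beta> :: "'j \<Rightarrow> 'l \<Rightarrow> 'i" and p :: "'i \<Rightarrow> real" and S :: real +
  fixes c :: "('i \<Rightarrow> real) \<Rightarrow> real" and c_grad :: "('i \<Rightarrow> real) \<Rightarrow> 'i \<Rightarrow> real" and n :: nat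
    and xbar :: "'i \<Rightarrow> real" and \<mu> :: real
  assumes n_pos: "0 < n"
    and c_scale: "0 < t \<Longrightarrow> c (\<lambda>b. t * x b) = t ^ n * c x"
    and c_cong: "(\<And>b. b \<in> I \<Longrightarrow> x b = y b) \<Longrightarrow> c x = c y"
    and c_pos: "positive x \<Longrightarrow> 0 < c x"
    and c_strict_mono: "positive x \<Longrightarrow> (\<And>b. b \<in> I \<Longrightarrow> x b < y b) \<Longrightarrow> c x < c y"
    and c_level_bounded: "0 < l \<Longrightarrow> \<exists>u. \<forall>x. (\<forall>b\<in>I. l \<le> x b) \<longrightarrow> c x = 1 \<longrightarrow> (\<forall>b\<in>I. x b \<le> u)"
    and c_quad: "0 < l \<Longrightarrow> quad_approx_on I (box l u) c c_grad"
    and c_grad_pos: "positive x \<Longrightarrow> b \<in> I \<Longrightarrow> 0 < c_grad x b"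
    and c_grad_cong: "(\<And>b. b \<in> I \<Longrightarrow> x b = y b) \<Longrightarrow> b \<in> I \<Longrightarrow> c_grad x b = c_grad y b"
    and continuous_c: "continuous_on (Collect positive) c"
    and continuous_c_grad: "b \<in> I \<Longrightarrow> continuous_on (Collect positive) (\<lambda>x. c_grad x b)"
    and xbar_pos: "positive xbar" and c_xbar: "c xbar = 1"
    and xbar_eigen: "b \<in> I \<Longrightarrow> form b xbar = \<mu> * xbar b powr (p b - 1)"

lemma compact_positive_lower_bound:
  fixes f :: "'a::topological_space \<Rightarrow> real"
  assumes "compact K" "continuous_on K f" "\<And>x. x \<in> K \<Longrightarrow> 0 < f x"
  shows "\<exists>\<kappa>>0. \<forall>x\<in>K. \<kappa> \<le> f x"
proof (cases "K = {}")
  case False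
  then obtain x where "x \<in> K" "\<forall>y\<in>K. f x \<le> f y"
    using continuous_attains_inf[OF assms(1) _ assms(2)] by blast
  then show ?thesis using assms(3) by blast
qed (auto intro: exI[of _ 1])

lemma compact_fun_interval:
  fixes A B :: "'i \<Rightarrow> real"
  shows "compact {x. \<forall>b. x b \<in> {A b..B b}}"
proof -
  have "compactin (product_topology (\<lambda>i. euclidean) UNIV) (PiE UNIV (\<lambda>b. {A b..B b}))"
    unfolding compactin_PiE by auto
  moreover have "PiE UNIV (\<lambda>b. {A b..B b}) = {x. \<forall>b. x b \<in> {A b..B b}}"
    by (auto simp: PiE_UNIV_domain)
  ultimately show ?thesis unfolding euclidean_product_topology by simp
qed

context weighted_system
begin

lemma form_mono:
  assumes "b \<in> I" "\<And>b. b \<in> I \<Longrightarrow> 0 \<le> x b" "\<And>b. b \<in> I \<Longrightarrow> x b \<le> y b"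
  shows "form b x \<le> form b y"
  unfolding form_def monomial_def
  using assms a_nonneg \<beta>_in by (intro sum_mono mult_left_mono prod_mono) auto

lemma monomial_exp:
  assumes b: "b \<in> I"
  shows "monomial b j (\<lambda>b. x b * exp (\<theta> b / p b)) = monomial b j x * exp (\<Sum>l\<in>L b. \<theta> (\<beta> j l) / p (\<beta> j l))"
  unfolding monomial_def using finite_L[OF b] by (simp add: prod.distrib exp_sum)

text \<open>Weighted homogeneity: multiplying the variable \<open>b\<close> by \<open>exp (t / p b)\<close> multiplies the form by a
  power of \<open>exp t\<close>.\<close>

lemma form_exp:
  assumes b: "b \<in> I"
  shows "form b (\<lambda>b. x b * exp (t / p b)) = form b x * exp (t * (S - 1 / p b))"
proof -
  have "(\<Sum>l\<in>L b. t / p (\<beta> j l)) = t * (S - 1 / p b)" if "j \<in> J b" for j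
    using degree[OF b that] by (simp add: sum_distrib_left[symmetric, of t "\<lambda>l. 1 / p (\<beta> j l)", simplified])
  then show ?thesis
    unfolding form_def using monomial_exp[OF b, of _ x "\<lambda>_. t"]
    by (simp add: sum_distrib_right mult.assoc cong: sum.cong)
qed

lemma exp_powr_weight:
  assumes "b \<in> I" "0 < (s::real)"
  shows "(s * exp (t / p b)) powr (p b - 1) = s powr (p b - 1) * exp (t * (1 - 1 / p b))"
proof -
  have "t / p b * (p b - 1) = t * (1 - 1 / p b)" using p_pos[OF assms(1)] by (simp add: field_simps)
  then show ?thesis using assms by (simp add: powr_mult exp_powr_real)
qed

end

context normalized_system
begin

text \<open>The weight \<open>p b\<close> makes \<open>theta x\<close> constant exactly for the vectors \<open>xbar b * exp (t / p b)\<close>, the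
  orbit of \<open>xbar\<close> under the scaling of \<open>form_exp\<close>.\<close>

definition theta :: "('i \<Rightarrow> real) \<Rightarrow> 'i \<Rightarrow> real" where
  "theta x b = p b * ln (x b / xbar b)"

lemma xbar_gt_0: "b \<in> I \<Longrightarrow> 0 < xbar b"
  using xbar_pos by (auto simp: positive_def)

lemma theta_exp: "positive x \<Longrightarrow> b \<in> I \<Longrightarrow> x b = xbar b * exp (theta x b / p b)"
  unfolding theta_def using p_pos[of b] xbar_gt_0[of b] by (auto simp: positive_def)

lemma quot_xbar: "b \<in> I \<Longrightarrow> quot b xbar = \<mu>"
  unfolding quot_def using xbar_eigen xbar_gt_0[of b] by simp

lemma \<mu>_nonneg: "0 \<le> \<mu>"
  using I_nonempty quot_nonneg[OF xbar_pos] quot_xbar by force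

lemma \<mu>_pos: "S < 1 \<Longrightarrow> 0 < \<mu>"
  using I_nonempty quot_pos[OF _ xbar_pos] quot_xbar by force

text \<open>The scaled eigenvector has all its quotients equal to \<open>\<mu> * exp ((S - 1) * t)\<close>.  As the forms are monotone,
  any vector that touches a scaled eigenvector from above or below can be compared with it at the index of contact.\<close>

lemma form_exp_xbar:
  assumes b: "b \<in> I"
  shows "form b (\<lambda>b. xbar b * exp (t / p b)) = \<mu> * exp ((S - 1) * t) * (xbar b * exp (t / p b)) powr (p b - 1)"
proof -
  have "exp (t * (S - 1 / p b)) = exp ((S - 1) * t) * exp (t * (1 - 1 / p b))"
    by (simp add: exp_add[symmetric] algebra_simps)
  then show ?thesis
    using form_exp[OF b, of xbar t] exp_powr_weight[OF b xbar_gt_0[OF b], of t] xbar_eigen[OF b]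
    by (simp add: mult_ac)
qed

lemma quot_at_min:
  assumes x: "positive x" and b: "b \<in> I" and min: "\<And>b'. b' \<in> I \<Longrightarrow> theta x b \<le> theta x b'"
  shows "\<mu> * exp ((S - 1) * theta x b) \<le> quot b x"
proof -
  define t where "t = theta x b"
  have "xbar b' * exp (t / p b') \<le> x b'" if "b' \<in> I" for b'
    using theta_exp[OF x that] min[OF that] xbar_gt_0[OF that] p_pos[OF that]
    unfolding t_def by (metis divide_right_mono exp_le_cancel_iff less_imp_le mult_left_mono)
  then have "form b (\<lambda>b. xbar b * exp (t / p b)) \<le> form b x"
    using xbar_gt_0 b by (intro form_mono) (auto simp: less_imp_le)
  then have "\<mu> * exp ((S - 1) * t) * x b powr (p b - 1) \<le> form b x"
    unfolding form_exp_xbar[OF b] using theta_exp[OF x b] t_def by simp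
  then show ?thesis
    unfolding quot_def t_def[symmetric] using positiveD[OF x b] by (simp add: le_divide_eq)
qed

lemma quot_at_max:
  assumes x: "positive x" and b: "b \<in> I" and max: "\<And>b'. b' \<in> I \<Longrightarrow> theta x b' \<le> theta x b"
  shows "quot b x \<le> \<mu> * exp ((S - 1) * theta x b)"
proof -
  define t where "t = theta x b"
  have "x b' \<le> xbar b' * exp (t / p b')" if "b' \<in> I" for b'
    using theta_exp[OF x that] max[OF that] xbar_gt_0[OF that] p_pos[OF that]
    unfolding t_def by (metis divide_right_mono exp_le_cancel_iff less_imp_le mult_left_mono)
  then have "form b x \<le> form b (\<lambda>b. xbar b * exp (t / p b))"
    using x b by (intro form_mono) (auto simp: positive_def less_imp_le)
  then have "form b x \<le> \<mu> * exp ((S - 1) * t) * x b powr (p b - 1)"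
    unfolding form_exp_xbar[OF b] using theta_exp[OF x b] t_def by simp
  then show ?thesis
    unfolding quot_def t_def[symmetric] using positiveD[OF x b] by (simp add: divide_le_eq)
qed

text \<open>Let \<open>t\<close> be the least number for which \<open>z b \<le> xbar b * exp (t / p b)\<close> for all \<open>b\<close>.  The index \<open>b0\<close> gives
  \<open>t \<ge> 0\<close>, and comparing the forms at an index of equality gives \<open>lam \<le> \<mu> * exp ((S - 1) * t)\<close>.
  Entries with \<open>z b = 0\<close> satisfy the bound for every \<open>t\<close> and are left out of the maximum that defines \<open>t\<close>.\<close>

lemma eigenvalue_le:
  assumes z: "\<And>b. b \<in> I \<Longrightarrow> 0 \<le> z b" and b0: "b0 \<in> I" "xbar b0 \<le> z b0"
    and sub: "\<And>b. b \<in> I \<Longrightarrow> lam * z b powr (p b - 1) \<le> form b z"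
  shows "lam \<le> \<mu>"
proof -
  define I' where "I' = {b \<in> I. 0 < z b}"
  have b0': "b0 \<in> I'" unfolding I'_def using b0 xbar_gt_0[OF b0(1)] by simp
  have fin: "finite I'" unfolding I'_def using finite_I by simp
  define t where "t = Max (theta z ` I')"
  have "t \<in> theta z ` I'" unfolding t_def using fin b0' by (intro Max_in) auto
  then obtain b where b: "b \<in> I" "0 < z b" "theta z b = t" unfolding I'_def by auto
  have t_ge: "theta z b' \<le> t" if "b' \<in> I'" for b' unfolding t_def using fin that by simp
  have zexp: "z b' = xbar b' * exp (theta z b' / p b')" if "b' \<in> I" "0 < z b'" for b'
    unfolding theta_def using that xbar_gt_0[OF that(1)] p_pos[OF that(1)] by simp
  have "z b' \<le> xbar b' * exp (t / p b')" if b': "b' \<in> I" for b'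
  proof (cases "0 < z b'")
    case True
    have "theta z b' / p b' \<le> t / p b'"
      using t_ge[of b'] True b' p_pos[OF b'] unfolding I'_def by (simp add: divide_right_mono)
    then show ?thesis using zexp[OF b' True] xbar_gt_0[OF b'] by simp
  next
    case False
    then show ?thesis using xbar_gt_0[OF b'] by (smt (verit) exp_gt_zero mult_pos_pos)
  qed
  then have "form b z \<le> form b (\<lambda>b. xbar b * exp (t / p b))"
    using z b by (intro form_mono) auto
  then have "lam * z b powr (p b - 1) \<le> \<mu> * exp ((S - 1) * t) * z b powr (p b - 1)"
    using sub[OF b(1)] zexp[OF b(1,2)] b(3) unfolding form_exp_xbar[OF b(1)] by simp
  then have "lam \<le> \<mu> * exp ((S - 1) * t)" using b(2) by simp
  also have "\<dots> \<le> \<mu> * 1"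
  proof -
    have "0 \<le> theta z b0"
      unfolding theta_def using b0 xbar_gt_0[OF b0(1)] p_pos[OF b0(1)] by simp
    then have "0 \<le> t" using t_ge[OF b0'] by linarith
    then show ?thesis using S_le_1 \<mu>_nonneg by (intro mult_left_mono) (auto simp: mult_nonpos_nonneg)
  qed
  finally show ?thesis by simp
qed

lemma theta_min_exists:
  obtains b where "b \<in> I" "\<And>b'. b' \<in> I \<Longrightarrow> theta x b \<le> theta x b'"
proof -
  have "Min (theta x ` I) \<in> theta x ` I" using finite_I I_nonempty by (intro Min_in) auto
  then obtain b where "b \<in> I" "theta x b = Min (theta x ` I)" by (auto simp del: Min_in)
  then show ?thesis using finite_I by (intro that[of b]) auto
qed

lemma theta_max_exists:
  obtains b where "b \<in> I" "\<And>b'. b' \<in> I \<Longrightarrow> theta x b' \<le> theta x b"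
proof -
  have "Max (theta x ` I) \<in> theta x ` I" using finite_I I_nonempty by (intro Max_in) auto
  then obtain b where "b \<in> I" "theta x b = Max (theta x ` I)" by (auto simp del: Max_in)
  then show ?thesis using finite_I by (intro that[of b]) auto
qed

lemma theta_nonneg_somewhere:
  assumes x: "positive x" "c x = 1" shows "\<exists>b\<in>I. 0 \<le> theta x b"
proof (rule ccontr)
  assume "\<not> ?thesis"
  then have *: "theta x b < 0" if "b \<in> I" for b using that by force
  have "x b < xbar b" if "b \<in> I" for b
    using *[OF that] p_pos[OF that] xbar_gt_0[OF that] x(1) that
    unfolding theta_def by (auto simp: mult_less_0_iff positive_def ln_div)
  then have "c x < c xbar" by (intro c_strict_mono x)
  then show False using x c_xbar by simp
qed

lemma theta_nonpos_somewhere: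
  assumes x: "positive x" "c x = 1" shows "\<exists>b\<in>I. theta x b \<le> 0"
proof (rule ccontr)
  assume "\<not> ?thesis"
  then have *: "theta x b > 0" if "b \<in> I" for b using that by force
  have "xbar b < x b" if "b \<in> I" for b
    using *[OF that] p_pos[OF that] xbar_gt_0[OF that] x(1) that
    unfolding theta_def by (auto simp: zero_less_mult_iff positive_def ln_div)
  then have "c xbar < c x" by (intro c_strict_mono xbar_pos)
  then show False using x c_xbar by simp
qed

lemma theta_0_imp_eq: "positive x \<Longrightarrow> b \<in> I \<Longrightarrow> theta x b = 0 \<Longrightarrow> x b = xbar b"
  using theta_exp[of x b] by simp

text \<open>As \<open>c\<close> is strictly monotone, \<open>theta x\<close> takes a value \<open>\<le> 0\<close> and a value \<open>\<ge> 0\<close>.  Comparison at its minimum and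
  maximum gives \<open>\<mu> \<le> lam \<le> \<mu>\<close>, and equality forces both extreme values to be \<open>0\<close> if \<open>S < 1\<close>.  If
  \<open>S = 1\<close>, equality makes the set of minimal indices closed, so \<open>theta x\<close> is constant.\<close>

lemma normalized_eigenvector_unique:
  assumes x: "positive x" "c x = 1" and eig: "\<And>b. b \<in> I \<Longrightarrow> quot b x = lam"
  shows "lam = \<mu>" "\<And>b. b \<in> I \<Longrightarrow> x b = xbar b"
proof -
  obtain b1 where b1: "b1 \<in> I" "\<And>b. b \<in> I \<Longrightarrow> theta x b1 \<le> theta x b" using theta_min_exists by blast
  obtain b2 where b2: "b2 \<in> I" "\<And>b. b \<in> I \<Longrightarrow> theta x b \<le> theta x b2" using theta_max_exists by blast
  have t1: "theta x b1 \<le> 0" using theta_nonpos_somewhere[OF x] b1(2) by force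
  have t2: "0 \<le> theta x b2" using theta_nonneg_somewhere[OF x] b2(2) by force
  have le1: "\<mu> * exp ((S - 1) * theta x b1) \<le> lam" using quot_at_min[OF x(1) b1] eig[OF b1(1)] by simp
  have le2: "lam \<le> \<mu> * exp ((S - 1) * theta x b2)" using quot_at_max[OF x(1) b2] eig[OF b2(1)] by simp
  have e1: "\<mu> \<le> \<mu> * exp ((S - 1) * theta x b1)"
    using t1 S_le_1 \<mu>_nonneg mult_left_mono[of 1 "exp ((S - 1) * theta x b1)" \<mu>] by (auto simp: mult_nonpos_nonpos)
  have e2: "\<mu> * exp ((S - 1) * theta x b2) \<le> \<mu>"
    using t2 S_le_1 \<mu>_nonneg mult_left_mono[of "exp ((S - 1) * theta x b2)" 1 \<mu>] by (auto simp: mult_nonpos_nonneg)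
  show lam: "lam = \<mu>" using le1 le2 e1 e2 by linarith
  have "theta x b = 0" if b: "b \<in> I" for b
  proof (cases "S < 1")
    case True
    have "\<mu> * exp ((S - 1) * theta x b1) = \<mu>" "\<mu> * exp ((S - 1) * theta x b2) = \<mu>"
      using le1 le2 e1 e2 lam by linarith+
    then have "theta x b1 = 0" "theta x b2 = 0" using True \<mu>_pos[OF True] by auto
    then show ?thesis using b1(2)[OF b] b2(2)[OF b] by simp
  next
    case False
    then have S: "S = 1" and irr: "\<And>T. T \<noteq> {} \<Longrightarrow> T \<subseteq> I \<Longrightarrow>
        (\<forall>b\<in>T. \<forall>j\<in>J b. 0 < a j \<longrightarrow> \<beta> j ` L b \<subseteq> T) \<Longrightarrow> T = I"
      using subcritical_or_irreducible by auto
    define t where "t = theta x b1"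
    have xeq: "x b = xbar b * exp (theta x b / p b)" if "b \<in> I" for b by (rule theta_exp[OF x(1) that])
    have "{b \<in> I. theta x b = t} = I"
    proof (rule irr)
      show "\<forall>b\<in>{b \<in> I. theta x b = t}. \<forall>j\<in>J b. 0 < a j \<longrightarrow> \<beta> j ` L b \<subseteq> {b \<in> I. theta x b = t}"
      proof (intro ballI impI subsetI)
        fix b j b' assume b: "b \<in> {b \<in> I. theta x b = t}" and j: "j \<in> J b" "0 < a j" "b' \<in> \<beta> j ` L b"
        have bI: "b \<in> I" and tb: "theta x b = t" using b by auto
        define e where "e = (\<lambda>j. \<Sum>l\<in>L b. theta x (\<beta> j l) / p (\<beta> j l))"
        have mon: "monomial b i x = monomial b i xbar * exp (e i)" if "i \<in> J b" for i
        proof -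
          have "monomial b i x = monomial b i (\<lambda>b. xbar b * exp (theta x b / p b))"
            unfolding monomial_def using \<beta>_in[OF bI that] xeq by (intro prod.cong) auto
          then show ?thesis unfolding e_def using monomial_exp[OF bI, of i xbar "theta x"] by simp
        qed
        have sumt: "(\<Sum>l\<in>L b. t / p (\<beta> i l)) = t * (1 - 1 / p b)" if "i \<in> J b" for i
          using degree[OF bI that] S by (simp add: sum_distrib_left[symmetric, of t "\<lambda>l. 1 / p (\<beta> i l)", simplified])
        have e_ge: "t * (1 - 1 / p b) \<le> e i" if "i \<in> J b" for i
          unfolding sumt[OF that, symmetric] e_def
          using b1(2) \<beta>_in[OF bI that] p_pos unfolding t_def
          by (intro sum_mono divide_right_mono) (auto simp: less_imp_le)
        have "form b x = \<mu> * x b powr (p b - 1)"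
          using eig[OF bI] lam x(1) bI unfolding quot_def by (auto simp: positive_def divide_eq_eq)
        also have "\<dots> = form b xbar * exp (t * (1 - 1 / p b))"
          using xeq[OF bI] exp_powr_weight[OF bI xbar_gt_0[OF bI], of t] xbar_eigen[OF bI] tb by simp
        finally have "(\<Sum>i\<in>J b. a i * monomial b i xbar * (exp (e i) - exp (t * (1 - 1 / p b)))) = 0"
          unfolding form_def sum_distrib_right
          by (simp add: mon right_diff_distrib sum_subtractf mult.assoc cong: sum.cong)
        moreover have "0 \<le> a i * monomial b i xbar * (exp (e i) - exp (t * (1 - 1 / p b)))" if "i \<in> J b" for i
          using a_nonneg[OF bI that] monomial_pos[OF xbar_pos bI that] e_ge[OF that] by simp
        ultimately have "a j * monomial b j xbar * (exp (e j) - exp (t * (1 - 1 / p b))) = 0"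
          using sum_nonneg_eq_0_iff[OF finite_J[OF bI], of "\<lambda>i. a i * monomial b i xbar * (exp (e i) - exp (t * (1 - 1 / p b)))"] j(1)
          by blast
        then have "e j = t * (1 - 1 / p b)"
          using j monomial_pos[OF xbar_pos bI j(1)] by simp
        then have "(\<Sum>l\<in>L b. (theta x (\<beta> j l) - t) / p (\<beta> j l)) = 0"
          using sumt[OF j(1)] unfolding e_def by (simp add: diff_divide_distrib sum_subtractf)
        moreover have "0 \<le> (theta x (\<beta> j l) - t) / p (\<beta> j l)" if "l \<in> L b" for l
          using b1(2) \<beta>_in[OF bI j(1) that] p_pos unfolding t_def by (simp add: less_imp_le)
        ultimately have "(theta x (\<beta> j l) - t) / p (\<beta> j l) = 0" if "l \<in> L b" for l
          using sum_nonneg_eq_0_iff[OF finite_L[OF bI], of "\<lambda>l. (theta x (\<beta> j l) - t) / p (\<beta> j l)"] that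
          by blast
        then show "b' \<in> {b \<in> I. theta x b = t}"
          using j(3) \<beta>_in[OF bI j(1)] p_pos by force
      qed
    qed (use b1 t_def in auto)
    then have "\<forall>b\<in>I. theta x b = t" by blast
    then show ?thesis using t1 t2 b1(1) b2(1) b by force
  qed
  then show "x b = xbar b" if "b \<in> I" for b using theta_0_imp_eq x that by blast
qed

text \<open>For \<open>S < 1\<close> this is the comparison at the minimum of \<open>theta x\<close>.  For \<open>S = 1\<close> fix the
  index \<open>b0\<close> of the minimum.  If \<open>theta x b - theta x b0\<close> is bounded, then a single monomial of row \<open>b\<close> with
  positive coefficient cannot be large compared with \<open>x b powr (p b - 1)\<close>, so the difference is also bounded for the
  variables of that monomial.  By irreducibility it is bounded for all indices, and \<open>theta x\<close> is nonnegative
  somewhere.\<close>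

lemma theta_lower_bound:
  "\<exists>T\<ge>0. \<forall>x. positive x \<longrightarrow> c x = 1 \<longrightarrow> (\<forall>b\<in>I. quot b x \<le> lam0) \<longrightarrow> (\<forall>b\<in>I. - T \<le> theta x b)"
proof (cases "S < 1")
  case True
  define T where "T = \<bar>ln (lam0 / \<mu>)\<bar> / (1 - S)"
  have "- T \<le> theta x b" if x: "positive x" "\<forall>b\<in>I. quot b x \<le> lam0" and b: "b \<in> I" for x b
  proof -
    obtain b1 where b1: "b1 \<in> I" "\<And>b. b \<in> I \<Longrightarrow> theta x b1 \<le> theta x b" using theta_min_exists by blast
    have "\<mu> * exp ((S - 1) * theta x b1) \<le> lam0"
      using quot_at_min[OF x(1) b1] x(2) b1(1) by force
    then have le: "exp ((S - 1) * theta x b1) \<le> lam0 / \<mu>"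
      using \<mu>_pos[OF True] by (simp add: field_simps)
    then have "(S - 1) * theta x b1 \<le> ln (lam0 / \<mu>)"
      by (metis exp_gt_zero exp_ln ln_exp ln_le_cancel_iff order_less_le_trans)
    then have "- theta x b1 * (1 - S) \<le> \<bar>ln (lam0 / \<mu>)\<bar>" by (simp add: algebra_simps)
    then have "- theta x b1 \<le> T" unfolding T_def using True by (simp add: le_divide_eq)
    then show ?thesis using b1(2)[OF b] by linarith
  qed
  moreover have "0 \<le> T" unfolding T_def using True by simp
  ultimately show ?thesis by blast
next
  case False
  then have S: "S = 1" and irr: "\<And>T. T \<noteq> {} \<Longrightarrow> T \<subseteq> I \<Longrightarrow>
      (\<forall>b\<in>T. \<forall>j\<in>J b. 0 < a j \<longrightarrow> \<beta> j ` L b \<subseteq> T) \<Longrightarrow> T = I"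
    using subcritical_or_irreducible by auto
  define sub where "sub = (\<lambda>b0 x. positive x \<and> (\<forall>b\<in>I. quot b x \<le> lam0) \<and> (\<forall>b\<in>I. theta x b0 \<le> theta x b))"
  define ok where "ok = (\<lambda>b0 b. \<exists>T. \<forall>x. sub b0 x \<longrightarrow> theta x b - theta x b0 \<le> T)"
  have spread: "ok b0 b" if b0: "b0 \<in> I" and b: "b \<in> I" for b0 b
  proof -
    have "{b \<in> I. ok b0 b} = I"
    proof (rule irr)
      have "ok b0 b0" unfolding ok_def by (intro exI[of _ 0]) simp
      then show "{b \<in> I. ok b0 b} \<noteq> {}" using b0 by blast
      show "\<forall>b\<in>{b \<in> I. ok b0 b}. \<forall>j\<in>J b. 0 < a j \<longrightarrow> \<beta> j ` L b \<subseteq> {b \<in> I. ok b0 b}"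
      proof (intro ballI impI subsetI)
        fix b j b' assume b: "b \<in> {b \<in> I. ok b0 b}" and j: "j \<in> J b" "0 < a j" "b' \<in> \<beta> j ` L b"
        obtain T where bI: "b \<in> I" and T: "\<And>x. sub b0 x \<Longrightarrow> theta x b - theta x b0 \<le> T"
          using b unfolding ok_def by blast
        obtain l where l: "l \<in> L b" "b' = \<beta> j l" using j by blast
        have b'I: "b' \<in> I" using \<beta>_in[OF bI j(1) l(1)] l by simp
        define k where "k = a j * monomial b j xbar"
        have k: "0 < k" unfolding k_def using j monomial_pos[OF xbar_pos bI j(1)] by simp
        define q where "q = xbar b powr (p b - 1)"
        have q: "0 < q" unfolding q_def using xbar_gt_0[OF bI] by simp
        have "theta x b' - theta x b0 \<le> p b' * (\<bar>T\<bar> + ln (lam0 * q / k))" if sx: "sub b0 x" for x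
        proof -
          have x: "positive x" "quot b x \<le> lam0" and min: "\<And>b. b \<in> I \<Longrightarrow> theta x b0 \<le> theta x b"
            using sx bI unfolding sub_def by auto
          define e where "e = (\<Sum>l\<in>L b. theta x (\<beta> j l) / p (\<beta> j l))"
          have "monomial b j x = monomial b j (\<lambda>b. xbar b * exp (theta x b / p b))"
            unfolding monomial_def using \<beta>_in[OF bI j(1)] theta_exp[OF x(1)] by (intro prod.cong) auto
          then have mon: "a j * monomial b j x = k * exp e"
            unfolding e_def k_def using monomial_exp[OF bI, of j xbar "theta x"] by simp
          have "a j * monomial b j x \<le> form b x"
            unfolding form_def using j(1) finite_J[OF bI] a_nonneg[OF bI] monomial_pos[OF x(1) bI]
            by (intro member_le_sum) (auto simp: less_imp_le)
          also have "\<dots> \<le> lam0 * x b powr (p b - 1)"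
            using x(2) positiveD[OF x(1) bI] unfolding quot_def by (simp add: divide_le_eq)
          also have "\<dots> = lam0 * q * exp (theta x b * (1 - 1 / p b))"
            unfolding q_def using exp_powr_weight[OF bI xbar_gt_0[OF bI], of "theta x b"] theta_exp[OF x(1) bI] by simp
          finally have le: "k * exp e \<le> lam0 * q * exp (theta x b * (1 - 1 / p b))" unfolding mon .
          moreover have "0 < k * exp e" using k by simp
          ultimately have "0 < lam0 * q" by (metis exp_gt_zero order_less_le_trans zero_less_mult_pos2)
          then have C: "0 < lam0 * q / k" using k by simp
          have "exp e \<le> lam0 * q / k * exp (theta x b * (1 - 1 / p b))" using le k by (simp add: field_simps)
          also have "\<dots> = exp (ln (lam0 * q / k) + theta x b * (1 - 1 / p b))"
            using C by (simp add: exp_add)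
          finally have e_le: "e \<le> ln (lam0 * q / k) + theta x b * (1 - 1 / p b)" by simp
          have "(\<Sum>l\<in>L b. (theta x (\<beta> j l) - theta x b0) / p (\<beta> j l)) = e - theta x b0 * (1 - 1 / p b)"
            using degree[OF bI j(1)] S
            by (simp add: e_def diff_divide_distrib sum_subtractf
                sum_distrib_left[symmetric, of "theta x b0" "\<lambda>l. 1 / p (\<beta> j l)", simplified])
          also have "\<dots> \<le> ln (lam0 * q / k) + (theta x b - theta x b0) * (1 - 1 / p b)"
            using e_le by (simp add: algebra_simps)
          also have "(theta x b - theta x b0) * (1 - 1 / p b) \<le> \<bar>T\<bar> * 1"
            using T[OF sx] min[OF bI] p_gt_1[OF bI] by (intro mult_mono) auto
          finally have sum_le: "(\<Sum>l\<in>L b. (theta x (\<beta> j l) - theta x b0) / p (\<beta> j l)) \<le> \<bar>T\<bar> + ln (lam0 * q / k)"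
            by simp
          have "(theta x b' - theta x b0) / p b' \<le> (\<Sum>l\<in>L b. (theta x (\<beta> j l) - theta x b0) / p (\<beta> j l))"
            unfolding l(2) using finite_L[OF bI] l(1) min \<beta>_in[OF bI j(1)] p_pos
            by (intro member_le_sum[where f = "\<lambda>l. (theta x (\<beta> j l) - theta x b0) / p (\<beta> j l)"]) (auto simp: less_imp_le)
          then have "(theta x b' - theta x b0) / p b' \<le> \<bar>T\<bar> + ln (lam0 * q / k)" using sum_le by linarith
          then show ?thesis using p_pos[OF b'I] by (simp add: divide_le_eq mult.commute)
        qed
        then show "b' \<in> {b \<in> I. ok b0 b}" using b'I unfolding ok_def by blast
      qed
    qed auto
    then show ?thesis using b by blast
  qed
  then obtain T where T: "\<And>b0 b x. b0 \<in> I \<Longrightarrow> b \<in> I \<Longrightarrow> sub b0 x \<Longrightarrow> theta x b - theta x b0 \<le> T b0 b"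
    unfolding ok_def by metis
  define U where "U = (\<Sum>b0\<in>I. \<Sum>b\<in>I. \<bar>T b0 b\<bar>)"
  have TU: "T b0 b \<le> U" if "b0 \<in> I" "b \<in> I" for b0 b
  proof -
    have "\<bar>T b0 b\<bar> \<le> (\<Sum>b\<in>I. \<bar>T b0 b\<bar>)"
      using finite_I that by (intro member_le_sum[where f = "\<lambda>b. \<bar>T b0 b\<bar>"]) auto
    also have "\<dots> \<le> U" unfolding U_def
      using finite_I that by (intro member_le_sum[where f = "\<lambda>b0. \<Sum>b\<in>I. \<bar>T b0 b\<bar>"]) (auto simp: sum_nonneg)
    finally show ?thesis by simp
  qed
  have "- U \<le> theta x b" if x: "positive x" "c x = 1" "\<forall>b\<in>I. quot b x \<le> lam0" and b: "b \<in> I" for x b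
  proof -
    obtain b0 where b0: "b0 \<in> I" "\<And>b. b \<in> I \<Longrightarrow> theta x b0 \<le> theta x b" using theta_min_exists by blast
    obtain b2 where b2: "b2 \<in> I" "0 \<le> theta x b2" using theta_nonneg_somewhere[OF x(1,2)] by blast
    have "sub b0 x" unfolding sub_def using x b0 by auto
    then show ?thesis using T[OF b0(1) b2(1)] TU[OF b0(1) b2(1)] b2(2) b0(2)[OF b] by force
  qed
  moreover have "0 \<le> U" unfolding U_def by (simp add: sum_nonneg)
  ultimately show ?thesis by blast
qed

lemma sublevel_in_box:
  obtains l u where "0 < l" "\<And>x. positive x \<Longrightarrow> c x = 1 \<Longrightarrow> (\<And>b. b \<in> I \<Longrightarrow> quot b x \<le> lam0) \<Longrightarrow> x \<in> box l u"
proof -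
  obtain T where T: "0 \<le> T" "\<And>x b. positive x \<Longrightarrow> c x = 1 \<Longrightarrow> (\<forall>b\<in>I. quot b x \<le> lam0) \<Longrightarrow> b \<in> I \<Longrightarrow> - T \<le> theta x b"
    using theta_lower_bound[of lam0] by blast
  define l where "l = Min (xbar ` I) * exp (- T)"
  have "0 < Min (xbar ` I)" using finite_I I_nonempty xbar_gt_0 by (subst Min_gr_iff) auto
  then have l: "0 < l" unfolding l_def by simp
  have low: "l \<le> x b" if x: "positive x" "c x = 1" "\<forall>b\<in>I. quot b x \<le> lam0" and b: "b \<in> I" for x b
  proof -
    have "- T \<le> theta x b / p b"
    proof -
      have "- T * p b \<le> - T" using T(1) p_gt_1[OF b] mult_left_mono[of 1 "p b" T] by simp
      then have "- T * p b \<le> theta x b" using T(2)[OF x b] by linarith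
      then show ?thesis using p_pos[OF b] by (simp add: le_divide_eq)
    qed
    then have "Min (xbar ` I) * exp (- T) \<le> xbar b * exp (theta x b / p b)"
      using finite_I b xbar_gt_0[OF b] by (intro mult_mono) auto
    then show ?thesis unfolding l_def using theta_exp[OF x(1) b] by simp
  qed
  obtain u where "\<And>x b. \<forall>b\<in>I. l \<le> x b \<Longrightarrow> c x = 1 \<Longrightarrow> b \<in> I \<Longrightarrow> x b \<le> u"
    using c_level_bounded[OF l] by blast
  then show ?thesis
    using low by (intro that[of l u] l) (simp add: box_def)
qed

end

section \<open>Uniform bounds for the Newton equation\<close>

context normalized_system
begin

definition nrm :: "('i \<Rightarrow> real) \<Rightarrow> real" where
  "nrm v = (\<Sum>b\<in>I. \<bar>v b\<bar>)"

abbreviation err :: "('i \<Rightarrow> real) \<Rightarrow> real" where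
  "err x \<equiv> nrm (\<lambda>b. x b - xbar b)"

definition newton :: "('i \<Rightarrow> real) \<Rightarrow> real \<Rightarrow> ('i \<Rightarrow> real) \<Rightarrow> real \<Rightarrow> bool" where
  "newton x lam v \<delta> \<longleftrightarrow>
     (\<forall>b\<in>I. jac lam x v b + x b * \<delta> + (lam * x b - quot b x * x b) = 0) \<and>
     (\<Sum>b\<in>I. c_grad x b * v b) = 0"

definition retract :: "('i \<Rightarrow> real) \<Rightarrow> 'i \<Rightarrow> real" where
  "retract x b = x b / root n (c x)"

text \<open>A compact copy of a box: the entries outside \<open>I\<close> are fixed to \<open>0\<close>, so that compactness follows from
  Tychonoff's theorem.\<close>

definition ext_box :: "real \<Rightarrow> real \<Rightarrow> ('i \<Rightarrow> real) set" where
  "ext_box l u = {x. \<forall>b. x b \<in> {(if b \<in> I then l else 0)..(if b \<in> I then u else 0)}}"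

definition ext0 :: "('i \<Rightarrow> real) \<Rightarrow> 'i \<Rightarrow> real" where
  "ext0 x b = (if b \<in> I then x b else 0)"

lemma ext_box_compact: "compact (ext_box l u)"
  unfolding ext_box_def by (rule compact_fun_interval)

lemma ext0_in: "x \<in> box l u \<Longrightarrow> ext0 x \<in> ext_box l u"
  by (auto simp: ext_box_def ext0_def box_def)

lemma ext_box_subset: "0 < l \<Longrightarrow> ext_box l u \<subseteq> Collect positive"
proof
  fix x assume l: "0 < l" and x: "x \<in> ext_box l u"
  have "l \<le> x b" if "b \<in> I" for b
    using x that unfolding ext_box_def mem_Collect_eq by (auto dest: spec[of _ b])
  then show "x \<in> Collect positive" using l by (force simp: positive_def)
qed

lemma box_pos: "0 < l \<Longrightarrow> x \<in> box l u \<Longrightarrow> positive x"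
  by (force simp: box_def positive_def)

lemma nrm_nonneg: "0 \<le> nrm v"
  unfolding nrm_def by (simp add: sum_nonneg)

lemma nrm_triangle: "nrm (\<lambda>b. v b + w b) \<le> nrm v + nrm w"
  unfolding nrm_def sum.distrib[symmetric] by (intro sum_mono abs_triangle_ineq)

lemma nrm_scale: "nrm (\<lambda>b. s * v b) = \<bar>s\<bar> * nrm v"
  unfolding nrm_def by (simp add: abs_mult sum_distrib_left)

lemma nrm_component: "b \<in> I \<Longrightarrow> \<bar>v b\<bar> \<le> nrm v"
  unfolding nrm_def using finite_I by (intro member_le_sum[where f = "\<lambda>b. \<bar>v b\<bar>"]) auto

lemma nrm_cong: "(\<And>b. b \<in> I \<Longrightarrow> v b = w b) \<Longrightarrow> nrm v = nrm w"
  unfolding nrm_def by (intro sum.cong) auto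

lemma continuous_comp_pos:
  assumes "continuous_on (Collect positive) f" "continuous_on K g" "g ` K \<subseteq> Collect positive"
  shows "continuous_on K (\<lambda>z. f (g z))"
  using continuous_on_compose2[OF assms] .

lemma continuous_coord_comp:
  fixes g :: "'z::topological_space \<Rightarrow> 'i \<Rightarrow> real"
  shows "continuous_on K g \<Longrightarrow> continuous_on K (\<lambda>z. g z b)"
  by (rule continuous_on_compose2[OF continuous_on_product_coordinates]) auto

text \<open>The right-hand side is positive for \<open>nrm y = 1\<close> by \<open>jac_injective\<close>; it is continuous in
  \<open>(x, lam, y)\<close>, so it has a positive minimum on the compact set of admissible triples.  Both sides are
  positively homogeneous in \<open>y\<close>.\<close>

lemma jac_uniform_injective:
  assumes l: "0 < l"
  shows "\<exists>\<kappa>>0. \<forall>x\<in>box l u. \<forall>lam\<le>lam0. (\<forall>b\<in>I. quot b x \<le> lam) \<longrightarrow>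
    (\<forall>y. \<kappa> * nrm y \<le> (\<Sum>b\<in>I. max 0 (jac lam x y b)) + \<bar>\<Sum>b\<in>I. c_grad x b * y b\<bar>)"
proof -
  define C where "C = ext_box l u \<times> {0..lam0} \<times> ext_box (-1) 1"
  have C: "compact C" unfolding C_def by (intro compact_Times ext_box_compact compact_Icc)
  define X where "X = (fst :: ('i \<Rightarrow> real) \<times> real \<times> ('i \<Rightarrow> real) \<Rightarrow> _)"
  define \<Lambda> where "\<Lambda> = (\<lambda>z :: ('i \<Rightarrow> real) \<times> real \<times> ('i \<Rightarrow> real). fst (snd z))"
  define Y where "Y = (\<lambda>z :: ('i \<Rightarrow> real) \<times> real \<times> ('i \<Rightarrow> real). snd (snd z))"
  have cX: "continuous_on C X" and cL: "continuous_on C \<Lambda>" and cY: "continuous_on C Y"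
    unfolding X_def \<Lambda>_def Y_def by (intro continuous_intros)+
  have Xpos: "X ` C \<subseteq> Collect positive"
    using ext_box_subset[OF l] unfolding C_def X_def by auto
  have cq: "continuous_on C (\<lambda>z. quot b (X z))" if "b \<in> I" for b
    by (rule continuous_comp_pos[OF continuous_quot[OF that] cX Xpos])
  have cs: "continuous_on C (\<lambda>z. scaled_grad b (X z) b')" if "b \<in> I" "b' \<in> I" for b b'
    by (rule continuous_comp_pos[OF continuous_jac_coeff[OF that] cX Xpos])
  have cg: "continuous_on C (\<lambda>z. c_grad (X z) b)" if "b \<in> I" for b
    by (rule continuous_comp_pos[OF continuous_c_grad[OF that] cX Xpos])
  have cYb: "continuous_on C (\<lambda>z. Y z b)" for b by (rule continuous_coord_comp[OF cY])
  define h where "h = (\<lambda>z. (\<Sum>b\<in>I. max 0 (quot b (X z) - \<Lambda> z)) + \<bar>nrm (Y z) - 1\<bar>)"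
  have "continuous_on C h"
    unfolding h_def nrm_def by (intro continuous_intros cq cL cYb)
  then have "closed (C \<inter> h -` {0})"
    by (rule continuous_closed_preimage) (use compact_imp_closed[OF C] in auto)
  then have K: "compact (C \<inter> (C \<inter> h -` {0}))"
    by (rule compact_Int_closed[OF C])
  define K where "K = C \<inter> (C \<inter> h -` {0})"
  define f where "f = (\<lambda>z. (\<Sum>b\<in>I. max 0 (jac (\<Lambda> z) (X z) (Y z) b)) + \<bar>\<Sum>b\<in>I. c_grad (X z) b * Y z b\<bar>)"
  have cf: "continuous_on C f"
    unfolding f_def jac_def by (intro continuous_intros cs cg cL cYb)
  have sum_max_0: "(\<Sum>b\<in>I. max 0 (w b)) = 0 \<longleftrightarrow> (\<forall>b\<in>I. w b \<le> 0)" for w :: "'i \<Rightarrow> real"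
  proof -
    have "(\<Sum>b\<in>I. max 0 (w b)) = 0 \<longleftrightarrow> (\<forall>b\<in>I. max 0 (w b) = 0)"
      using finite_I by (intro sum_nonneg_eq_0_iff) auto
    then show ?thesis by (auto simp: max_def)
  qed
  have hK: "(\<forall>b\<in>I. quot b (X z) \<le> \<Lambda> z) \<and> nrm (Y z) = 1" if "h z = 0" for z
  proof -
    have "0 \<le> (\<Sum>b\<in>I. max 0 (quot b (X z) - \<Lambda> z))" by (intro sum_nonneg) auto
    then have "(\<Sum>b\<in>I. max 0 (quot b (X z) - \<Lambda> z)) = 0" "nrm (Y z) = 1"
      using that unfolding h_def by linarith+
    then show ?thesis unfolding sum_max_0 by auto
  qed
  have "\<exists>\<kappa>>0. \<forall>z\<in>K. \<kappa> \<le> f z"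
  proof (rule compact_positive_lower_bound)
    show "compact K" unfolding K_def by (rule K)
    show "continuous_on K f" using cf by (rule continuous_on_subset) (auto simp: K_def)
    fix z assume z: "z \<in> K"
    then have zC: "z \<in> C" and hz: "\<And>b. b \<in> I \<Longrightarrow> quot b (X z) \<le> \<Lambda> z" "nrm (Y z) = 1"
      using hK unfolding K_def by auto
    have Xz: "positive (X z)" using Xpos zC by blast
    have nonneg: "0 \<le> (\<Sum>b\<in>I. max 0 (jac (\<Lambda> z) (X z) (Y z) b))" by (intro sum_nonneg) auto
    show "0 < f z"
    proof (rule ccontr)
      assume "\<not> 0 < f z"
      then have "(\<Sum>b\<in>I. max 0 (jac (\<Lambda> z) (X z) (Y z) b)) = 0" "(\<Sum>b\<in>I. c_grad (X z) b * Y z b) = 0"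
        using nonneg unfolding f_def by linarith+
      then have le: "\<forall>b\<in>I. jac (\<Lambda> z) (X z) (Y z) b \<le> 0"
        and tangent: "(\<Sum>b\<in>I. c_grad (X z) b * Y z b) = 0"
        unfolding sum_max_0 by auto
      have sign: "jac (\<Lambda> z) (X z) (Y z) b \<le> 0" if "b \<in> I" for b using le that by blast
      have "Y z b = 0" if "b \<in> I" for b
        by (rule jac_injective[OF Xz hz(1) sign c_grad_pos[OF Xz] tangent that])
      then have "nrm (Y z) = 0" unfolding nrm_def by simp
      then show False using hz by simp
    qed
  qed
  then obtain \<kappa> where \<kappa>: "0 < \<kappa>" "\<And>z. z \<in> K \<Longrightarrow> \<kappa> \<le> f z" by blast
  have "\<kappa> * nrm y \<le> (\<Sum>b\<in>I. max 0 (jac lam x y b)) + \<bar>\<Sum>b\<in>I. c_grad x b * y b\<bar>"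
    if x: "x \<in> box l u" and lam: "lam \<le> lam0" "\<forall>b\<in>I. quot b x \<le> lam" for x lam y
  proof (cases "nrm y = 0")
    case True
    then show ?thesis by (simp add: sum_nonneg)
  next
    case False
    then have ny: "0 < nrm y" using nrm_nonneg[of y] by simp
    define s where "s = 1 / nrm y"
    have s: "0 < s" unfolding s_def using ny by simp
    define y' where "y' = (\<lambda>b. s * y b)"
    have ny': "nrm y' = 1" unfolding y'_def nrm_scale using ny s_def by simp
    define z where "z = (ext0 x, lam, ext0 y')"
    have z: "X z = ext0 x" "\<Lambda> z = lam" "Y z = ext0 y'" unfolding z_def X_def \<Lambda>_def Y_def by auto
    have eq: "\<And>b. b \<in> I \<Longrightarrow> ext0 x b = x b" "\<And>b. b \<in> I \<Longrightarrow> ext0 y' b = y' b" unfolding ext0_def by auto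
    have qx: "quot b (ext0 x) = quot b x" if "b \<in> I" for b using quot_cong[OF eq(1) that] .
    have "y' \<in> box (-1) 1"
      unfolding box_def using nrm_component[of _ y'] ny' by (auto simp: abs_le_iff)
    moreover have "0 \<le> lam"
      using I_nonempty lam(2) quot_nonneg[OF box_pos[OF l x]] by force
    ultimately have "z \<in> C" unfolding C_def z_def using x lam ext0_in by auto
    moreover have "nrm (ext0 y') = 1" using ny' nrm_cong[OF eq(2)] by simp
    then have "h z = 0" unfolding h_def z using lam(2) qx by simp
    ultimately have "\<kappa> \<le> f z" by (intro \<kappa>) (simp add: K_def)
    also have "f z = (\<Sum>b\<in>I. max 0 (jac lam x y' b)) + \<bar>\<Sum>b\<in>I. c_grad x b * y' b\<bar>"
      unfolding f_def z using jac_cong[OF eq] c_grad_cong[OF eq(1)] eq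
      by (intro arg_cong2[where f = "(+)"] arg_cong[where f = abs] sum.cong) auto
    also have "\<dots> = s * ((\<Sum>b\<in>I. max 0 (jac lam x y b)) + \<bar>\<Sum>b\<in>I. c_grad x b * y b\<bar>)"
    proof -
      have j: "jac lam x y' b = s * jac lam x y b" for b
        unfolding y'_def using jac_linear[of lam x s y "\<lambda>_. 0" b] by (simp add: jac_def)
      have "max 0 (s * w) = s * max 0 w" for w
        using s by (auto simp: max_def zero_le_mult_iff mult_le_0_iff)
      then have 1: "(\<Sum>b\<in>I. max 0 (jac lam x y' b)) = s * (\<Sum>b\<in>I. max 0 (jac lam x y b))"
        unfolding j by (simp add: sum_distrib_left)
      have "(\<Sum>b\<in>I. c_grad x b * y' b) = s * (\<Sum>b\<in>I. c_grad x b * y b)"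
        unfolding y'_def by (simp add: sum_distrib_left mult_ac)
      then show ?thesis using 1 s by (simp add: abs_mult distrib_left)
    qed
    finally show ?thesis using ny unfolding s_def by (simp add: field_simps)
  qed
  then show ?thesis using \<kappa>(1) by blast
qed

lemma jac_bounded:
  assumes l: "0 < l"
  shows "\<exists>K\<ge>0. \<forall>x\<in>box l u. \<forall>lam. \<bar>lam\<bar> \<le> lam0 \<longrightarrow> (\<forall>y. \<forall>b\<in>I. \<bar>jac lam x y b\<bar> \<le> K * nrm y)"
proof -
  have "\<exists>K\<ge>0. \<forall>x\<in>box l u. \<forall>b'\<in>I. \<bar>scaled_grad b x b'\<bar> \<le> K" if "b \<in> I" for b
  proof (rule quad_approx_onE[OF scaled_quad[OF l that, of u]])
    fix K assume K: "0 \<le> K" "quad_bound_on K I (box l u) (\<lambda>x. quot b x * x b) (scaled_grad b)"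
    show ?thesis using K(1) quad_bound_onD(2)[OF K(2)] by (intro exI[of _ K]) simp
  qed
  then obtain k where k: "\<And>b. b \<in> I \<Longrightarrow> 0 \<le> k b"
    "\<And>b x b'. b \<in> I \<Longrightarrow> x \<in> box l u \<Longrightarrow> b' \<in> I \<Longrightarrow> \<bar>scaled_grad b x b'\<bar> \<le> k b"
    by metis
  define K where "K = \<bar>lam0\<bar> + sum k I"
  have "\<bar>jac lam x y b\<bar> \<le> K * nrm y" if "x \<in> box l u" "\<bar>lam\<bar> \<le> lam0" "b \<in> I" for x lam y b
  proof -
    have "\<bar>\<Sum>b'\<in>I. scaled_grad b x b' * y b'\<bar> \<le> (\<Sum>b'\<in>I. k b * \<bar>y b'\<bar>)"
      by (rule sum_abs[THEN order_trans]) (use k that in \<open>auto simp: abs_mult intro!: sum_mono mult_right_mono\<close>)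
    also have "\<dots> = k b * nrm y" unfolding nrm_def by (simp add: sum_distrib_left)
    also have "\<dots> \<le> sum k I * nrm y"
      using finite_I k that nrm_nonneg by (intro mult_right_mono member_le_sum) auto
    finally have 1: "\<bar>\<Sum>b'\<in>I. scaled_grad b x b' * y b'\<bar> \<le> sum k I * nrm y" .
    have "\<bar>lam * y b\<bar> \<le> \<bar>lam0\<bar> * nrm y"
      unfolding abs_mult using that nrm_component[OF that(3)] by (intro mult_mono) auto
    then show ?thesis using 1 unfolding jac_def K_def distrib_right by linarith
  qed
  moreover have "0 \<le> K" unfolding K_def using k by (simp add: sum_nonneg)
  ultimately show ?thesis by blast
qed

text \<open>After a change of sign of \<open>(y, \<epsilon>)\<close> one may assume \<open>\<epsilon> \<ge> 0\<close>.  Then the positive part of \<open>jac lam x y\<close> is at most \<open>e\<close>, which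
  bounds \<open>y\<close>; the equation then bounds \<open>\<epsilon>\<close>.\<close>

lemma bordered_inverse_bound:
  assumes l: "0 < l"
  shows "\<exists>K\<ge>0. \<forall>x\<in>box l u. \<forall>lam\<le>lam0. (\<forall>b\<in>I. quot b x \<le> lam) \<longrightarrow> (\<forall>y \<epsilon> e.
    (\<forall>b\<in>I. \<bar>jac lam x y b + \<epsilon> * x b\<bar> \<le> e) \<longrightarrow> \<bar>\<Sum>b\<in>I. c_grad x b * y b\<bar> \<le> e \<longrightarrow>
      nrm y \<le> K * e \<and> \<bar>\<epsilon>\<bar> \<le> K * e)"
proof -
  obtain \<kappa> where \<kappa>: "0 < \<kappa>" "\<And>x lam y. x \<in> box l u \<Longrightarrow> lam \<le> lam0 \<Longrightarrow> \<forall>b\<in>I. quot b x \<le> lam \<Longrightarrow>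
      \<kappa> * nrm y \<le> (\<Sum>b\<in>I. max 0 (jac lam x y b)) + \<bar>\<Sum>b\<in>I. c_grad x b * y b\<bar>"
    using jac_uniform_injective[OF l, of u lam0] by blast
  obtain K1 where K1: "0 \<le> K1" "\<And>x lam y b. x \<in> box l u \<Longrightarrow> \<bar>lam\<bar> \<le> lam0 \<Longrightarrow> b \<in> I \<Longrightarrow> \<bar>jac lam x y b\<bar> \<le> K1 * nrm y"
    using jac_bounded[OF l, of u lam0] by blast
  define K2 where "K2 = (real (card I) + 1) / \<kappa>"
  define K where "K = K2 + (1 + K1 * K2) / l"
  have K2: "0 \<le> K2" unfolding K2_def using \<kappa> by simp
  have "nrm y \<le> K * e \<and> \<bar>\<epsilon>\<bar> \<le> K * e"
    if x: "x \<in> box l u" and lam: "lam \<le> lam0" "\<forall>b\<in>I. quot b x \<le> lam"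
      and r: "\<forall>b\<in>I. \<bar>jac lam x y b + \<epsilon> * x b\<bar> \<le> e" and g: "\<bar>\<Sum>b\<in>I. c_grad x b * y b\<bar> \<le> e"
    for x lam y \<epsilon> e
  proof -
    have e: "0 \<le> e" using g by linarith
    have xpos: "0 < x b" if "b \<in> I" for b using box_pos[OF l x] that by (rule positiveD)
    have main: "nrm y \<le> K2 * e"
      if eps: "0 \<le> \<epsilon>" and r: "\<forall>b\<in>I. \<bar>jac lam x y b + \<epsilon> * x b\<bar> \<le> e" and g: "\<bar>\<Sum>b\<in>I. c_grad x b * y b\<bar> \<le> e" for \<epsilon> y
    proof -
      have "max 0 (jac lam x y b) \<le> e" if "b \<in> I" for b
      proof -
        have "0 \<le> \<epsilon> * x b" using eps xpos[OF that] by simp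
        then show ?thesis using r that e by (smt (verit))
      qed
      then have "(\<Sum>b\<in>I. max 0 (jac lam x y b)) \<le> (\<Sum>b\<in>I. e)" by (intro sum_mono)
      then have "\<kappa> * nrm y \<le> (real (card I) + 1) * e"
        using \<kappa>(2)[OF x lam, of y] g by (simp add: distrib_right)
      then show ?thesis unfolding K2_def using \<kappa>(1) by (simp add: field_simps)
    qed
    have ny: "nrm y \<le> K2 * e"
    proof (cases "0 \<le> \<epsilon>")
      case True
      then show ?thesis using main r g by blast
    next
      case False
      have "jac lam x (\<lambda>b. - y b) b + - \<epsilon> * x b = - (jac lam x y b + \<epsilon> * x b)" for b
        unfolding jac_def by (simp add: sum_negf)
      then have r': "\<forall>b\<in>I. \<bar>jac lam x (\<lambda>b. - y b) b + - \<epsilon> * x b\<bar> \<le> e"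
        using r by (metis abs_minus_cancel)
      have "nrm (\<lambda>b. - y b) \<le> K2 * e"
        by (rule main[OF _ r']) (use False g in \<open>simp_all add: sum_negf\<close>)
      then show ?thesis unfolding nrm_def by simp
    qed
    obtain b where b: "b \<in> I" using I_nonempty by blast
    have "0 \<le> lam" using lam(2) b quot_nonneg[OF box_pos[OF l x] b] by force
    then have "\<bar>jac lam x y b\<bar> \<le> K1 * nrm y" using lam by (intro K1(2)[OF x _ b]) auto
    also have "\<dots> \<le> K1 * (K2 * e)" using ny K1 by (intro mult_left_mono)
    finally have "\<bar>\<epsilon> * x b\<bar> \<le> e + K1 * (K2 * e)"
      using r b by (smt (verit))
    moreover have "\<bar>\<epsilon>\<bar> * l \<le> \<bar>\<epsilon> * x b\<bar>"
      using x b xpos[OF b] by (simp add: abs_mult box_def mult_left_mono)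
    ultimately have "\<bar>\<epsilon>\<bar> * l \<le> (1 + K1 * K2) * e" by (simp add: algebra_simps)
    then have "\<bar>\<epsilon>\<bar> \<le> (1 + K1 * K2) / l * e" using l by (simp add: field_simps)
    moreover have "0 \<le> K2 * e" "0 \<le> (1 + K1 * K2) / l * e" using e K1 K2 l by auto
    ultimately show ?thesis using ny unfolding K_def distrib_right by linarith
  qed
  moreover have "0 \<le> K" unfolding K_def using K1 K2 l by simp
  ultimately show ?thesis by blast
qed

text \<open>For \<open>\<delta> > 0\<close> the Newton equation would give \<open>jac lam x v < 0\<close> for a tangential \<open>v\<close>, so \<open>v = 0\<close> by
  \<open>jac_injective\<close>, and then \<open>jac lam x v\<close> is not negative.\<close>

lemma newton_increment_nonpos:
  assumes x: "positive x" and lam: "\<And>b. b \<in> I \<Longrightarrow> quot b x \<le> lam" and v: "newton x lam v \<delta>"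
  shows "\<delta> \<le> 0"
proof (rule ccontr)
  assume \<delta>: "\<not> \<delta> \<le> 0"
  have r: "0 \<le> lam * x b - quot b x * x b" if "b \<in> I" for b
    using lam[OF that] positiveD[OF x that] by (simp add: mult_right_mono)
  have eq: "jac lam x v b = - (x b * \<delta>) - (lam * x b - quot b x * x b)" if "b \<in> I" for b
  proof -
    have "jac lam x v b + x b * \<delta> + (lam * x b - quot b x * x b) = 0"
      using v that unfolding newton_def by blast
    then show ?thesis by linarith
  qed
  have neg: "jac lam x v b < 0" if "b \<in> I" for b
  proof -
    have "0 < x b * \<delta>" using \<delta> positiveD[OF x that] by simp
    then show ?thesis using eq[OF that] r[OF that] by linarith
  qed
  have tangent: "(\<Sum>b\<in>I. c_grad x b * v b) = 0" using v unfolding newton_def by blast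
  have "v b = 0" if "b \<in> I" for b
    by (rule jac_injective[OF x lam less_imp_le[OF neg] c_grad_pos[OF x] tangent that])
  then have "jac lam x v b = 0" if "b \<in> I" for b using that unfolding jac_def by simp
  then show False using neg I_nonempty by force
qed

text \<open>As the residual is nonnegative, the Newton equation bounds the positive part of \<open>jac lam x v\<close> by a
  multiple of \<open>\<bar>\<delta>\<bar>\<close>.  This estimate makes the second-order terms of the line search of order \<open>\<delta>\<^sup>2\<close>.\<close>

lemma newton_step_bound:
  assumes l: "0 < l"
  shows "\<exists>K\<ge>0. \<forall>x\<in>box l u. \<forall>lam\<le>lam0. (\<forall>b\<in>I. quot b x \<le> lam) \<longrightarrow>
    (\<forall>v \<delta>. newton x lam v \<delta> \<longrightarrow> nrm v \<le> K * \<bar>\<delta>\<bar>)"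
proof -
  obtain \<kappa> where \<kappa>: "0 < \<kappa>" "\<And>x lam y. x \<in> box l u \<Longrightarrow> lam \<le> lam0 \<Longrightarrow> \<forall>b\<in>I. quot b x \<le> lam \<Longrightarrow>
      \<kappa> * nrm y \<le> (\<Sum>b\<in>I. max 0 (jac lam x y b)) + \<bar>\<Sum>b\<in>I. c_grad x b * y b\<bar>"
    using jac_uniform_injective[OF l, of u lam0] by blast
  define K where "K = real (card I) * \<bar>u\<bar> / \<kappa>"
  have "nrm v \<le> K * \<bar>\<delta>\<bar>"
    if x: "x \<in> box l u" and lam: "lam \<le> lam0" "\<forall>b\<in>I. quot b x \<le> lam" and v: "newton x lam v \<delta>" for x lam v \<delta>
  proof -
    have xp: "positive x" by (rule box_pos[OF l x])
    have "max 0 (jac lam x v b) \<le> \<bar>u\<bar> * \<bar>\<delta>\<bar>" if b: "b \<in> I" for b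
    proof -
      have "0 \<le> lam * x b - quot b x * x b"
        using lam b positiveD[OF xp b] by (simp add: mult_right_mono)
      moreover have "jac lam x v b + x b * \<delta> + (lam * x b - quot b x * x b) = 0"
        using v b unfolding newton_def by blast
      moreover have "\<bar>x b * \<delta>\<bar> \<le> \<bar>u\<bar> * \<bar>\<delta>\<bar>"
        unfolding abs_mult using x b positiveD[OF xp b] by (intro mult_right_mono) (auto simp: box_def)
      moreover have "0 \<le> \<bar>u\<bar> * \<bar>\<delta>\<bar>" by simp
      ultimately show ?thesis by linarith
    qed
    then have "(\<Sum>b\<in>I. max 0 (jac lam x v b)) \<le> (\<Sum>b\<in>I. \<bar>u\<bar> * \<bar>\<delta>\<bar>)" by (rule sum_mono)
    moreover have "(\<Sum>b\<in>I. c_grad x b * v b) = 0" using v unfolding newton_def by blast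
    ultimately have "\<kappa> * nrm v \<le> real (card I) * (\<bar>u\<bar> * \<bar>\<delta>\<bar>)"
      using \<kappa>(2)[OF x lam, of v] by simp
    then show ?thesis unfolding K_def using \<kappa>(1) by (simp add: field_simps)
  qed
  moreover have "0 \<le> K" unfolding K_def using \<kappa> by simp
  ultimately show ?thesis by blast
qed

text \<open>By uniqueness of the normalized eigenvector the residual does not vanish on the compact set
  considered.\<close>

lemma residual_bounded_below:
  assumes l: "0 < l" and \<epsilon>: "0 < \<epsilon>"
  shows "\<exists>\<kappa>>0. \<forall>x\<in>box l u. \<forall>lam. 0 \<le> lam \<longrightarrow> lam \<le> lam0 \<longrightarrow> c x = 1 \<longrightarrow> \<epsilon> \<le> err x \<longrightarrow>
    \<kappa> \<le> nrm (\<lambda>b. lam * x b - quot b x * x b)"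
proof -
  define C where "C = ext_box l u \<times> {0..lam0}"
  have C: "compact C" unfolding C_def by (intro compact_Times ext_box_compact compact_Icc)
  define X where "X = (fst :: ('i \<Rightarrow> real) \<times> real \<Rightarrow> _)"
  define \<Lambda> where "\<Lambda> = (snd :: ('i \<Rightarrow> real) \<times> real \<Rightarrow> _)"
  have cX: "continuous_on C X" and cL: "continuous_on C \<Lambda>"
    unfolding X_def \<Lambda>_def by (intro continuous_intros)+
  have Xpos: "X ` C \<subseteq> Collect positive"
    using ext_box_subset[OF l] unfolding C_def X_def by auto
  have cq: "continuous_on C (\<lambda>z. quot b (X z))" if "b \<in> I" for b
    by (rule continuous_comp_pos[OF continuous_quot[OF that] cX Xpos])
  have cc: "continuous_on C (\<lambda>z. c (X z))"
    by (rule continuous_comp_pos[OF continuous_c cX Xpos])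
  have cXb: "continuous_on C (\<lambda>z. X z b)" for b by (rule continuous_coord_comp[OF cX])
  define h where "h = (\<lambda>z. \<bar>c (X z) - 1\<bar> + max 0 (\<epsilon> - err (X z)))"
  have "continuous_on C h"
    unfolding h_def nrm_def by (intro continuous_intros cc cXb)
  then have "closed (C \<inter> h -` {0})"
    by (rule continuous_closed_preimage) (use compact_imp_closed[OF C] in auto)
  then have K: "compact (C \<inter> (C \<inter> h -` {0}))"
    by (rule compact_Int_closed[OF C])
  define K where "K = C \<inter> (C \<inter> h -` {0})"
  define f where "f = (\<lambda>z. nrm (\<lambda>b. \<Lambda> z * X z b - quot b (X z) * X z b))"
  have cf: "continuous_on C f"
    unfolding f_def nrm_def by (intro continuous_intros cq cL cXb)
  have "\<exists>\<kappa>>0. \<forall>z\<in>K. \<kappa> \<le> f z"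
  proof (rule compact_positive_lower_bound)
    show "compact K" unfolding K_def by (rule K)
    show "continuous_on K f" using cf by (rule continuous_on_subset) (auto simp: K_def)
    fix z assume z: "z \<in> K"
    then have zC: "z \<in> C" and hz: "c (X z) = 1" "\<epsilon> \<le> err (X z)"
      unfolding K_def h_def by auto
    have Xz: "positive (X z)" using Xpos zC by blast
    show "0 < f z"
    proof (rule ccontr)
      assume "\<not> 0 < f z"
      then have "f z = 0" unfolding f_def using nrm_nonneg by (smt (verit))
      then have "\<Lambda> z * X z b - quot b (X z) * X z b = 0" if "b \<in> I" for b
        unfolding f_def using nrm_component[OF that, of "\<lambda>b. \<Lambda> z * X z b - quot b (X z) * X z b"] by simp
      then have "quot b (X z) = \<Lambda> z" if "b \<in> I" for b
        using positiveD[OF Xz that] that by force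
      then have "X z b = xbar b" if "b \<in> I" for b
        using normalized_eigenvector_unique(2)[OF Xz hz(1)] that by blast
      then have "err (X z) = 0" unfolding nrm_def by simp
      then show False using hz \<epsilon> by simp
    qed
  qed
  then obtain \<kappa> where \<kappa>: "0 < \<kappa>" "\<And>z. z \<in> K \<Longrightarrow> \<kappa> \<le> f z" by blast
  have "\<kappa> \<le> nrm (\<lambda>b. lam * x b - quot b x * x b)"
    if x: "x \<in> box l u" and lam: "0 \<le> lam" "lam \<le> lam0" and cx: "c x = 1" and far: "\<epsilon> \<le> err x" for x lam
  proof -
    have eq: "ext0 x b = x b" if "b \<in> I" for b using that by (simp add: ext0_def)
    define z where "z = (ext0 x, lam)"
    have z: "X z = ext0 x" "\<Lambda> z = lam" unfolding z_def X_def \<Lambda>_def by auto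
    have "c (ext0 x) = 1" using c_cong[OF eq] cx by simp
    moreover have "err (ext0 x) = err x" by (rule nrm_cong) (simp add: eq)
    ultimately have "h z = 0" unfolding h_def z using far by simp
    moreover have "z \<in> C" unfolding C_def z_def using ext0_in[OF x] lam by simp
    ultimately have "\<kappa> \<le> f z" by (intro \<kappa>) (simp add: K_def)
    also have "f z = nrm (\<lambda>b. lam * x b - quot b x * x b)"
      unfolding f_def z by (rule nrm_cong) (simp add: eq quot_cong[OF eq])
    finally show ?thesis .
  qed
  then show ?thesis using \<kappa>(1) by blast
qed

end

section \<open>Line search and quadratic error of a Newton step\<close>

lemma root_near_1:
  fixes t :: real
  assumes "0 < n" "0 \<le> t" shows "\<bar>root n t - 1\<bar> \<le> \<bar>t - 1\<bar>"
proof -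
  define r where "r = root n t"
  have r: "0 \<le> r" "r ^ n = t" unfolding r_def using assms by auto
  show ?thesis
  proof (cases "1 \<le> r")
    case True
    then have "r ^ 1 \<le> r ^ n" using assms by (intro power_increasing) auto
    then show ?thesis using True r unfolding r_def[symmetric] by simp
  next
    case False
    then have "r ^ n \<le> r ^ 1" using assms r by (intro power_decreasing) auto
    then show ?thesis using False r unfolding r_def[symmetric] by simp
  qed
qed

lemma mult_le_of_le_divide_Suc:
  fixes q r v :: real
  assumes "0 \<le> q" "0 \<le> v" "v \<le> r / (q + 1)" shows "q * v \<le> r"
proof -
  have "(q + 1) * v \<le> r" using assms by (simp add: field_simps)
  then show ?thesis using assms by (simp add: algebra_simps)
qed

context normalized_system
begin

lemma uniform_constant:
  assumes "\<And>b. b \<in> I \<Longrightarrow> \<exists>K\<ge>(0::real). Q b K" and "\<And>b K K'. Q b K \<Longrightarrow> K \<le> K' \<Longrightarrow> Q b K'"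
  shows "\<exists>K\<ge>0. \<forall>b\<in>I. Q b K"
proof -
  obtain k where k: "\<And>b. b \<in> I \<Longrightarrow> 0 \<le> k b" "\<And>b. b \<in> I \<Longrightarrow> Q b (k b)"
    using assms(1) by metis
  show ?thesis
    using k finite_I assms(2)
    by (intro exI[of _ "sum k I"]) (auto simp: sum_nonneg intro!: assms(2)[OF k(2)] member_le_sum)
qed

lemma scaled_quot_remainder:
  assumes l: "0 < l"
  shows "\<exists>K\<ge>0. \<forall>b\<in>I. \<forall>x\<in>box l u. \<forall>y\<in>box l u.
    \<bar>quot b y * y b - quot b x * x b - (\<Sum>b'\<in>I. scaled_grad b x b' * (y b' - x b'))\<bar>
      \<le> K * (nrm (\<lambda>b. y b - x b))\<^sup>2"
proof (rule uniform_constant)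
  fix b assume "b \<in> I"
  show "\<exists>K\<ge>0. \<forall>x\<in>box l u. \<forall>y\<in>box l u.
    \<bar>quot b y * y b - quot b x * x b - (\<Sum>b'\<in>I. scaled_grad b x b' * (y b' - x b'))\<bar>
      \<le> K * (nrm (\<lambda>b. y b - x b))\<^sup>2"
    unfolding nrm_def
    by (rule quad_approx_on_remainderE[OF scaled_quad[OF l \<open>b \<in> I\<close>, of u]]) blast
qed (meson mult_right_mono order_trans zero_le_power2)

lemma quot_lipschitz:
  assumes l: "0 < l"
  shows "\<exists>K\<ge>0. \<forall>b\<in>I. \<forall>x\<in>box l u. \<forall>y\<in>box l u.
    \<bar>quot b y - quot b x\<bar> \<le> K * nrm (\<lambda>b. y b - x b)"
proof (rule uniform_constant)
  fix b assume "b \<in> I"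
  show "\<exists>K\<ge>0. \<forall>x\<in>box l u. \<forall>y\<in>box l u. \<bar>quot b y - quot b x\<bar> \<le> K * nrm (\<lambda>b. y b - x b)"
    unfolding nrm_def
    by (rule quad_approx_on_lipschitzE[OF quot_quad[OF l \<open>b \<in> I\<close>, of u]]) blast
qed (meson mult_right_mono order_trans nrm_nonneg)

lemma c_remainder:
  assumes l: "0 < l"
  obtains K where "0 \<le> K" "\<And>x y. x \<in> box l u \<Longrightarrow> y \<in> box l u \<Longrightarrow>
    \<bar>c y - c x - (\<Sum>b\<in>I. c_grad x b * (y b - x b))\<bar> \<le> K * (nrm (\<lambda>b. y b - x b))\<^sup>2"
  unfolding nrm_def by (rule quad_approx_on_remainderE[OF c_quad[OF l, of u]]) blast

lemma c_lipschitz: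
  assumes l: "0 < l"
  obtains K where "0 \<le> K" "\<And>x y. x \<in> box l u \<Longrightarrow> y \<in> box l u \<Longrightarrow>
    \<bar>c y - c x\<bar> \<le> K * nrm (\<lambda>b. y b - x b)"
  unfolding nrm_def by (rule quad_approx_on_lipschitzE[OF c_quad[OF l, of u]]) blast

lemma retract_normalized:
  assumes z: "positive z" shows "positive (retract z)" "c (retract z) = 1"
proof -
  define r where "r = root n (c z)"
  have r: "0 < r" "r ^ n = c z" unfolding r_def using c_pos[OF z] n_pos by auto
  show "positive (retract z)"
    using z r(1) unfolding positive_def retract_def r_def[symmetric] by simp
  have "c (retract z) = c (\<lambda>b. 1 / r * z b)" unfolding retract_def r_def by (rule c_cong) simp
  also have "\<dots> = (1 / r) ^ n * c z" by (rule c_scale) (use r in simp)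
  also have "\<dots> = 1" using r c_pos[OF z] by (simp add: power_one_over)
  finally show "c (retract z) = 1" .
qed

lemma retract_eq_self: "c x = 1 \<Longrightarrow> retract x b = x b"
  unfolding retract_def using n_pos by simp

text \<open>The retraction moves a point by at most a multiple of its defect \<open>c z - 1\<close>, because \<open>root_near_1\<close> bounds the
  scaling factor; at normalized points the defect is of second order along
  tangential directions.\<close>

lemma retract_near:
  assumes l: "0 < l" and z: "z \<in> box l u" and cz: "\<bar>c z - 1\<bar> \<le> 1 / 2"
  shows "nrm (\<lambda>b. retract z b - z b) \<le> 2 * real (card I) * \<bar>u\<bar> * \<bar>c z - 1\<bar>"
proof -
  define r where "r = root n (c z)"
  have r: "\<bar>r - 1\<bar> \<le> \<bar>c z - 1\<bar>"
    unfolding r_def using root_near_1[OF n_pos] c_pos[OF box_pos[OF l z]] by simp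
  then have r2: "1 / 2 \<le> r" using cz by linarith
  have "\<bar>retract z b - z b\<bar> \<le> \<bar>u\<bar> * (2 * \<bar>c z - 1\<bar>)" if b: "b \<in> I" for b
  proof -
    have zb: "\<bar>z b\<bar> \<le> \<bar>u\<bar>" using z b l by (force simp: box_def)
    have "retract z b - z b = z b * ((1 - r) / r)"
      unfolding retract_def r_def[symmetric] using r2 by (simp add: field_simps)
    moreover have "\<bar>(1 - r) / r\<bar> \<le> 2 * \<bar>c z - 1\<bar>"
    proof -
      have "\<bar>1 - r\<bar> * 1 \<le> \<bar>c z - 1\<bar> * (2 * r)" using r r2 by (intro mult_mono) auto
      then show ?thesis using r2 by (simp add: abs_divide divide_le_eq mult_ac)
    qed
    ultimately show ?thesis using zb by (simp only: abs_mult[of "z b"]) (intro mult_mono, auto)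
  qed
  then have "nrm (\<lambda>b. retract z b - z b) \<le> (\<Sum>b\<in>I. \<bar>u\<bar> * (2 * \<bar>c z - 1\<bar>))"
    unfolding nrm_def by (rule sum_mono)
  then show ?thesis by (simp add: mult_ac)
qed

lemma box_near:
  assumes "x \<in> box l u" "nrm (\<lambda>b. y b - x b) \<le> r" shows "y \<in> box (l - r) (u + r)"
proof -
  have "\<bar>y b - x b\<bar> \<le> r" if "b \<in> I" for b
    using nrm_component[OF that, of "\<lambda>b. y b - x b"] assms(2) by linarith
  then show ?thesis using assms(1) unfolding box_def mem_Collect_eq by (smt (verit))
qed

lemma box_mono: "x \<in> box l u \<Longrightarrow> l' \<le> l \<Longrightarrow> u \<le> u' \<Longrightarrow> x \<in> box l' u'"
  unfolding box_def mem_Collect_eq by (meson order_trans)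

lemma newton_directional:
  assumes "newton x lam v \<delta>" "b \<in> I"
  shows "(\<Sum>b'\<in>I. scaled_grad b x b' * v b') = lam * v b + x b * \<delta> + (lam * x b - quot b x * x b)"
proof -
  have "jac lam x v b + x b * \<delta> + (lam * x b - quot b x * x b) = 0"
    using assms unfolding newton_def by blast
  then show ?thesis unfolding jac_def by linarith
qed

text \<open>With \<open>z = x + \<alpha> v\<close>, the Newton equation and the Taylor estimate for \<open>quot b x * x b\<close> give
  \<open>quot b z * z b \<le> lam * z b + \<alpha> * \<delta> * x b + O((\<alpha> * nrm v)\<^sup>2)\<close>; the term with the residual has the right sign since
  \<open>\<alpha> \<le> 1\<close>.  Replacing \<open>x b\<close> by \<open>z b\<close> and retracting cost terms of second order, and \<open>nrm v\<close> is bounded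
  by a multiple of \<open>\<bar>\<delta>\<bar>\<close>, so in terms of \<open>w = \<alpha> * \<bar>\<delta>\<bar>\<close> the condition to be met is \<open>q3 * w\<^sup>2 \<le> (1 - \<eta>) * w\<close>.\<close>

lemma line_search_accepts:
  assumes l: "0 < l" and \<eta>: "\<eta> < 1"
  shows "\<exists>\<epsilon>>0. \<forall>x\<in>box l u. c x = 1 \<longrightarrow> (\<forall>lam\<le>lam0. (\<forall>b\<in>I. quot b x \<le> lam) \<longrightarrow>
    (\<forall>v \<delta> \<alpha>. newton x lam v \<delta> \<longrightarrow> 0 < \<alpha> \<longrightarrow> \<alpha> \<le> 1 \<longrightarrow> \<alpha> * \<bar>\<delta>\<bar> \<le> \<epsilon> \<longrightarrow>
      positive (\<lambda>b. x b + \<alpha> * v b) \<and>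
      (\<forall>b\<in>I. quot b (retract (\<lambda>b. x b + \<alpha> * v b)) \<le> lam + \<eta> * \<alpha> * \<delta>)))"
proof -
  \<comment> \<open>A larger box, with room for \<open>x + \<alpha> v\<close> and its retraction.\<close>
  define B where "B = box (l / 4) (u + l)"
  have l4: "0 < l / 4" using l by simp
  obtain K1 where K1: "0 \<le> K1" "\<And>x lam v \<delta>. x \<in> box l u \<Longrightarrow> lam \<le> lam0 \<Longrightarrow> \<forall>b\<in>I. quot b x \<le> lam \<Longrightarrow>
      newton x lam v \<delta> \<Longrightarrow> nrm v \<le> K1 * \<bar>\<delta>\<bar>"
    using newton_step_bound[OF l, of u lam0] by blast
  obtain Kg where Kg: "0 \<le> Kg" "\<And>b x y. b \<in> I \<Longrightarrow> x \<in> B \<Longrightarrow> y \<in> B \<Longrightarrow>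
    \<bar>quot b y * y b - quot b x * x b - (\<Sum>b'\<in>I. scaled_grad b x b' * (y b' - x b'))\<bar>
      \<le> Kg * (nrm (\<lambda>b. y b - x b))\<^sup>2"
    unfolding B_def using scaled_quot_remainder[OF l4, of "u + l"] by blast
  obtain Kf where Kf: "0 \<le> Kf" "\<And>b x y. b \<in> I \<Longrightarrow> x \<in> B \<Longrightarrow> y \<in> B \<Longrightarrow>
    \<bar>quot b y - quot b x\<bar> \<le> Kf * nrm (\<lambda>b. y b - x b)"
    unfolding B_def using quot_lipschitz[OF l4, of "u + l"] by blast
  obtain Kc where Kc: "0 \<le> Kc" "\<And>x y. x \<in> B \<Longrightarrow> y \<in> B \<Longrightarrow>
    \<bar>c y - c x - (\<Sum>b\<in>I. c_grad x b * (y b - x b))\<bar> \<le> Kc * (nrm (\<lambda>b. y b - x b))\<^sup>2"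
    unfolding B_def using c_remainder[OF l4] by blast
  define Kr where "Kr = 2 * real (card I) * \<bar>u + l\<bar>"
  have Kr: "0 \<le> Kr" unfolding Kr_def by simp
  define q1 where "q1 = Kc * K1\<^sup>2"
  define q2 where "q2 = Kr * q1"
  define q3 where "q3 = (K1 + Kg * K1\<^sup>2) * (2 / l) + Kf * q2"
  have q: "0 \<le> q1" "0 \<le> q2" "0 \<le> q3"
    unfolding q1_def q2_def q3_def using Kc K1 Kg Kf Kr l by auto
  \<comment> \<open>The entries ensure in turn: \<open>w\<^sup>2 \<le> w\<close>; the trial point stays near the box; \<open>c\<close> stays near \<open>1\<close>, as
    \<open>retract_near\<close> demands; the retracted point stays in \<open>B\<close>; sufficient decrease.\<close>
  define \<epsilon> where "\<epsilon> = Min {1, (l / 2) / (K1 + 1), (1 / 2) / (q1 + 1), (l / 4) / (q2 + 1), (1 - \<eta>) / (q3 + 1)}"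
  have \<epsilon>: "0 < \<epsilon>" unfolding \<epsilon>_def using l q K1 \<eta> by (simp add: divide_simps)
  have "positive (\<lambda>b. x b + \<alpha> * v b) \<and>
      (\<forall>b\<in>I. quot b (retract (\<lambda>b. x b + \<alpha> * v b)) \<le> lam + \<eta> * \<alpha> * \<delta>)"
    if x: "x \<in> box l u" and cx: "c x = 1" and lam: "lam \<le> lam0" "\<forall>b\<in>I. quot b x \<le> lam"
      and nw: "newton x lam v \<delta>" and \<alpha>: "0 < \<alpha>" "\<alpha> \<le> 1" "\<alpha> * \<bar>\<delta>\<bar> \<le> \<epsilon>" for x lam v \<delta> \<alpha>
  proof -
    define w where "w = \<alpha> * \<bar>\<delta>\<bar>"
    have w: "0 \<le> w" unfolding w_def using \<alpha> by simp
    have \<delta>: "\<delta> \<le> 0" using newton_increment_nonpos[OF box_pos[OF l x] _ nw] lam by blast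
    have w_\<delta>: "\<alpha> * \<delta> = - w" unfolding w_def using \<delta> by simp
    have wle: "w \<le> 1" "w \<le> (l / 2) / (K1 + 1)" "w \<le> (1 / 2) / (q1 + 1)" "w \<le> (l / 4) / (q2 + 1)" "w \<le> (1 - \<eta>) / (q3 + 1)"
      using \<alpha>(3) unfolding w_def[symmetric] \<epsilon>_def by auto
    have w2: "w\<^sup>2 \<le> w" using w wle(1) by (simp add: power2_eq_square mult_left_le_one_le)
    have small: "K1 * w \<le> l / 2" "q1 * w \<le> 1 / 2" "q2 * w \<le> l / 4" "q3 * w \<le> 1 - \<eta>"
      using mult_le_of_le_divide_Suc w wle q K1(1) by blast+
    define z where "z = (\<lambda>b. x b + \<alpha> * v b)"
    have zx: "z b - x b = \<alpha> * v b" for b unfolding z_def by simp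
    define m where "m = nrm (\<lambda>b. z b - x b)"
    have m: "0 \<le> m" "m \<le> K1 * w"
    proof -
      show "0 \<le> m" unfolding m_def by (rule nrm_nonneg)
      have "m = \<alpha> * nrm v" unfolding m_def zx nrm_scale using \<alpha> by simp
      also have "\<dots> \<le> \<alpha> * (K1 * \<bar>\<delta>\<bar>)" using K1(2)[OF x lam nw] \<alpha> by (intro mult_left_mono) auto
      finally show "m \<le> K1 * w" unfolding w_def by (simp add: mult_ac)
    qed
    have m2: "m\<^sup>2 \<le> K1\<^sup>2 * w\<^sup>2" using m by (metis power_mono power_mult_distrib)
    have zbox: "z \<in> box (l / 2) (u + l / 2)"
      using box_near[OF x, of z "l / 2"] m small(1) unfolding m_def by simp
    have zb: "l / 2 \<le> z b" if "b \<in> I" for b using zbox that by (simp add: box_def)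
    have xB: "x \<in> B" unfolding B_def by (rule box_mono[OF x]) (use l in auto)
    have zB: "z \<in> B" unfolding B_def by (rule box_mono[OF zbox]) (use l in auto)
    have zpos: "positive z" by (rule box_pos[OF _ zbox]) (use l in simp)
    have "(\<Sum>b\<in>I. c_grad x b * (z b - x b)) = \<alpha> * (\<Sum>b\<in>I. c_grad x b * v b)"
      unfolding zx by (simp add: sum_distrib_left mult_ac)
    also have "\<dots> = 0" using nw unfolding newton_def by simp
    finally have "\<bar>c z - 1\<bar> \<le> Kc * m\<^sup>2" using Kc(2)[OF xB zB] cx unfolding m_def by simp
    also have "\<dots> \<le> q1 * w\<^sup>2" unfolding q1_def using m2 Kc(1) by (simp add: mult.assoc mult_left_mono)
    finally have cz: "\<bar>c z - 1\<bar> \<le> q1 * w\<^sup>2" .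
    moreover have "q1 * w\<^sup>2 \<le> q1 * w" using w2 q by (intro mult_left_mono) auto
    ultimately have cz2: "\<bar>c z - 1\<bar> \<le> 1 / 2" using small by linarith
    have "nrm (\<lambda>b. retract z b - z b) \<le> Kr * \<bar>c z - 1\<bar>"
      unfolding Kr_def using retract_near[OF l4 zB[unfolded B_def] cz2] by simp
    also have "\<dots> \<le> q2 * w\<^sup>2" unfolding q2_def using cz Kr by (simp add: mult.assoc mult_left_mono)
    finally have rz: "nrm (\<lambda>b. retract z b - z b) \<le> q2 * w\<^sup>2" .
    moreover have "q2 * w\<^sup>2 \<le> q2 * w" using w2 q by (intro mult_left_mono) auto
    ultimately have "nrm (\<lambda>b. retract z b - z b) \<le> l / 4" using small by linarith
    then have "retract z \<in> box (l / 2 - l / 4) (u + l / 2 + l / 4)" by (rule box_near[OF zbox])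
    then have rB: "retract z \<in> B" unfolding B_def by (rule box_mono) (use l in auto)
    have "quot b (retract z) \<le> lam + \<eta> * \<alpha> * \<delta>" if b: "b \<in> I" for b
    proof -
      have xb: "0 < x b" and zb0: "0 < z b" using positiveD[OF box_pos[OF l x] b] positiveD[OF zpos b] .
      have "(\<Sum>b'\<in>I. scaled_grad b x b' * (z b' - x b')) = \<alpha> * (\<Sum>b'\<in>I. scaled_grad b x b' * v b')"
        unfolding zx by (simp add: sum_distrib_left mult_ac)
      also have "\<dots> = \<alpha> * (lam * v b + x b * \<delta> + (lam * x b - quot b x * x b))"
        unfolding newton_directional[OF nw b] ..
      finally have "quot b z * z b \<le> quot b x * x b
          + \<alpha> * (lam * v b + x b * \<delta> + (lam * x b - quot b x * x b)) + Kg * m\<^sup>2"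
        using Kg(2)[OF b xB zB] unfolding m_def by linarith
      also have "\<dots> = lam * z b - (1 - \<alpha>) * (lam * x b - quot b x * x b) + (\<alpha> * \<delta>) * x b + Kg * m\<^sup>2"
        unfolding z_def by (simp add: algebra_simps)
      also have "(1 - \<alpha>) * (lam * x b - quot b x * x b) \<ge> 0"
        using \<alpha> lam b xb by (intro mult_nonneg_nonneg) (auto simp: mult_right_mono)
      then have "lam * z b - (1 - \<alpha>) * (lam * x b - quot b x * x b) + (\<alpha> * \<delta>) * x b + Kg * m\<^sup>2
          \<le> lam * z b + (\<alpha> * \<delta>) * z b + w * (z b - x b) + Kg * m\<^sup>2"
        unfolding w_\<delta> by (simp add: algebra_simps)
      also have "w * (z b - x b) \<le> w * m"
        using nrm_component[OF b, of "\<lambda>b. z b - x b"] w unfolding m_def by (intro mult_left_mono) auto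
      also have "w * m \<le> w * (K1 * w)" using m w by (intro mult_left_mono)
      also have "Kg * m\<^sup>2 \<le> Kg * (K1\<^sup>2 * w\<^sup>2)" using m2 Kg(1) by (intro mult_left_mono)
      finally have "quot b z * z b \<le> (lam + \<alpha> * \<delta>) * z b + (K1 + Kg * K1\<^sup>2) * w\<^sup>2"
        by (simp add: algebra_simps power2_eq_square)
      also have "\<dots> \<le> (lam + \<alpha> * \<delta>) * z b + (K1 + Kg * K1\<^sup>2) * w\<^sup>2 * (2 / l * z b)"
      proof -
        have "1 \<le> 2 / l * z b" using zb[OF b] l by (simp add: field_simps)
        then show ?thesis
          using K1(1) Kg(1) mult_left_mono[of 1 "2 / l * z b" "(K1 + Kg * K1\<^sup>2) * w\<^sup>2"] by simp
      qed
      also have "\<dots> = (lam + \<alpha> * \<delta> + (K1 + Kg * K1\<^sup>2) * (2 / l) * w\<^sup>2) * z b"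
        by (simp add: algebra_simps)
      finally have 1: "quot b z \<le> lam + \<alpha> * \<delta> + (K1 + Kg * K1\<^sup>2) * (2 / l) * w\<^sup>2"
        using zb0 by simp
      have "\<bar>quot b (retract z) - quot b z\<bar> \<le> Kf * nrm (\<lambda>b. retract z b - z b)"
        by (rule Kf(2)[OF b zB rB])
      also have "\<dots> \<le> Kf * (q2 * w\<^sup>2)" using rz Kf(1) by (intro mult_left_mono)
      finally have "quot b (retract z) \<le> lam + \<alpha> * \<delta> + q3 * w\<^sup>2"
        using 1 unfolding q3_def by (simp add: algebra_simps)
      also have "q3 * w\<^sup>2 = (q3 * w) * w" by (simp add: power2_eq_square)
      also have "(q3 * w) * w \<le> (1 - \<eta>) * w" using small w by (intro mult_right_mono)
      also have "lam + \<alpha> * \<delta> + (1 - \<eta>) * w = lam + \<eta> * \<alpha> * \<delta>"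
        unfolding mult.assoc[of \<eta>] w_\<delta> by (simp add: algebra_simps)
      finally show ?thesis by simp
    qed
    then show ?thesis using zpos unfolding z_def by blast
  qed
  then show ?thesis using \<epsilon> by blast
qed

text \<open>The errors \<open>y = x + v - xbar\<close> and \<open>lam + \<delta> - \<mu>\<close> solve the bordered system up to the Taylor
  remainders at \<open>xbar\<close> and the product \<open>(lam - \<mu>) * (x - xbar)\<close>, all of second order.  That \<open>lam\<close> is attained by a
  quotient makes \<open>lam - \<mu>\<close> a first-order term.\<close>

lemma newton_quadratic_error:
  assumes l: "0 < l" and xbar: "xbar \<in> box l u"
  shows "\<exists>K\<ge>0. \<forall>x\<in>box l u. c x = 1 \<longrightarrow> (\<forall>lam\<le>lam0. (\<forall>b\<in>I. quot b x \<le> lam) \<longrightarrow> (\<exists>b\<in>I. quot b x = lam) \<longrightarrow>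
    (\<forall>v \<delta>. newton x lam v \<delta> \<longrightarrow>
      nrm (\<lambda>b. x b + v b - xbar b) \<le> K * (err x)\<^sup>2 \<and>
      \<bar>lam + \<delta> - \<mu>\<bar> \<le> K * (err x)\<^sup>2))"
proof -
  obtain K0 where K0: "0 \<le> K0" "\<And>x lam y \<epsilon> e. x \<in> box l u \<Longrightarrow> lam \<le> lam0 \<Longrightarrow> \<forall>b\<in>I. quot b x \<le> lam \<Longrightarrow>
    \<forall>b\<in>I. \<bar>jac lam x y b + \<epsilon> * x b\<bar> \<le> e \<Longrightarrow> \<bar>\<Sum>b\<in>I. c_grad x b * y b\<bar> \<le> e \<Longrightarrow>
      nrm y \<le> K0 * e \<and> \<bar>\<epsilon>\<bar> \<le> K0 * e"
    using bordered_inverse_bound[OF l, of u lam0] by blast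
  obtain Kg where Kg: "0 \<le> Kg" "\<And>b x y. b \<in> I \<Longrightarrow> x \<in> box l u \<Longrightarrow> y \<in> box l u \<Longrightarrow>
    \<bar>quot b y * y b - quot b x * x b - (\<Sum>b'\<in>I. scaled_grad b x b' * (y b' - x b'))\<bar>
      \<le> Kg * (nrm (\<lambda>b. y b - x b))\<^sup>2"
    using scaled_quot_remainder[OF l, of u] by blast
  obtain Kf where Kf: "0 \<le> Kf" "\<And>b x y. b \<in> I \<Longrightarrow> x \<in> box l u \<Longrightarrow> y \<in> box l u \<Longrightarrow>
    \<bar>quot b y - quot b x\<bar> \<le> Kf * nrm (\<lambda>b. y b - x b)"
    using quot_lipschitz[OF l, of u] by blast
  obtain Kc where Kc: "0 \<le> Kc" "\<And>x y. x \<in> box l u \<Longrightarrow> y \<in> box l u \<Longrightarrow>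
    \<bar>c y - c x - (\<Sum>b\<in>I. c_grad x b * (y b - x b))\<bar> \<le> Kc * (nrm (\<lambda>b. y b - x b))\<^sup>2"
    using c_remainder[OF l] by blast
  define K where "K = K0 * (Kg + Kf + Kc)"
  have "nrm (\<lambda>b. x b + v b - xbar b) \<le> K * (err x)\<^sup>2 \<and>
      \<bar>lam + \<delta> - \<mu>\<bar> \<le> K * (err x)\<^sup>2"
    if x: "x \<in> box l u" and cx: "c x = 1" and lam: "lam \<le> lam0" "\<forall>b\<in>I. quot b x \<le> lam"
      and att: "\<exists>b\<in>I. quot b x = lam" and nw: "newton x lam v \<delta>" for x lam v \<delta>
  proof -
    define e where "e = err x"
    have e: "0 \<le> e" unfolding e_def by (rule nrm_nonneg)
    have e': "nrm (\<lambda>b. xbar b - x b) = e" unfolding e_def nrm_def by (simp add: abs_minus_commute)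
    have lam_err: "\<bar>lam - \<mu>\<bar> \<le> Kf * e"
    proof -
      obtain b where b: "b \<in> I" "quot b x = lam" using att by blast
      then show ?thesis using Kf(2)[OF b(1) xbar x] quot_xbar[OF b(1)] unfolding e_def by simp
    qed
    define y where "y = (\<lambda>b. x b + v b - xbar b)"
    have "\<bar>jac lam x y b + (lam + \<delta> - \<mu>) * x b\<bar> \<le> (Kg + Kf + Kc) * e\<^sup>2" if b: "b \<in> I" for b
    proof -
      have "(\<Sum>b'\<in>I. scaled_grad b x b' * y b') = (\<Sum>b'\<in>I. scaled_grad b x b' * v b')
          - (\<Sum>b'\<in>I. scaled_grad b x b' * (xbar b' - x b'))"
        unfolding y_def by (simp add: sum_subtractf[symmetric] algebra_simps)
      then have "jac lam x y b + (lam + \<delta> - \<mu>) * x b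
        = - (quot b xbar * xbar b - quot b x * x b - (\<Sum>b'\<in>I. scaled_grad b x b' * (xbar b' - x b')))
          + (lam - \<mu>) * (x b - xbar b)"
        unfolding jac_def newton_directional[OF nw b] quot_xbar[OF b] y_def by (simp add: algebra_simps)
      moreover have "\<bar>quot b xbar * xbar b - quot b x * x b - (\<Sum>b'\<in>I. scaled_grad b x b' * (xbar b' - x b'))\<bar> \<le> Kg * e\<^sup>2"
        using Kg(2)[OF b x xbar] unfolding e' .
      moreover have "\<bar>(lam - \<mu>) * (x b - xbar b)\<bar> \<le> (Kf * e) * e"
        unfolding abs_mult using lam_err nrm_component[OF b, of "\<lambda>b. x b - xbar b"] Kf(1) e
        unfolding e_def[symmetric] by (intro mult_mono) auto
      moreover have "0 \<le> Kc * e\<^sup>2" using Kc(1) by simp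
      ultimately show ?thesis by (simp add: algebra_simps power2_eq_square)
    qed
    moreover have "\<bar>\<Sum>b\<in>I. c_grad x b * y b\<bar> \<le> (Kg + Kf + Kc) * e\<^sup>2"
    proof -
      have "(\<Sum>b\<in>I. c_grad x b * y b) = (\<Sum>b\<in>I. c_grad x b * v b) - (\<Sum>b\<in>I. c_grad x b * (xbar b - x b))"
        unfolding y_def by (simp add: sum_subtractf[symmetric] algebra_simps)
      moreover have "(\<Sum>b\<in>I. c_grad x b * v b) = 0" using nw unfolding newton_def by blast
      ultimately have "\<bar>\<Sum>b\<in>I. c_grad x b * y b\<bar> \<le> Kc * e\<^sup>2"
        using Kc(2)[OF x xbar] cx c_xbar unfolding e' by simp
      moreover have "0 \<le> Kg * e\<^sup>2" "0 \<le> Kf * e\<^sup>2" using Kg(1) Kf(1) by auto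
      ultimately show ?thesis by (simp add: distrib_right)
    qed
    ultimately have "nrm y \<le> K0 * ((Kg + Kf + Kc) * e\<^sup>2) \<and> \<bar>lam + \<delta> - \<mu>\<bar> \<le> K0 * ((Kg + Kf + Kc) * e\<^sup>2)"
      by (intro K0(2)[OF x lam]) auto
    then show ?thesis unfolding y_def K_def e_def by (simp add: mult.assoc)
  qed
  moreover have "0 \<le> K" unfolding K_def using K0 Kg Kf Kc by simp
  ultimately show ?thesis by blast
qed

end

section \<open>Convergence of the damped Newton iteration\<close>

context normalized_system
begin

text \<open>The relations satisfied by the iterates of the damped Newton method: \<open>largest\<close> says that the step length
  is the largest admissible power of \<open>\<rho>\<close>, and \<open>dec\<close> is the sufficient decrease it was accepted for.\<close>

theorem line_search_newton_converges:
  fixes xs ds :: "nat \<Rightarrow> 'i \<Rightarrow> real" and ls \<delta>s \<alpha>s :: "nat \<Rightarrow> real" and \<eta> \<rho> :: real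
  assumes \<eta>: "0 < \<eta>" "\<eta> < 1" and \<rho>: "0 < \<rho>" "\<rho> < 1"
    and pos: "\<And>k. positive (xs k)" and c1: "\<And>k. c (xs k) = 1"
    and le: "\<And>k b. b \<in> I \<Longrightarrow> quot b (xs k) \<le> ls k"
    and att: "\<And>k. \<exists>b\<in>I. quot b (xs k) = ls k"
    and nw: "\<And>k. newton (xs k) (ls k) (ds k) (\<delta>s k)"
    and pow: "\<And>k. \<exists>i. \<alpha>s k = \<rho> ^ i"
    and dec: "\<And>k. ls (Suc k) \<le> ls k + \<eta> * \<alpha>s k * \<delta>s k"
    and largest: "\<And>k i. positive (\<lambda>b. xs k b + \<rho> ^ i * ds k b) \<Longrightarrow>
      (\<forall>b\<in>I. quot b (retract (\<lambda>b. xs k b + \<rho> ^ i * ds k b)) \<le> ls k + \<eta> * \<rho> ^ i * \<delta>s k) \<Longrightarrow>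
      \<rho> ^ i \<le> \<alpha>s k"
    and step: "\<And>k b. b \<in> I \<Longrightarrow> xs (Suc k) b = retract (\<lambda>b. xs k b + \<alpha>s k * ds k b) b"
  shows "(\<lambda>k. err (xs k)) \<longlonglongrightarrow> 0"
    and "\<exists>K. \<forall>\<^sub>F k in sequentially. err (xs (Suc k)) \<le> K * (err (xs k))\<^sup>2"
    and "(\<lambda>k. \<bar>ls k - \<mu>\<bar>) \<longlonglongrightarrow> 0"
    and "\<exists>K. \<forall>\<^sub>F k in sequentially. \<bar>ls (Suc k) - \<mu>\<bar> \<le> K * \<bar>ls k - \<mu>\<bar>\<^sup>2"
    and "\<forall>\<^sub>F k in sequentially. \<alpha>s k = 1"
proof -
  have \<delta>: "\<delta>s k \<le> 0" for k by (rule newton_increment_nonpos[OF pos le nw])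
  have \<alpha>_pos: "0 < \<alpha>s k" for k using pow[of k] \<rho> by auto
  have drop: "\<eta> * (\<alpha>s k * \<bar>\<delta>s k\<bar>) \<le> ls k - ls (Suc k)" for k
    using dec[of k] \<delta>[of k] by (simp add: mult.assoc)
  have drop0: "0 \<le> \<alpha>s k * \<bar>\<delta>s k\<bar>" for k using \<alpha>_pos[of k] by simp
  have "ls (Suc k) \<le> ls k" for k
  proof -
    have "0 \<le> \<eta> * (\<alpha>s k * \<bar>\<delta>s k\<bar>)" using drop0[of k] \<eta> by simp
    then show ?thesis using drop[of k] by linarith
  qed
  then have decls: "decseq ls" by (simp add: decseq_Suc_iff)
  have ls_nonneg: "0 \<le> ls k" for k
    using att[of k] quot_nonneg[OF pos[of k]] by force
  obtain lim where lim: "ls \<longlonglongrightarrow> lim"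
    using decseq_convergent[OF decls, of 0] ls_nonneg by blast

  define lam0 where "lam0 = max (ls 0) \<mu>"
  obtain l u where l: "0 < l" and lu: "\<And>x. positive x \<Longrightarrow> c x = 1 \<Longrightarrow> (\<And>b. b \<in> I \<Longrightarrow> quot b x \<le> lam0) \<Longrightarrow> x \<in> box l u"
    using sublevel_in_box[of lam0] by blast
  have ls_le: "ls k \<le> lam0" for k
    using decseqD[OF decls, of 0 k] unfolding lam0_def by simp
  have quot_le: "\<forall>b\<in>I. quot b (xs k) \<le> ls k" for k using le by blast
  have xk: "xs k \<in> box l u" for k
    using le ls_le[of k] by (intro lu pos c1) (meson order_trans)
  have xb: "xbar \<in> box l u"
    by (intro lu xbar_pos c_xbar) (simp add: quot_xbar lam0_def)

  \<comment> \<open>A rejected longer step forces the decrease of the eigenvalue estimate to exceed a fixed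
    constant, which can happen only finitely often.\<close>
  obtain \<epsilon> where \<epsilon>: "0 < \<epsilon>" "\<And>x lam v \<delta> \<alpha>. x \<in> box l u \<Longrightarrow> c x = 1 \<Longrightarrow> lam \<le> lam0 \<Longrightarrow>
      \<forall>b\<in>I. quot b x \<le> lam \<Longrightarrow> newton x lam v \<delta> \<Longrightarrow> 0 < \<alpha> \<Longrightarrow> \<alpha> \<le> 1 \<Longrightarrow> \<alpha> * \<bar>\<delta>\<bar> \<le> \<epsilon> \<Longrightarrow>
      positive (\<lambda>b. x b + \<alpha> * v b) \<and>
      (\<forall>b\<in>I. quot b (retract (\<lambda>b. x b + \<alpha> * v b)) \<le> lam + \<eta> * \<alpha> * \<delta>)"
    using line_search_accepts[OF l \<eta>(2), of u lam0] by blast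
  have \<alpha>_cases: "\<alpha>s k = 1 \<or> \<rho> * \<epsilon> < \<alpha>s k * \<bar>\<delta>s k\<bar>" for k
  proof -
    obtain i where i: "\<alpha>s k = \<rho> ^ i" using pow by blast
    show ?thesis
    proof (cases i)
      case 0
      then show ?thesis using i by simp
    next
      case (Suc i')
      have "\<rho> ^ i < \<rho> ^ i'" using \<rho> Suc by simp
      then have "\<not> \<rho> ^ i' \<le> \<alpha>s k" using i by simp
      then have "\<not> \<rho> ^ i' * \<bar>\<delta>s k\<bar> \<le> \<epsilon>"
        using \<epsilon>(2)[OF xk c1 ls_le quot_le nw, of "\<rho> ^ i'" k] largest[of k i'] \<rho> by (auto simp: power_le_one)
      then have "\<rho> * \<epsilon> < \<rho> * (\<rho> ^ i' * \<bar>\<delta>s k\<bar>)" using \<rho> by simp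
      then show ?thesis using i Suc by (simp add: mult.assoc)
    qed
  qed
  have "(\<lambda>k. (ls k - ls (Suc k)) / \<eta>) \<longlonglongrightarrow> (lim - lim) / \<eta>"
    using \<eta> by (intro tendsto_intros lim LIMSEQ_Suc[OF lim]) auto
  then have gap: "(\<lambda>k. (ls k - ls (Suc k)) / \<eta>) \<longlonglongrightarrow> 0" by simp
  have q0: "(\<lambda>k. \<alpha>s k * \<bar>\<delta>s k\<bar>) \<longlonglongrightarrow> 0"
    by (rule real_tendsto_sandwich[OF _ _ tendsto_const gap])
      (use drop drop0 \<eta> in \<open>auto simp: le_divide_eq mult.commute intro!: always_eventually\<close>)
  have "\<forall>\<^sub>F k in sequentially. \<alpha>s k * \<bar>\<delta>s k\<bar> < \<rho> * \<epsilon>"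
    by (rule order_tendstoD[OF q0]) (use \<rho> \<epsilon> in simp)
  then show ev1: "\<forall>\<^sub>F k in sequentially. \<alpha>s k = 1"
    by eventually_elim (use \<alpha>_cases in \<open>force\<close>)
  have \<delta>0: "(\<lambda>k. \<bar>\<delta>s k\<bar>) \<longlonglongrightarrow> 0"
    by (rule Lim_transform_eventually[OF q0]) (use ev1 in \<open>auto elim: eventually_mono\<close>)

  obtain K1 where K1: "0 \<le> K1" "\<And>x lam v \<delta>. x \<in> box l u \<Longrightarrow> lam \<le> lam0 \<Longrightarrow> \<forall>b\<in>I. quot b x \<le> lam \<Longrightarrow>
      newton x lam v \<delta> \<Longrightarrow> nrm v \<le> K1 * \<bar>\<delta>\<bar>"
    using newton_step_bound[OF l, of u lam0] by blast
  have d_le: "nrm (ds k) \<le> K1 * \<bar>\<delta>s k\<bar>" for k by (rule K1(2)[OF xk ls_le quot_le nw])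
  obtain K2 where K2: "0 \<le> K2" "\<And>x lam y b. x \<in> box l u \<Longrightarrow> \<bar>lam\<bar> \<le> lam0 \<Longrightarrow> b \<in> I \<Longrightarrow> \<bar>jac lam x y b\<bar> \<le> K2 * nrm y"
    using jac_bounded[OF l, of u lam0] by blast
  define K3 where "K3 = real (card I) * (K2 * K1 + \<bar>u\<bar>)"
  have res_le: "nrm (\<lambda>b. ls k * xs k b - quot b (xs k) * xs k b) \<le> K3 * \<bar>\<delta>s k\<bar>" for k
  proof -
    have "\<bar>ls k * xs k b - quot b (xs k) * xs k b\<bar> \<le> (K2 * K1 + \<bar>u\<bar>) * \<bar>\<delta>s k\<bar>" if b: "b \<in> I" for b
    proof -
      have "jac (ls k) (xs k) (ds k) b + xs k b * \<delta>s k + (ls k * xs k b - quot b (xs k) * xs k b) = 0"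
        using nw b unfolding newton_def by blast
      moreover have "\<bar>jac (ls k) (xs k) (ds k) b\<bar> \<le> K2 * (K1 * \<bar>\<delta>s k\<bar>)"
        using K2(2)[OF xk _ b, of "ls k" k "ds k"] ls_le ls_nonneg mult_left_mono[OF d_le K2(1), of k]
        by fastforce
      moreover have "\<bar>xs k b * \<delta>s k\<bar> \<le> \<bar>u\<bar> * \<bar>\<delta>s k\<bar>"
        unfolding abs_mult using xk[of k] positiveD[OF pos b, of k] b
        by (intro mult_right_mono) (auto simp: box_def)
      ultimately show ?thesis unfolding distrib_right mult.assoc by linarith
    qed
    then have "nrm (\<lambda>b. ls k * xs k b - quot b (xs k) * xs k b) \<le> (\<Sum>b\<in>I. (K2 * K1 + \<bar>u\<bar>) * \<bar>\<delta>s k\<bar>)"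
      unfolding nrm_def by (rule sum_mono)
    then show ?thesis unfolding K3_def by simp
  qed
  have K3\<delta>: "(\<lambda>k. K3 * \<bar>\<delta>s k\<bar>) \<longlonglongrightarrow> 0" using tendsto_mult_left[OF \<delta>0, of K3] by simp
  define e where "e = (\<lambda>k. err (xs k))"
  have e_nonneg: "0 \<le> e k" for k unfolding e_def by (rule nrm_nonneg)
  have e0: "e \<longlonglongrightarrow> 0"
  proof (rule order_tendstoI)
    fix t :: real assume "t < 0"
    then show "\<forall>\<^sub>F k in sequentially. t < e k" by (intro always_eventually allI less_le_trans[OF _ e_nonneg])
  next
    fix t :: real assume t: "0 < t"
    obtain \<kappa> where \<kappa>: "0 < \<kappa>" "\<And>x lam. x \<in> box l u \<Longrightarrow> 0 \<le> lam \<Longrightarrow> lam \<le> lam0 \<Longrightarrow> c x = 1 \<Longrightarrow>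
        t \<le> err x \<Longrightarrow> \<kappa> \<le> nrm (\<lambda>b. lam * x b - quot b x * x b)"
      using residual_bounded_below[OF l t, of u lam0] by blast
    have "\<forall>\<^sub>F k in sequentially. K3 * \<bar>\<delta>s k\<bar> < \<kappa>" by (rule order_tendstoD(2)[OF K3\<delta> \<kappa>(1)])
    then show "\<forall>\<^sub>F k in sequentially. e k < t"
    proof eventually_elim
      case (elim k)
      have "\<kappa> \<le> K3 * \<bar>\<delta>s k\<bar>" if "t \<le> e k"
        using \<kappa>(2)[OF xk ls_nonneg ls_le c1 that[unfolded e_def]] res_le[of k] by (rule order_trans)
      then show ?case using elim by linarith
    qed
  qed
  then show "(\<lambda>k. err (xs k)) \<longlonglongrightarrow> 0" unfolding e_def .

  obtain Kf where Kf: "0 \<le> Kf" "\<And>b x y. b \<in> I \<Longrightarrow> x \<in> box l u \<Longrightarrow> y \<in> box l u \<Longrightarrow>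
    \<bar>quot b y - quot b x\<bar> \<le> Kf * nrm (\<lambda>b. y b - x b)"
    using quot_lipschitz[OF l, of u] by blast
  have lam_err: "\<bar>ls k - \<mu>\<bar> \<le> Kf * e k" for k
  proof -
    obtain b where b: "b \<in> I" "quot b (xs k) = ls k" using att by blast
    then show ?thesis using Kf(2)[OF b(1) xb xk, of k] quot_xbar[OF b(1)] unfolding e_def by simp
  qed
  have Kfe: "(\<lambda>k. Kf * e k) \<longlonglongrightarrow> 0" using tendsto_mult_left[OF e0, of Kf] by simp
  show "(\<lambda>k. \<bar>ls k - \<mu>\<bar>) \<longlonglongrightarrow> 0"
    by (rule real_tendsto_sandwich[OF _ _ tendsto_const Kfe])
      (use lam_err in \<open>auto intro!: always_eventually\<close>)

  obtain K where K: "0 \<le> K" "\<And>x lam v \<delta>. x \<in> box l u \<Longrightarrow> c x = 1 \<Longrightarrow> lam \<le> lam0 \<Longrightarrow>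
      \<forall>b\<in>I. quot b x \<le> lam \<Longrightarrow> \<exists>b\<in>I. quot b x = lam \<Longrightarrow> newton x lam v \<delta> \<Longrightarrow>
      nrm (\<lambda>b. x b + v b - xbar b) \<le> K * (err x)\<^sup>2 \<and>
      \<bar>lam + \<delta> - \<mu>\<bar> \<le> K * (err x)\<^sup>2"
    using newton_quadratic_error[OF l xb, of lam0] by blast
  define z where "z = (\<lambda>k b. xs k b + ds k b)"
  have z_err: "err (z k) \<le> K * (e k)\<^sup>2" and inc_err: "\<bar>ls k + \<delta>s k - \<mu>\<bar> \<le> K * (e k)\<^sup>2" for k
    using K(2)[OF xk c1 ls_le quot_le att nw, of k] unfolding z_def e_def by auto
  define B where "B = box (l / 2) (u + l / 2)"
  have l2: "0 < l / 2" using l by simp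
  obtain Kc where Kc: "0 \<le> Kc" "\<And>x y. x \<in> B \<Longrightarrow> y \<in> B \<Longrightarrow> \<bar>c y - c x\<bar> \<le> Kc * nrm (\<lambda>b. y b - x b)"
    unfolding B_def using c_lipschitz[OF l2] by blast
  define Kr where "Kr = 2 * real (card I) * \<bar>u + l / 2\<bar>"
  have Kr: "0 \<le> Kr" unfolding Kr_def by simp
  define M where "M = (Kr * Kc + 1) * K"
  have M: "0 \<le> M" unfolding M_def using Kr Kc K by simp
  have Ke2: "(\<lambda>k. K * (e k)\<^sup>2) \<longlonglongrightarrow> 0"
    using tendsto_mult_left[OF tendsto_power[OF e0, of 2], of K] by simp
  have KKe2: "(\<lambda>k. Kc * (K * (e k)\<^sup>2)) \<longlonglongrightarrow> 0"
    using tendsto_mult_left[OF Ke2, of Kc] by simp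
  have quad: "\<forall>\<^sub>F k in sequentially. e (Suc k) \<le> M * (e k)\<^sup>2"
    using ev1 order_tendstoD(2)[OF Ke2 l2] order_tendstoD(2)[OF KKe2, of "1 / 2", simplified]
  proof eventually_elim
    case (elim k)
    have zn: "err (z k) \<le> l / 2" using z_err[of k] elim(2) by linarith
    have zB: "z k \<in> B" unfolding B_def by (rule box_near[OF xb zn, THEN box_mono]) simp_all
    have xB: "xbar \<in> B" unfolding B_def by (rule box_mono[OF xb]) (use l in auto)
    have "\<bar>c (z k) - 1\<bar> \<le> Kc * err (z k)" using Kc(2)[OF xB zB] c_xbar by simp
    also have "\<dots> \<le> Kc * (K * (e k)\<^sup>2)" by (rule mult_left_mono[OF z_err Kc(1)])
    finally have cz: "\<bar>c (z k) - 1\<bar> \<le> Kc * (K * (e k)\<^sup>2)" .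
    then have cz2: "\<bar>c (z k) - 1\<bar> \<le> 1 / 2" using elim(3) by linarith
    have "nrm (\<lambda>b. retract (z k) b - z k b) \<le> Kr * \<bar>c (z k) - 1\<bar>"
      unfolding Kr_def by (rule retract_near[OF l2 zB[unfolded B_def] cz2])
    also have "\<dots> \<le> Kr * (Kc * (K * (e k)\<^sup>2))" by (rule mult_left_mono[OF cz Kr])
    finally have rz: "nrm (\<lambda>b. retract (z k) b - z k b) \<le> Kr * (Kc * (K * (e k)\<^sup>2))" .
    have "e (Suc k) = nrm (\<lambda>b. (retract (z k) b - z k b) + (z k b - xbar b))"
      unfolding e_def by (rule nrm_cong) (simp add: step elim(1) z_def)
    also have "\<dots> \<le> Kr * (Kc * (K * (e k)\<^sup>2)) + K * (e k)\<^sup>2"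
      using nrm_triangle[of "\<lambda>b. retract (z k) b - z k b" "\<lambda>b. z k b - xbar b"] rz z_err[of k] by linarith
    finally show "e (Suc k) \<le> M * (e k)\<^sup>2" unfolding M_def by (simp add: algebra_simps)
  qed
  then show "\<exists>K. \<forall>\<^sub>F k in sequentially. err (xs (Suc k)) \<le> K * (err (xs k))\<^sup>2"
    unfolding e_def by blast

  \<comment> \<open>Up to terms of second order, the error is the negative of the step, the step is bounded by \<open>\<delta>s k\<close>, and
    \<open>\<delta>s k\<close> is the negative of \<open>ls k - \<mu>\<close>.\<close>
  define Q where "Q = (K1 + 1) * K"
  have Q: "0 \<le> Q" unfolding Q_def using K1 K by simp
  have "(\<lambda>k. Q * e k) \<longlonglongrightarrow> 0" using tendsto_mult_left[OF e0, of Q] by simp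
  then have "\<forall>\<^sub>F k in sequentially. Q * e k < 1 / 2" by (rule order_tendstoD) simp
  then have e_le: "\<forall>\<^sub>F k in sequentially. e k \<le> 2 * K1 * \<bar>ls k - \<mu>\<bar>"
  proof eventually_elim
    case (elim k)
    have "e k = nrm (\<lambda>b. (z k b - xbar b) + (- 1) * ds k b)"
      unfolding e_def z_def by simp
    also have "\<dots> \<le> err (z k) + nrm (\<lambda>b. (- 1) * ds k b)" by (rule nrm_triangle)
    also have "\<dots> \<le> K * (e k)\<^sup>2 + K1 * \<bar>\<delta>s k\<bar>"
      using z_err[of k] d_le[of k] nrm_scale[of "- 1" "ds k"] by simp
    also have "\<bar>\<delta>s k\<bar> \<le> \<bar>ls k - \<mu>\<bar> + K * (e k)\<^sup>2" using inc_err[of k] by linarith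
    then have "K1 * \<bar>\<delta>s k\<bar> \<le> K1 * (\<bar>ls k - \<mu>\<bar> + K * (e k)\<^sup>2)" using K1(1) by (rule mult_left_mono)
    finally have "e k \<le> K1 * \<bar>ls k - \<mu>\<bar> + (Q * e k) * e k"
      unfolding Q_def by (simp add: algebra_simps power2_eq_square)
    also have "(Q * e k) * e k \<le> 1 / 2 * e k" using elim e_nonneg[of k] by (intro mult_right_mono) auto
    finally show ?case by simp
  qed
  have "\<forall>\<^sub>F k in sequentially. \<bar>ls (Suc k) - \<mu>\<bar> \<le> (Kf * M * (2 * K1)\<^sup>2) * \<bar>ls k - \<mu>\<bar>\<^sup>2"
    using quad e_le
  proof eventually_elim
    case (elim k)
    have "\<bar>ls (Suc k) - \<mu>\<bar> \<le> Kf * e (Suc k)" by (rule lam_err)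
    also have "\<dots> \<le> Kf * (M * (e k)\<^sup>2)" by (rule mult_left_mono[OF elim(1) Kf(1)])
    also have "(e k)\<^sup>2 \<le> (2 * K1 * \<bar>ls k - \<mu>\<bar>)\<^sup>2" using elim(2) e_nonneg[of k] by (rule power_mono)
    then have "Kf * (M * (e k)\<^sup>2) \<le> Kf * (M * (2 * K1 * \<bar>ls k - \<mu>\<bar>)\<^sup>2)"
      using Kf(1) M by (intro mult_left_mono)
    finally show ?case by (simp add: power_mult_distrib mult_ac)
  qed
  then show "\<exists>K. \<forall>\<^sub>F k in sequentially. \<bar>ls (Suc k) - \<mu>\<bar> \<le> K * \<bar>ls k - \<mu>\<bar>\<^sup>2" by blast
qed

end

section \<open>Tensors with a shape partition\<close>

locale shaped_tensor =
  fixes m d :: nat and N :: "nat \<Rightarrow> nat" and a :: "(nat \<Rightarrow> nat) \<Rightarrow> real"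
    and \<sigma> :: "nat \<Rightarrow> nat set" and p :: "nat \<Rightarrow> real"
  assumes m_pos: "1 \<le> m" and N_pos: "\<forall>l\<in>{1..m}. 1 \<le> N l"
    and nonneg: "nonneg_tensor m N a" and shape: "shape_partition m N d \<sigma>"
    and exponents_gt_1: "\<forall>i\<in>{1..d}. 1 < p i"
begin

lemma modes_partition: "partition_on {1..m} (\<sigma> ` {1..d})"
  using shape[unfolded shape_partition_def] by (elim conjE)

lemma blocks_inj: "inj_on \<sigma> {1..d}"
  using shape[unfolded shape_partition_def] by (elim conjE)

lemma dims_constant: "\<forall>i\<in>{1..d}. \<forall>j\<in>\<sigma> i. \<forall>j'\<in>\<sigma> i. N j = N j'"
  using shape[unfolded shape_partition_def] by (elim conjE)

lemma modes_Union: "(\<Union>i\<in>{1..d}. \<sigma> i) = {1..m}"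
  using partition_onD1[OF modes_partition] by simp

lemma blocks_meet: "i \<in> {1..d} \<Longrightarrow> i' \<in> {1..d} \<Longrightarrow> l \<in> \<sigma> i \<Longrightarrow> l \<in> \<sigma> i' \<Longrightarrow> i' = i"
  using disjointD[OF partition_onD2[OF modes_partition], of "\<sigma> i" "\<sigma> i'"] inj_onD[OF blocks_inj, of i' i] by blast

lemma block_of_mode:
  assumes "l \<in> {1..m}" shows "block_of d \<sigma> l \<in> {1..d}" "l \<in> \<sigma> (block_of d \<sigma> l)"
proof -
  obtain i where i: "i \<in> {1..d}" "l \<in> \<sigma> i"
    using assms modes_Union by blast
  then have "\<exists>!i. i \<in> {1..d} \<and> l \<in> \<sigma> i" using blocks_meet by blast
  from theI'[OF this] show "block_of d \<sigma> l \<in> {1..d}" "l \<in> \<sigma> (block_of d \<sigma> l)"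
    unfolding block_of_def by auto
qed

lemma block_of_eq:
  assumes "i \<in> {1..d}" "l \<in> \<sigma> i" shows "l \<in> {1..m}" "block_of d \<sigma> l = i"
proof -
  show l: "l \<in> {1..m}" using assms modes_Union by blast
  show "block_of d \<sigma> l = i" by (rule blocks_meet[OF assms(1) _ assms(2)]) (rule block_of_mode[OF l])+
qed

lemma block_finite: "i \<in> {1..d} \<Longrightarrow> finite (\<sigma> i)"
  using block_of_eq(1) finite_subset[of "\<sigma> i" "{1..m}"] by blast

lemma s_idx_in: assumes i: "i \<in> {1..d}" shows "s_idx \<sigma> i \<in> \<sigma> i"
proof -
  have "\<sigma> i \<noteq> {}" using partition_onD3[OF modes_partition] i by (metis imageI)
  then show ?thesis unfolding s_idx_def using block_finite[OF i] by (intro Min_in)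
qed

lemma N_mode: assumes l: "l \<in> {1..m}" shows "N l = n_dim N \<sigma> (block_of d \<sigma> l)"
  unfolding n_dim_def using dims_constant block_of_mode[OF l] s_idx_in[OF block_of_mode(1)[OF l]] by blast

lemma d_pos: "0 < d"
  using block_of_mode(1)[of 1] m_pos by auto

lemma exponent_pos: "i \<in> {1..d} \<Longrightarrow> 0 < p i"
  using exponents_gt_1 by fastforce

lemma n_dim_pos: "i \<in> {1..d} \<Longrightarrow> 1 \<le> n_dim N \<sigma> i"
  unfolding n_dim_def using N_pos block_of_eq(1)[OF _ s_idx_in] by blast

text \<open>The data that present \<open>A_{s_i,t}(x^{[\<sigma>]})\<close> as a weighted form: multi-indices with entry \<open>t\<close> in mode
  \<open>s_i\<close> label the monomials, and the remaining modes label the factors.\<close>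

definition rows :: "nat \<times> nat \<Rightarrow> (nat \<Rightarrow> nat) set" where
  "rows b = {j \<in> multi_idx m N. j (s_idx \<sigma> (fst b)) = snd b}"

definition modes :: "nat \<times> nat \<Rightarrow> nat set" where
  "modes b = {1..m} - {s_idx \<sigma> (fst b)}"

definition entry :: "(nat \<Rightarrow> nat) \<Rightarrow> nat \<Rightarrow> nat \<times> nat" where
  "entry j l = (block_of d \<sigma> l, j l)"

definition total :: real where
  "total = (\<Sum>i\<in>{1..d}. real (card (\<sigma> i)) / p i)"

lemma finite_idx: "finite (idx N d \<sigma>)"
  unfolding idx_def by auto

sublocale weighted_form "idx N d \<sigma>" rows a modes entry "\<lambda>b. p (fst b)" total
proof
  show "finite (idx N d \<sigma>)" by (rule finite_idx)
  have "(1, 1) \<in> idx N d \<sigma>" unfolding idx_def using d_pos n_dim_pos[of 1] by auto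
  then show "idx N d \<sigma> \<noteq> {}" by blast
  fix b assume b: "b \<in> idx N d \<sigma>"
  then have i: "fst b \<in> {1..d}" unfolding idx_def by auto
  show "finite (rows b)" unfolding rows_def multi_idx_def by (simp add: finite_PiE)
  show "finite (modes b)" unfolding modes_def by simp
  show "1 < p (fst b)" using exponents_gt_1 i by blast
  fix j assume j: "j \<in> rows b"
  show "0 \<le> a j" using nonneg j unfolding nonneg_tensor_def rows_def by blast
  show "entry j l \<in> idx N d \<sigma>" if "l \<in> modes b" for l
    using that j block_of_mode(1)[of l] N_mode[of l] PiE_mem[of j "{1..m}" "\<lambda>l. {1..N l}" l]
    unfolding modes_def rows_def multi_idx_def entry_def idx_def by auto
  have "(\<Sum>l\<in>{1..m}. 1 / p (block_of d \<sigma> l)) = (\<Sum>i\<in>{1..d}. \<Sum>l\<in>{l \<in> {1..m}. block_of d \<sigma> l = i}. 1 / p (block_of d \<sigma> l))"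
    using block_of_mode by (intro sum.group[symmetric]) auto
  also have "\<dots> = total" unfolding total_def
  proof (rule sum.cong)
    fix i assume i: "i \<in> {1..d}"
    have "{l \<in> {1..m}. block_of d \<sigma> l = i} = \<sigma> i"
      using block_of_mode block_of_eq[OF i] by auto
    then show "(\<Sum>l\<in>{l \<in> {1..m}. block_of d \<sigma> l = i}. 1 / p (block_of d \<sigma> l)) = real (card (\<sigma> i)) / p i"
      using block_of_eq(2)[OF i] by simp
  qed simp
  finally have "(\<Sum>l\<in>{1..m}. 1 / p (block_of d \<sigma> l)) = total" .
  moreover have "(\<Sum>l\<in>{1..m}. 1 / p (block_of d \<sigma> l)) = 1 / p (block_of d \<sigma> (s_idx \<sigma> (fst b)))
      + (\<Sum>l\<in>modes b. 1 / p (block_of d \<sigma> l))"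
    unfolding modes_def using block_of_eq(1)[OF i s_idx_in[OF i]] by (intro sum.remove) auto
  ultimately show "(\<Sum>l\<in>modes b. 1 / p (fst (entry j l))) = total - 1 / p (fst b)"
    using block_of_eq(2)[OF i s_idx_in[OF i]] unfolding entry_def by simp
qed

lemma block_map_eq_form: "block_map m N a d \<sigma> b = form b"
  unfolding block_map_def tensor_map_def repeat_blocks_def
  by (rule ext) (simp add: form_def monomial_def rows_def modes_def entry_def)

lemma Phi_eq_quot: "Phi m N a d \<sigma> p x b = quot b x"
  unfolding Phi_def quot_def block_map_eq_form by simp

lemma positive_vec_eq: "positive_vec N d \<sigma> x \<longleftrightarrow> positive x"
  unfolding positive_vec_def positive_def ..

lemma M_matrix_eq:
  assumes "b \<in> idx N d \<sigma>" "b' \<in> idx N d \<sigma>"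
  shows "M_matrix m N a d \<sigma> b b' = form_grad b (\<lambda>_. 1) b'"
  unfolding M_matrix_def pderiv_at_def block_map_eq_form
  by (rule DERIV_imp_deriv, rule partial_derivative_positive[OF form_quad])
    (use assms in \<open>auto simp: positive_def\<close>)

lemma M_matrix_nonzero:
  assumes "b \<in> idx N d \<sigma>" "b' \<in> idx N d \<sigma>" "M_matrix m N a d \<sigma> b b' \<noteq> 0"
  shows "\<exists>j\<in>rows b. 0 < a j"
proof (rule ccontr)
  assume "\<not> ?thesis"
  then have "a j = 0" if "j \<in> rows b" for j using a_nonneg[OF assms(1) that] that by force
  then have "form_grad b (\<lambda>_. 1) b' = 0" unfolding form_grad_def by simp
  then show False using assms M_matrix_eq by simp
qed

text \<open>An entry of the matrix \<open>M\<close> vanishes if its column occurs in no monomial of its row with positive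
  coefficient, and a row with a nonzero entry contains such a monomial; so a closed set of indices gives a
  zero block of \<open>M\<close>.\<close>

lemma weighted_system_if:
  assumes "(strictly_nonneg m N a d \<sigma> \<and> (\<Sum>i\<in>{1..d}. real (card (\<sigma> i)) / p i) < 1) \<or>
         (weakly_irreducible m N a d \<sigma> \<and> (\<Sum>i\<in>{1..d}. real (card (\<sigma> i)) / p i) = 1)"
  shows "weighted_system (idx N d \<sigma>) rows a modes entry (\<lambda>b. p (fst b)) total"
proof
  show "(total < 1 \<and> (\<forall>b\<in>idx N d \<sigma>. \<exists>j\<in>rows b. 0 < a j)) \<or>
      (total = 1 \<and> (\<forall>T. T \<noteq> {} \<longrightarrow> T \<subseteq> idx N d \<sigma> \<longrightarrow>
        (\<forall>b\<in>T. \<forall>j\<in>rows b. 0 < a j \<longrightarrow> entry j ` modes b \<subseteq> T) \<longrightarrow> T = idx N d \<sigma>))"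
    using assms unfolding total_def[symmetric]
  proof (elim disjE conjE)
    assume "strictly_nonneg m N a d \<sigma>" "total < 1"
    then show ?thesis using M_matrix_nonzero unfolding strictly_nonneg_def by blast
  next
    assume irr: "weakly_irreducible m N a d \<sigma>" and S: "total = 1"
    have "T = idx N d \<sigma>" if T: "T \<noteq> {}" "T \<subseteq> idx N d \<sigma>"
      and cl: "\<forall>b\<in>T. \<forall>j\<in>rows b. 0 < a j \<longrightarrow> entry j ` modes b \<subseteq> T" for T
    proof (rule ccontr)
      assume "T \<noteq> idx N d \<sigma>"
      then have "T \<subset> idx N d \<sigma>" using T by blast
      moreover have "M_matrix m N a d \<sigma> b b' = 0" if b: "b \<in> T" and b': "b' \<in> idx N d \<sigma> - T" for b b'
      proof -
        have "a j * (monomial b j (\<lambda>_. 1) * (real (card {l \<in> modes b. entry j l = b'}) / 1)) = 0" if j: "j \<in> rows b" for j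
        proof (cases "0 < a j")
          case True
          then have "{l \<in> modes b. entry j l = b'} = {}" using cl b b' j by blast
          then show ?thesis by (simp only: card.empty)
        next
          case False
          then show ?thesis using a_nonneg[OF _ j] b T by force
        qed
        then have "form_grad b (\<lambda>_. 1) b' = 0" unfolding form_grad_def by (intro sum.neutral) blast
        moreover have "b \<in> idx N d \<sigma>" "b' \<in> idx N d \<sigma>" using b b' T by blast+
        ultimately show ?thesis by (simp only: M_matrix_eq)
      qed
      ultimately have "\<exists>S. S \<noteq> {} \<and> S \<subset> idx N d \<sigma> \<and>
          (\<forall>b\<in>S. \<forall>b'\<in>idx N d \<sigma> - S. M_matrix m N a d \<sigma> b b' = 0)"
        using T(1) by (intro exI[of _ T]) (intro conjI ballI)
      with irr show False
        unfolding weakly_irreducible_def irreducible_matrix_def by (rule notE)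
    qed
    then show ?thesis using S by blast
  qed
qed

definition power_sum :: "bvec \<Rightarrow> nat \<Rightarrow> real" where
  "power_sum x i = (\<Sum>t\<in>{1..n_dim N \<sigma> i}. \<bar>x (i, t)\<bar> powr p i)"

definition norm_grad :: "bvec \<Rightarrow> nat \<times> nat \<Rightarrow> real" where
  "norm_grad x b = c_fun N d \<sigma> p x * (\<bar>x b\<bar> powr (p (fst b) - 1) / power_sum x (fst b))"

lemma block_norm_power_sum: "block_norm N \<sigma> p x i = power_sum x i powr (1 / p i)"
  unfolding block_norm_def power_sum_def ..

lemma idx_iff: "(i, t) \<in> idx N d \<sigma> \<longleftrightarrow> i \<in> {1..d} \<and> t \<in> {1..n_dim N \<sigma> i}"
  unfolding idx_def by auto

lemma power_sum_lower:
  assumes l: "0 < l" and x: "\<And>b. b \<in> idx N d \<sigma> \<Longrightarrow> l \<le> x b" and i: "i \<in> {1..d}"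
  shows "l powr p i \<le> power_sum x i"
proof -
  have t: "1 \<in> {1..n_dim N \<sigma> i}" using n_dim_pos[OF i] by simp
  have "l powr p i \<le> \<bar>x (i, 1)\<bar> powr p i"
    using x[of "(i, 1)"] t i l exponent_pos[OF i] by (intro powr_mono2) (auto simp: idx_iff)
  also have "\<dots> \<le> power_sum x i"
    unfolding power_sum_def using t by (intro member_le_sum[where f = "\<lambda>t. \<bar>x (i, t)\<bar> powr p i"]) auto
  finally show ?thesis .
qed

lemma power_sum_pos: assumes x: "positive x" and i: "i \<in> {1..d}" shows "0 < power_sum x i"
  unfolding power_sum_def
proof (rule sum_pos)
  show "{1..n_dim N \<sigma> i} \<noteq> {}" using n_dim_pos[OF i] by auto
  fix t assume t: "t \<in> {1..n_dim N \<sigma> i}"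
  then have "0 < x (i, t)" using positiveD[OF x] i by (simp add: idx_iff)
  then show "0 < \<bar>x (i, t)\<bar> powr p i" by simp
qed simp

lemma block_norm_lower:
  assumes l: "0 < l" and x: "\<And>b. b \<in> idx N d \<sigma> \<Longrightarrow> l \<le> x b" and i: "i \<in> {1..d}"
  shows "l \<le> block_norm N \<sigma> p x i"
proof -
  have pi: "0 < p i" by (rule exponent_pos[OF i])
  have "l = (l powr p i) powr (1 / p i)" using l pi by (simp add: powr_powr)
  also have "\<dots> \<le> block_norm N \<sigma> p x i"
    unfolding block_norm_power_sum using power_sum_lower[OF assms] pi l by (intro powr_mono2) auto
  finally show ?thesis .
qed

lemma block_norm_pos: "positive x \<Longrightarrow> i \<in> {1..d} \<Longrightarrow> 0 < block_norm N \<sigma> p x i"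
  unfolding block_norm_power_sum using power_sum_pos[of x i] by simp

lemma block_norm_component:
  assumes "(i, t) \<in> idx N d \<sigma>" shows "\<bar>x (i, t)\<bar> \<le> block_norm N \<sigma> p x i"
proof -
  have i: "i \<in> {1..d}" and t: "t \<in> {1..n_dim N \<sigma> i}" using assms by (auto simp: idx_iff)
  have pi: "0 < p i" by (rule exponent_pos[OF i])
  have "\<bar>x (i, t)\<bar> = (\<bar>x (i, t)\<bar> powr p i) powr (1 / p i)" using pi by (simp add: powr_powr)
  also have "\<dots> \<le> block_norm N \<sigma> p x i"
    unfolding block_norm_power_sum power_sum_def using t pi
    by (intro powr_mono2 member_le_sum[where f = "\<lambda>t. \<bar>x (i, t)\<bar> powr p i"]) auto
  finally show ?thesis .
qed

lemma block_norm_strict_mono: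
  assumes i: "i \<in> {1..d}" and lt: "\<And>t. (i, t) \<in> idx N d \<sigma> \<Longrightarrow> \<bar>x (i, t)\<bar> < \<bar>y (i, t)\<bar>"
  shows "block_norm N \<sigma> p x i < block_norm N \<sigma> p y i"
proof -
  have pi: "0 < p i" by (rule exponent_pos[OF i])
  have "power_sum x i < power_sum y i"
    unfolding power_sum_def
    using lt i pi n_dim_pos[OF i] by (intro sum_strict_mono powr_less_mono2) (auto simp: idx_iff)
  moreover have "0 \<le> power_sum x i" unfolding power_sum_def by (simp add: sum_nonneg)
  ultimately show ?thesis unfolding block_norm_power_sum using pi by (intro powr_less_mono2) auto
qed

lemma block_norm_cong:
  assumes "\<And>b. b \<in> idx N d \<sigma> \<Longrightarrow> x b = y b" "i \<in> {1..d}"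
  shows "power_sum x i = power_sum y i" "block_norm N \<sigma> p x i = block_norm N \<sigma> p y i"
proof -
  show "power_sum x i = power_sum y i" unfolding power_sum_def using assms by (auto simp: idx_iff intro!: sum.cong)
  then show "block_norm N \<sigma> p x i = block_norm N \<sigma> p y i" unfolding block_norm_power_sum by simp
qed

lemma c_fun_cong:
  assumes "\<And>b. b \<in> idx N d \<sigma> \<Longrightarrow> x b = y b" shows "c_fun N d \<sigma> p x = c_fun N d \<sigma> p y"
  unfolding c_fun_def by (intro prod.cong block_norm_cong(2)[OF assms]) auto

lemma c_fun_pos: "positive x \<Longrightarrow> 0 < c_fun N d \<sigma> p x"
  unfolding c_fun_def by (intro prod_pos) (auto intro: block_norm_pos)

text \<open>Up to the factor \<open>c_fun\<close>, the derivative in an entry of block \<open>i\<close> is the logarithmic derivative of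
  the norm of this block.\<close>

lemma c_fun_quad:
  assumes l: "0 < l"
  shows "quad_approx_on (idx N d \<sigma>) (box l u) (c_fun N d \<sigma> p) norm_grad"
proof -
  define lg where "lg = (\<lambda>i x b. if fst b = i then \<bar>x b\<bar> powr (p i - 1) / power_sum x i else 0)"
  have "quad_approx_on (idx N d \<sigma>) (box l u) (\<lambda>x. \<Prod>i\<in>{1..d}. block_norm N \<sigma> p x i)
      (\<lambda>x b. (\<Prod>i\<in>{1..d}. block_norm N \<sigma> p x i) * (\<Sum>i\<in>{1..d}. lg i x b))"
  proof (rule quad_approx_on_prod)
    fix i assume i: "i \<in> {1..d}"
    have pi: "0 < p i" by (rule exponent_pos[OF i])
    have low: "l \<le> x b" if "x \<in> box l u" "b \<in> idx N d \<sigma>" for x b using that by (simp add: box_def)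
    have "quad_approx_on (idx N d \<sigma>) (box l u) (\<lambda>x. \<Sum>t\<in>{1..n_dim N \<sigma> i}. x (i, t) powr p i)
        (\<lambda>x b. \<Sum>t\<in>{1..n_dim N \<sigma> i}. p i * x (i, t) powr (p i - 1) * (if b = (i, t) then 1 else 0))"
    proof (rule quad_approx_on_sum)
      fix t assume "t \<in> {1..n_dim N \<sigma> i}"
      then have b: "(i, t) \<in> idx N d \<sigma>" using i by (simp add: idx_iff)
      show "quad_approx_on (idx N d \<sigma>) (box l u) (\<lambda>x. x (i, t) powr p i)
          (\<lambda>x b. p i * x (i, t) powr (p i - 1) * (if b = (i, t) then 1 else 0))"
        by (rule quad_approx_on_powr[OF coord_quad[OF l b] l]) (rule low[OF _ b])
    qed
    then have "quad_approx_on (idx N d \<sigma>) (box l u) (\<lambda>x. power_sum x i)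
        (\<lambda>x b. if fst b = i then p i * \<bar>x b\<bar> powr (p i - 1) else 0)"
    proof (rule quad_approx_on_cong)
      fix x assume x: "x \<in> box l u"
      have abs: "\<bar>x b\<bar> = x b" if "b \<in> idx N d \<sigma>" for b using low[OF x that] l by simp
      show "power_sum x i = (\<Sum>t\<in>{1..n_dim N \<sigma> i}. x (i, t) powr p i)"
        unfolding power_sum_def using abs i by (intro sum.cong) (auto simp: idx_iff)
      fix b assume b: "b \<in> idx N d \<sigma>"
      obtain i' t' where b': "b = (i', t')" by (cases b)
      have "(\<Sum>t\<in>{1..n_dim N \<sigma> i}. p i * x (i, t) powr (p i - 1) * (if b = (i, t) then 1 else 0))
          = (\<Sum>t\<in>{1..n_dim N \<sigma> i}. if t = t' then (if i' = i then p i * x (i, t) powr (p i - 1) else 0) else 0)"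
        unfolding b' by (intro sum.cong) auto
      also have "\<dots> = (if i' = i then p i * x (i, t') powr (p i - 1) else 0)"
        using b b' by (auto simp: idx_iff)
      finally show "(if fst b = i then p i * \<bar>x b\<bar> powr (p i - 1) else 0)
          = (\<Sum>t\<in>{1..n_dim N \<sigma> i}. p i * x (i, t) powr (p i - 1) * (if b = (i, t) then 1 else 0))"
        using abs[OF b] b' by auto
    qed
    then have "quad_approx_on (idx N d \<sigma>) (box l u) (\<lambda>x. power_sum x i powr (1 / p i))
        (\<lambda>x b. 1 / p i * power_sum x i powr (1 / p i - 1) * (if fst b = i then p i * \<bar>x b\<bar> powr (p i - 1) else 0))"
      by (rule quad_approx_on_powr[where lo = "l powr p i"]) (use l i in \<open>auto intro!: power_sum_lower low\<close>)
    then show "quad_approx_on (idx N d \<sigma>) (box l u) (\<lambda>x. block_norm N \<sigma> p x i)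
        (\<lambda>x b. block_norm N \<sigma> p x i * lg i x b)"
    proof (rule quad_approx_on_cong)
      fix x b assume x: "x \<in> box l u"
      have "0 < l powr p i" using l by simp
      also have "\<dots> \<le> power_sum x i" by (rule power_sum_lower[OF l low[OF x] i])
      finally have "0 < power_sum x i" .
      then show "block_norm N \<sigma> p x i * lg i x b = 1 / p i * power_sum x i powr (1 / p i - 1) *
          (if fst b = i then p i * \<bar>x b\<bar> powr (p i - 1) else 0)"
        unfolding block_norm_power_sum lg_def using pi by (simp add: powr_diff)
    qed (simp add: block_norm_power_sum)
  qed
  then show ?thesis
  proof (rule quad_approx_on_cong)
    fix x b assume b: "b \<in> idx N d \<sigma>"
    then have "(\<Sum>i\<in>{1..d}. lg i x b) = \<bar>x b\<bar> powr (p (fst b) - 1) / power_sum x (fst b)"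
      unfolding lg_def by (cases b) (auto simp: idx_iff)
    then show "norm_grad x b = (\<Prod>i\<in>{1..d}. block_norm N \<sigma> p x i) * (\<Sum>i\<in>{1..d}. lg i x b)"
      unfolding norm_grad_def c_fun_def by simp
  qed (simp add: c_fun_def)
qed

lemma continuous_power_sum:
  assumes i: "i \<in> {1..d}" shows "continuous_on (Collect positive) (\<lambda>x. power_sum x i)"
  unfolding power_sum_def
proof (intro continuous_on_sum continuous_on_powr continuous_on_rabs continuous_on_const
    continuous_on_product_coordinates[THEN continuous_on_subset] ballI)
  fix t x assume "t \<in> {1..n_dim N \<sigma> i}" "x \<in> Collect positive"
  then show "\<bar>x (i, t)\<bar> \<noteq> 0" using positiveD[of x "(i, t)"] i by (auto simp: idx_iff)
qed simp

lemma continuous_c_fun: "continuous_on (Collect positive) (c_fun N d \<sigma> p)"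
  unfolding c_fun_def block_norm_power_sum
  by (intro continuous_intros continuous_power_sum) (use power_sum_pos in force)+

lemma continuous_norm_grad:
  assumes b: "b \<in> idx N d \<sigma>" shows "continuous_on (Collect positive) (\<lambda>x. norm_grad x b)"
proof -
  have i: "fst b \<in> {1..d}" using b by (auto simp: idx_def)
  show ?thesis
    unfolding norm_grad_def
    by (intro continuous_intros continuous_c_fun continuous_power_sum[OF i]
        continuous_on_product_coordinates[THEN continuous_on_subset])
      (use power_sum_pos[OF _ i] positiveD[OF _ b] in force)+
qed

abbreviation eigen_system :: "bvec \<Rightarrow> real \<Rightarrow> bool" where
  "eigen_system xbar \<mu> \<equiv> normalized_system (idx N d \<sigma>) rows a modes entry (\<lambda>b. p (fst b)) total
     (c_fun N d \<sigma> p) norm_grad d xbar \<mu>"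

text \<open>The vectors with entries \<open>\<ge> l\<close> and \<open>c_fun = 1\<close> are bounded because each block norm is at least
  \<open>l\<close> and their product is \<open>1\<close>.\<close>

lemma eigenvector_normalized_system:
  assumes "weighted_system (idx N d \<sigma>) rows a modes entry (\<lambda>b. p (fst b)) total"
    and pos: "positive xbar" and eig: "is_eigenpair m N a d \<sigma> p \<mu> xbar"
  shows "eigen_system xbar \<mu>"
proof -
  interpret weighted_system "idx N d \<sigma>" rows a modes entry "\<lambda>b. p (fst b)" total by fact
  show ?thesis
  proof
    show "0 < d" by (rule d_pos)
    show "c_fun N d \<sigma> p (\<lambda>b. t * x b) = t ^ d * c_fun N d \<sigma> p x" if t: "0 < t" for t x
    proof -
      have "block_norm N \<sigma> p (\<lambda>b. t * x b) i = t * block_norm N \<sigma> p x i" if i: "i \<in> {1..d}" for i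
      proof -
        have pi: "0 < p i" by (rule exponent_pos[OF i])
        have "power_sum (\<lambda>b. t * x b) i = t powr p i * power_sum x i"
          unfolding power_sum_def using t by (simp add: abs_mult powr_mult sum_distrib_left)
        moreover have "0 \<le> power_sum x i" unfolding power_sum_def by (simp add: sum_nonneg)
        ultimately show ?thesis unfolding block_norm_power_sum using t pi by (simp add: powr_mult powr_powr)
      qed
      then show ?thesis unfolding c_fun_def by (simp add: prod.distrib)
    qed
    show "c_fun N d \<sigma> p x = c_fun N d \<sigma> p y" if "\<And>b. b \<in> idx N d \<sigma> \<Longrightarrow> x b = y b" for x y
      using that by (rule c_fun_cong)
    show "0 < c_fun N d \<sigma> p x" if "positive x" for x using that by (rule c_fun_pos)
    show "c_fun N d \<sigma> p x < c_fun N d \<sigma> p y" if x: "positive x" and lt: "\<And>b. b \<in> idx N d \<sigma> \<Longrightarrow> x b < y b" for x y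
    proof -
      have bn: "block_norm N \<sigma> p x i < block_norm N \<sigma> p y i" if "i \<in> {1..d}" for i
        by (rule block_norm_strict_mono[OF that]) (use lt positiveD[OF x] in force)
      show ?thesis unfolding c_fun_def
      proof (rule prod_mono_strict)
        show "1 \<in> {1..d}" "block_norm N \<sigma> p x 1 < block_norm N \<sigma> p y 1" using bn[of 1] d_pos by auto
        fix i assume i: "i \<in> {1..d}"
        show "0 \<le> block_norm N \<sigma> p x i \<and> block_norm N \<sigma> p x i \<le> block_norm N \<sigma> p y i"
          using bn[OF i] block_norm_pos[OF x i] by simp
        show "0 < block_norm N \<sigma> p y i" using bn[OF i] block_norm_pos[OF x i] by simp
      qed simp
    qed
    show "\<exists>u. \<forall>x. (\<forall>b\<in>idx N d \<sigma>. l \<le> x b) \<longrightarrow> c_fun N d \<sigma> p x = 1 \<longrightarrow> (\<forall>b\<in>idx N d \<sigma>. x b \<le> u)" if l: "0 < l" for l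
    proof (intro exI allI impI ballI)
      fix x b assume x: "\<forall>b\<in>idx N d \<sigma>. l \<le> x b" and c: "c_fun N d \<sigma> p x = 1" and b: "b \<in> idx N d \<sigma>"
      obtain i t where b': "b = (i, t)" by (cases b)
      have i: "i \<in> {1..d}" using b b' by (simp add: idx_iff)
      have low: "l \<le> block_norm N \<sigma> p x i" if "i \<in> {1..d}" for i by (rule block_norm_lower[OF l _ that]) (use x in blast)
      have "l ^ (d - 1) = (\<Prod>i\<in>{1..d} - {i}. l)" using i by simp
      also have "\<dots> \<le> (\<Prod>i\<in>{1..d} - {i}. block_norm N \<sigma> p x i)"
        using low l by (intro prod_mono) auto
      finally have "block_norm N \<sigma> p x i * l ^ (d - 1) \<le> block_norm N \<sigma> p x i * (\<Prod>i\<in>{1..d} - {i}. block_norm N \<sigma> p x i)"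
        using low[OF i] l by (intro mult_left_mono) auto
      also have "\<dots> = 1" using c i unfolding c_fun_def by (subst (asm) prod.remove[of _ i]) auto
      finally have "block_norm N \<sigma> p x i \<le> 1 / l ^ (d - 1)" using l by (simp add: field_simps)
      then show "x b \<le> 1 / l ^ (d - 1)" using block_norm_component[of i t x] b b' by force
    qed
    show "quad_approx_on (idx N d \<sigma>) (box l u) (c_fun N d \<sigma> p) norm_grad" if "0 < l" for l u
      using that by (rule c_fun_quad)
    show "0 < norm_grad x b" if "positive x" "b \<in> idx N d \<sigma>" for x b
      unfolding norm_grad_def using c_fun_pos[OF that(1)] power_sum_pos[OF that(1), of "fst b"] positiveD[OF that] that
      by (auto simp: idx_def)
    show "norm_grad x b = norm_grad y b" if eq: "\<And>b. b \<in> idx N d \<sigma> \<Longrightarrow> x b = y b" and b: "b \<in> idx N d \<sigma>" for x y b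
    proof -
      have i: "fst b \<in> {1..d}" using b by (auto simp: idx_def)
      have "power_sum x (fst b) = power_sum y (fst b)" by (rule block_norm_cong(1)[OF eq i])
      then show ?thesis unfolding norm_grad_def using c_fun_cong[OF eq] eq[OF b] by simp
    qed
    show "continuous_on (Collect positive) (c_fun N d \<sigma> p)" by (rule continuous_c_fun)
    show "continuous_on (Collect positive) (\<lambda>x. norm_grad x b)" if "b \<in> idx N d \<sigma>" for b
      using that by (rule continuous_norm_grad)
    show "positive xbar" by fact
    show "c_fun N d \<sigma> p xbar = 1" using eig unfolding c_fun_def is_eigenpair_def by simp
    show "form b xbar = \<mu> * xbar b powr (p (fst b) - 1)" if b: "b \<in> idx N d \<sigma>" for b
      using eig b positiveD[OF pos b] unfolding is_eigenpair_def block_map_eq_form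
      by (cases b) (auto simp: idx_iff)
  qed
qed

end

section \<open>The algorithm LS-NNM\<close>

context shaped_tensor
begin

lemma phi_max_eq: "phi_max m N a d \<sigma> p x = Max ((\<lambda>b. quot b x) ` idx N d \<sigma>)"
  unfolding phi_max_def Phi_eq_quot by simp

lemma phi_max_ge: "b \<in> idx N d \<sigma> \<Longrightarrow> quot b x \<le> phi_max m N a d \<sigma> p x"
  unfolding phi_max_eq using finite_idx by simp

lemma phi_max_attained: "\<exists>b\<in>idx N d \<sigma>. quot b x = phi_max m N a d \<sigma> p x"
proof -
  have "phi_max m N a d \<sigma> p x \<in> (\<lambda>b. quot b x) ` idx N d \<sigma>"
    unfolding phi_max_eq using finite_idx I_nonempty by (intro Max_in) auto
  then show ?thesis by force
qed

lemma phi_max_le_iff: "phi_max m N a d \<sigma> p x \<le> t \<longleftrightarrow> (\<forall>b\<in>idx N d \<sigma>. quot b x \<le> t)"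
  unfolding phi_max_eq using finite_idx I_nonempty by (subst Max_le_iff) auto

lemma phi_max_cong:
  assumes "\<And>b. b \<in> idx N d \<sigma> \<Longrightarrow> x b = y b" shows "phi_max m N a d \<sigma> p x = phi_max m N a d \<sigma> p y"
  unfolding phi_max_eq by (intro arg_cong[where f = Max] image_cong quot_cong assms) auto

lemma H_fun_Some: "H_fun m N a d \<sigma> p x \<mu> (Some b) = \<mu> * x b - quot b x * x b"
  unfolding H_fun_def r_fun_def Phi_eq_quot by simp

lemma H_fun_None: "H_fun m N a d \<sigma> p x \<mu> None = c_fun N d \<sigma> p x - 1"
  unfolding H_fun_def by simp

lemma DH_fun_Some_Some:
  assumes x: "positive x" and b: "b \<in> idx N d \<sigma>" and b': "b' \<in> idx N d \<sigma>"
  shows "DH_fun m N a d \<sigma> p x \<mu> (Some b) (Some b') = \<mu> * (if b' = b then 1 else 0) - scaled_grad b x b'"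
proof -
  have "quad_approx_on (idx N d \<sigma>) (box l u) (\<lambda>x. \<mu> * x b + - 1 * (quot b x * x b))
      (\<lambda>x b'. \<mu> * (if b' = b then 1 else 0) + - 1 * scaled_grad b x b')" if "0 < l" for l u
    by (rule quad_approx_on_add[OF quad_approx_on_cmult[OF coord_quad[OF that b]]
          quad_approx_on_cmult[OF scaled_quad[OF that b]]])
  then have "((\<lambda>s. \<mu> * (x(b' := s)) b + - 1 * (quot b (x(b' := s)) * (x(b' := s)) b))
      has_real_derivative \<mu> * (if b' = b then 1 else 0) + - 1 * scaled_grad b x b') (at (x b'))"
    by (rule partial_derivative_positive[OF _ x b'])
  then show ?thesis
    unfolding DH_fun_def pderiv_at_def option.case H_fun_Some by (intro DERIV_imp_deriv) simp
qed

lemma DH_fun_None_Some: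
  assumes x: "positive x" and b: "b \<in> idx N d \<sigma>"
  shows "DH_fun m N a d \<sigma> p x \<mu> None (Some b) = norm_grad x b"
proof -
  have "((\<lambda>s. c_fun N d \<sigma> p (x(b := s))) has_real_derivative norm_grad x b) (at (x b))"
    by (rule partial_derivative_positive[OF c_fun_quad x b])
  then have "((\<lambda>s. c_fun N d \<sigma> p (x(b := s)) - 1) has_real_derivative norm_grad x b - 0) (at (x b))"
    by (rule DERIV_diff) (rule DERIV_const)
  then show ?thesis
    unfolding DH_fun_def pderiv_at_def option.case H_fun_None by (intro DERIV_imp_deriv) simp
qed

lemma DH_fun_Some_None: "DH_fun m N a d \<sigma> p x \<mu> (Some b) None = x b"
  unfolding DH_fun_def option.case H_fun_Some
  by (rule DERIV_imp_deriv) (auto intro!: derivative_eq_intros)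

lemma DH_fun_None_None: "DH_fun m N a d \<sigma> p x \<mu> None None = 0"
  unfolding DH_fun_def option.case H_fun_None by simp

lemma newton_step_imp_newton:
  assumes ns: "eigen_system xbar \<mu>"
    and x: "positive x" "c_fun N d \<sigma> p x = 1" and step: "newton_step m N a d \<sigma> p x lam v \<delta>"
  shows "normalized_system.newton (idx N d \<sigma>) rows a modes entry (\<lambda>b. p (fst b)) norm_grad x lam v \<delta>"
proof -
  interpret normalized_system "idx N d \<sigma>" rows a modes entry "\<lambda>b. p (fst b)" total "c_fun N d \<sigma> p" norm_grad d xbar \<mu>
    by fact
  have eq: "(\<Sum>b\<in>idx N d \<sigma>. DH_fun m N a d \<sigma> p x lam h (Some b) * v b)
        + DH_fun m N a d \<sigma> p x lam h None * \<delta> + H_fun m N a d \<sigma> p x lam h = 0"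
    if "h \<in> H_idx N d \<sigma>" for h
    using step that unfolding newton_step_def by blast
  show ?thesis unfolding newton_def
  proof (intro conjI ballI)
    fix b assume b: "b \<in> idx N d \<sigma>"
    have "(\<Sum>b'\<in>idx N d \<sigma>. DH_fun m N a d \<sigma> p x lam (Some b) (Some b') * v b')
        = (\<Sum>b'\<in>idx N d \<sigma>. (if b' = b then lam * v b else 0) - scaled_grad b x b' * v b')"
      by (intro sum.cong) (auto simp: DH_fun_Some_Some[OF x(1) b] left_diff_distrib)
    also have "\<dots> = jac lam x v b"
      unfolding jac_def using b finite_idx by (simp add: sum_subtractf)
    finally show "jac lam x v b + x b * \<delta> + (lam * x b - quot b x * x b) = 0"
      using eq[of "Some b"] b by (simp add: H_idx_def DH_fun_Some_None H_fun_Some)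
  next
    have "(\<Sum>b\<in>idx N d \<sigma>. DH_fun m N a d \<sigma> p x lam None (Some b) * v b) = (\<Sum>b\<in>idx N d \<sigma>. norm_grad x b * v b)"
      by (intro sum.cong) (auto simp: DH_fun_None_Some[OF x(1)])
    then show "(\<Sum>b\<in>idx N d \<sigma>. norm_grad x b * v b) = 0"
      using eq[of None] x(2) by (simp add: H_idx_def DH_fun_None_None H_fun_None)
  qed
qed

text \<open>If \<open>x\<close> is any eigenvector, its absolute value is a subsolution for the absolute value of the eigenvalue,
  by the triangle inequality; normalization of the first block provides an index where it is not below
  \<open>xbar\<close>.\<close>

lemma spectral_radius_eq:
  assumes ns: "eigen_system xbar \<mu>" and pair: "is_eigenpair m N a d \<sigma> p \<mu> xbar"
  shows "spectral_radius_\<sigma>p m N a d \<sigma> p = \<mu>"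
proof -
  interpret normalized_system "idx N d \<sigma>" rows a modes entry "\<lambda>b. p (fst b)" total "c_fun N d \<sigma> p" norm_grad d xbar \<mu>
    by fact
  have le: "\<bar>\<kappa>\<bar> \<le> \<mu>" if ev: "is_eigenpair m N a d \<sigma> p \<kappa> x" for \<kappa> x
  proof -
    define z where "z = (\<lambda>b. \<bar>x b\<bar>)"
    have one: "1 \<in> {1..d}" using d_pos by simp
    have "\<exists>t. (1, t) \<in> idx N d \<sigma> \<and> xbar (1, t) \<le> z (1, t)"
    proof (rule ccontr)
      assume "\<not> ?thesis"
      then have "block_norm N \<sigma> p x 1 < block_norm N \<sigma> p xbar 1"
        unfolding z_def using xbar_gt_0 by (intro block_norm_strict_mono[OF one]) force
      then show False using ev pair one unfolding is_eigenpair_def by simp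
    qed
    then obtain b0 where b0: "b0 \<in> idx N d \<sigma>" "xbar b0 \<le> z b0" by blast
    show ?thesis
    proof (rule eigenvalue_le[where z = z and ?b0.0 = b0, OF _ b0])
      show "0 \<le> z b" for b unfolding z_def by simp
      fix b assume b: "b \<in> idx N d \<sigma>"
      have "form b x = \<kappa> * (\<bar>x b\<bar> powr (p (fst b) - 1) * sgn (x b))"
        using ev b unfolding is_eigenpair_def block_map_eq_form by (cases b) (auto simp: idx_iff)
      then have "\<bar>\<kappa>\<bar> * z b powr (p (fst b) - 1) = \<bar>form b x\<bar>"
        unfolding z_def by (cases "x b = 0") (auto simp: abs_mult abs_sgn_eq)
      also have "\<dots> \<le> (\<Sum>j\<in>rows b. \<bar>a j * monomial b j x\<bar>)" unfolding form_def by (rule sum_abs)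
      also have "\<dots> = form b z"
        unfolding form_def monomial_def z_def using a_nonneg[OF b] by (simp add: abs_mult abs_prod)
      finally show "\<bar>\<kappa>\<bar> * z b powr (p (fst b) - 1) \<le> form b z" .
    qed
  qed
  show ?thesis
    unfolding spectral_radius_\<sigma>p_def
  proof (rule cSup_eq_maximum)
    show "\<mu> \<in> {\<bar>\<kappa>\<bar> |\<kappa>. is_eigenvalue m N a d \<sigma> p \<kappa>}"
      using pair \<mu>_nonneg unfolding is_eigenvalue_def by (auto intro!: exI[of _ \<mu>])
  qed (use le in \<open>auto simp: is_eigenvalue_def\<close>)
qed

lemma LS_NNM_converges:
  assumes ns: "eigen_system xbar \<mu>"
    and \<eta>: "0 < \<eta>" "\<eta> < 1" and \<rho>: "0 < \<rho>" "\<rho> < 1" and u0: "u0 \<in> C_set N d \<sigma> p"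
    and alg: "LS_NNM m N a d \<sigma> p \<eta> \<rho> u0 xs ls ds \<delta>s \<alpha>s"
  shows "converges_quadratically (\<lambda>v. L2_set v (idx N d \<sigma>)) xs xbar"
    and "converges_quadratically abs ls \<mu>"
    and "\<forall>\<^sub>F k in sequentially. \<alpha>s k = 1"
proof -
  interpret normalized_system "idx N d \<sigma>" rows a modes entry "\<lambda>b. p (fst b)" total "c_fun N d \<sigma> p" norm_grad d xbar \<mu>
    by fact
  let ?I = "idx N d \<sigma>"
  let ?c = "c_fun N d \<sigma> p"
  have R: "R_fun N d \<sigma> p x = retract x" for x
    unfolding R_fun_def retract_def by (rule ext) simp
  have move: "move x \<alpha> v = (\<lambda>b. x b + \<alpha> * v b)" for x \<alpha> v unfolding move_def ..
  have start: "\<And>b. b \<in> ?I \<Longrightarrow> xs 0 b = R_fun N d \<sigma> p u0 b" "ls 0 = phi_max m N a d \<sigma> p (xs 0)"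
    using alg unfolding LS_NNM_def by blast+
  have stop: "(\<forall>b\<in>?I. xs (Suc k) b = xs k b) \<and> ls (Suc k) = ls k \<and> (\<forall>b\<in>?I. ds k b = 0) \<and> \<delta>s k = 0 \<and> \<alpha>s k = 1"
    if "H_zero m N a d \<sigma> p (xs k) (ls k)" for k
    using alg that unfolding LS_NNM_def by presburger
  have go: "newton_step m N a d \<sigma> p (xs k) (ls k) (ds k) (\<delta>s k) \<and>
               \<alpha>s k \<in> admissible_steps m N a d \<sigma> p \<eta> \<rho> (xs k) (ds k) (\<delta>s k) \<and>
               (\<forall>\<beta>\<in>admissible_steps m N a d \<sigma> p \<eta> \<rho> (xs k) (ds k) (\<delta>s k). \<beta> \<le> \<alpha>s k) \<and>
               (\<forall>b\<in>?I. xs (Suc k) b = R_fun N d \<sigma> p (move (xs k) (\<alpha>s k) (ds k)) b) \<and>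
               ls (Suc k) = phi_max m N a d \<sigma> p (xs (Suc k))"
    if "\<not> H_zero m N a d \<sigma> p (xs k) (ls k)" for k
    using alg that unfolding LS_NNM_def by presburger
  have adm: "\<alpha> \<in> admissible_steps m N a d \<sigma> p \<eta> \<rho> x v \<delta> \<longleftrightarrow> (\<exists>i. \<alpha> = \<rho> ^ i) \<and>
      positive (\<lambda>b. x b + \<alpha> * v b) \<and>
      phi_max m N a d \<sigma> p (retract (\<lambda>b. x b + \<alpha> * v b)) \<le> phi_max m N a d \<sigma> p x + \<eta> * \<alpha> * \<delta>" for \<alpha> x v \<delta>
    unfolding admissible_steps_def R move positive_vec_eq by simp
  have positive_cong: "positive x \<longleftrightarrow> positive y" if "\<And>b. b \<in> ?I \<Longrightarrow> x b = y b" for x y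
    using that unfolding positive_def by simp

  have inv: "positive (xs k) \<and> ?c (xs k) = 1 \<and> ls k = phi_max m N a d \<sigma> p (xs k)" for k
  proof (induction k)
    case 0
    have u: "positive u0" "?c u0 = 1" using u0 unfolding C_set_def positive_vec_eq by auto
    have "xs 0 b = u0 b" if "b \<in> ?I" for b
      using start(1)[OF that] retract_eq_self[OF u(2)] unfolding R by simp
    then show ?case using u start(2) positive_cong[of "xs 0" u0] c_fun_cong[of "xs 0" u0] by simp
  next
    case (Suc k)
    show ?case
    proof (cases "H_zero m N a d \<sigma> p (xs k) (ls k)")
      case True
      have eq: "xs (Suc k) b = xs k b" if "b \<in> ?I" for b using stop[OF True] that by blast
      show ?thesis
        using Suc stop[OF True] positive_cong[OF eq] c_fun_cong[OF eq] phi_max_cong[OF eq] by simp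
    next
      case False
      define z where "z = (\<lambda>b. xs k b + \<alpha>s k * ds k b)"
      have zpos: "positive z" using go[OF False] unfolding adm z_def by blast
      have eq: "xs (Suc k) b = retract z b" if "b \<in> ?I" for b
        using go[OF False] that unfolding R move z_def by blast
      show ?thesis
        using go[OF False] positive_cong[OF eq] c_fun_cong[OF eq] retract_normalized[OF zpos] by simp
    qed
  qed
  have pos: "positive (xs k)" and c1: "?c (xs k) = 1" and lsk: "ls k = phi_max m N a d \<sigma> p (xs k)" for k
    using inv by auto

  \<comment> \<open>After termination the zero direction is a Newton direction with full step, so both branches
    of the algorithm satisfy the same relations.\<close>
  have nw: "newton (xs k) (ls k) (ds k) (\<delta>s k)" for k
  proof (cases "H_zero m N a d \<sigma> p (xs k) (ls k)")
    case True
    have zero: "ds k b = 0" if "b \<in> ?I" for b using stop[OF True] that by blast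
    have "newton_step m N a d \<sigma> p (xs k) (ls k) (ds k) (\<delta>s k)"
      using True stop[OF True] zero unfolding newton_step_def H_zero_def by simp
    then show ?thesis by (rule newton_step_imp_newton[OF ns pos c1])
  next
    case False
    then show ?thesis using go newton_step_imp_newton[OF ns pos c1] by blast
  qed
  have pow: "\<exists>i. \<alpha>s k = \<rho> ^ i" for k
  proof (cases "H_zero m N a d \<sigma> p (xs k) (ls k)")
    case True
    then show ?thesis using stop[OF True] by (intro exI[of _ 0]) simp
  next
    case False
    then show ?thesis using go unfolding adm by blast
  qed
  have step: "xs (Suc k) b = retract (\<lambda>b. xs k b + \<alpha>s k * ds k b) b" if b: "b \<in> ?I" for k b
  proof (cases "H_zero m N a d \<sigma> p (xs k) (ls k)")
    case True
    have eq: "xs k b + \<alpha>s k * ds k b = xs k b" if "b \<in> ?I" for b using stop[OF True] that by simp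
    have "?c (\<lambda>b. xs k b + \<alpha>s k * ds k b) = 1" using c_fun_cong[OF eq] c1 by simp
    then show ?thesis using retract_eq_self eq[OF b] stop[OF True] b by simp
  next
    case False
    then show ?thesis using go b unfolding R move by blast
  qed
  have dec: "ls (Suc k) \<le> ls k + \<eta> * \<alpha>s k * \<delta>s k" for k
  proof (cases "H_zero m N a d \<sigma> p (xs k) (ls k)")
    case True
    then show ?thesis using stop[OF True] by simp
  next
    case False
    have "phi_max m N a d \<sigma> p (xs (Suc k)) = phi_max m N a d \<sigma> p (retract (\<lambda>b. xs k b + \<alpha>s k * ds k b))"
      by (rule phi_max_cong) (rule step)
    then show ?thesis using go[OF False] lsk unfolding adm by simp
  qed
  have largest: "\<rho> ^ i \<le> \<alpha>s k"
    if "positive (\<lambda>b. xs k b + \<rho> ^ i * ds k b)"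
      and "\<forall>b\<in>?I. quot b (retract (\<lambda>b. xs k b + \<rho> ^ i * ds k b)) \<le> ls k + \<eta> * \<rho> ^ i * \<delta>s k" for k i
  proof (cases "H_zero m N a d \<sigma> p (xs k) (ls k)")
    case True
    then show ?thesis using stop[OF True] \<rho> by (simp add: power_le_one)
  next
    case False
    have "\<rho> ^ i \<in> admissible_steps m N a d \<sigma> p \<eta> \<rho> (xs k) (ds k) (\<delta>s k)"
      unfolding adm using that lsk[of k] by (auto simp: phi_max_le_iff)
    then show ?thesis using go[OF False] by blast
  qed
  have quot_le: "quot b (xs k) \<le> ls k" if "b \<in> ?I" for k b
    using phi_max_ge[OF that] lsk by simp
  have att: "\<exists>b\<in>?I. quot b (xs k) = ls k" for k using phi_max_attained[of "xs k"] lsk by simp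

  note conv = line_search_newton_converges[where xs = xs and ls = ls and ds = ds and \<delta>s = \<delta>s and \<alpha>s = \<alpha>s,
      OF \<eta> \<rho> pos c1 quot_le att nw pow dec largest step]
  show "\<forall>\<^sub>F k in sequentially. \<alpha>s k = 1" by (rule conv(5))
  show "converges_quadratically abs ls \<mu>"
    unfolding converges_quadratically_def by (intro conjI conv(3) conv(4))
  define e where "e = (\<lambda>k. err (xs k))"
  define E where "E = (\<lambda>k. L2_set (xs k - xbar) ?I)"
  have Ee: "E k \<le> e k" for k
    unfolding E_def e_def nrm_def using L2_set_le_sum_abs[of "xs k - xbar" ?I] by simp
  have E0: "0 \<le> E k" for k unfolding E_def by (rule L2_set_nonneg)
  have eE: "e k \<le> real (card ?I) * E k" for k
  proof -
    have "\<bar>xs k b - xbar b\<bar> \<le> E k" if "b \<in> ?I" for b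
      using member_le_L2_set[OF finite_idx that, of "\<lambda>b. \<bar>(xs k - xbar) b\<bar>"] unfolding E_def
      by (simp add: L2_set_def)
    then have "e k \<le> (\<Sum>b\<in>?I. E k)" unfolding e_def nrm_def by (rule sum_mono)
    then show ?thesis by simp
  qed
  obtain K where K: "\<forall>\<^sub>F k in sequentially. e (Suc k) \<le> K * (e k)\<^sup>2"
    using conv(2) unfolding e_def by blast
  show "converges_quadratically (\<lambda>v. L2_set v ?I) xs xbar"
    unfolding converges_quadratically_def
  proof (intro conjI exI)
    have "e \<longlonglongrightarrow> 0" using conv(1) unfolding e_def .
    from real_tendsto_sandwich[OF _ _ tendsto_const this, of E] have "E \<longlonglongrightarrow> 0"
      using E0 Ee by simp
    then show "(\<lambda>k. L2_set (xs k - xbar) ?I) \<longlonglongrightarrow> 0" unfolding E_def .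
    show "\<forall>\<^sub>F k in sequentially. L2_set (xs (Suc k) - xbar) ?I
        \<le> (\<bar>K\<bar> * (real (card ?I))\<^sup>2) * (L2_set (xs k - xbar) ?I)\<^sup>2"
      using K
    proof eventually_elim
      case (elim k)
      have e_nonneg: "0 \<le> e k" unfolding e_def by (rule nrm_nonneg)
      have "E (Suc k) \<le> K * (e k)\<^sup>2" using Ee[of "Suc k"] elim by linarith
      also have "\<dots> \<le> \<bar>K\<bar> * (e k)\<^sup>2" by (intro mult_right_mono) auto
      also have "\<dots> \<le> \<bar>K\<bar> * (real (card ?I) * E k)\<^sup>2"
        using eE[of k] e_nonneg by (intro mult_left_mono power_mono) auto
      finally show ?case unfolding E_def by (simp add: power_mult_distrib mult.assoc)
    qed
  qed
qed

end

theorem theorem4p9: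
  fixes m d :: nat and N :: "nat \<Rightarrow> nat" and a :: "(nat \<Rightarrow> nat) \<Rightarrow> real"
    and \<sigma> :: "nat \<Rightarrow> nat set" and p :: "nat \<Rightarrow> real"
    and xbar u0 :: "nat \<times> nat \<Rightarrow> real" and lambar \<eta> \<rho> :: real
    and xs ds :: "nat \<Rightarrow> nat \<times> nat \<Rightarrow> real" and ls \<delta>s \<alpha>s :: "nat \<Rightarrow> real"
  assumes "1 \<le> m" and "\<forall>l\<in>{1..m}. 1 \<le> N l"
    and "nonneg_tensor m N a"
    and "shape_partition m N d \<sigma>"
    and "\<forall>i\<in>{1..d}. 1 < p i"
    and "(strictly_nonneg m N a d \<sigma> \<and> (\<Sum>i\<in>{1..d}. real (card (\<sigma> i)) / p i) < 1) \<or>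
         (weakly_irreducible m N a d \<sigma> \<and> (\<Sum>i\<in>{1..d}. real (card (\<sigma> i)) / p i) = 1)"
    and "positive_vec N d \<sigma> xbar" and "is_eigenvector m N a d \<sigma> p xbar"
    and "lambar = spectral_radius_\<sigma>p m N a d \<sigma> p"
    and "0 < \<eta>" and "\<eta> < 1" and "0 < \<rho>" and "\<rho> < 1"
    and "u0 \<in> C_set N d \<sigma> p"
    and "LS_NNM m N a d \<sigma> p \<eta> \<rho> u0 xs ls ds \<delta>s \<alpha>s"
  shows "converges_quadratically (\<lambda>v. L2_set v (idx N d \<sigma>)) xs xbar \<and>
         converges_quadratically abs ls lambar \<and>
         (\<forall>\<^sub>F k in sequentially. \<alpha>s k = 1)"
proof -
  interpret shaped_tensor m d N a \<sigma> p by standard fact+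
  obtain \<mu> where pair: "is_eigenpair m N a d \<sigma> p \<mu> xbar"
    using assms(8) unfolding is_eigenvector_def by blast
  have ns: "eigen_system xbar \<mu>"
    using assms(7) by (intro eigenvector_normalized_system weighted_system_if assms(6) pair)
      (simp add: positive_vec_eq)
  have "lambar = \<mu>" using spectral_radius_eq[OF ns pair] assms(9) by simp
  then show ?thesis using LS_NNM_converges[OF ns assms(10-15)] by simp
qed

end
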